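(* Let $n\ge 2$ and $0\le k<n$ be integers. Then $$\max\Big\{\big(2-2^{-1/n}\big)^{-n},\ \sigma(n,k)\Big\}\ \ge\ \sigma(n+1,k+1).$$ In particular, for every $n\ge 2$, $\sigma(n,n-1)\le \sigma(2,1)\le \frac13(\sqrt2+1)$.
   Context: A convex body is a compact convex set with nonempty interior. For a convex body $K\subset\mathbb{R}^n$ and an integer $0\le k<n$, $$\mathrm{Sym}_k(K)=\frac{1}{\mathrm{vol}_n(K)}\max_{\mathcal L}\mathrm{vol}_n\big(K\cap \mathrm{refl}_{\mathcal L}(K)\big),$$ the maximum over all $k$-dimensional affine flats $\mathcal L$, with $\mathrm{refl}_{\mathcal L}$ the orthogonal reflection through $\mathcal L$. Define $\sigma(n,k)=\inf\{\mathrm{Sym}_k(K): K\subset\mathbb{R}^n \text{ a convex body}\}$. *)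

theory Defs
  imports "HOL-Analysis.Analysis"
begin

definition convex_body :: "'a::euclidean_space set \<Rightarrow> bool" where
  "convex_body K \<longleftrightarrow> compact K \<and> convex K \<and> interior K \<noteq> {}"

definition affine_flat :: "nat \<Rightarrow> 'a::euclidean_space set \<Rightarrow> bool" where
  "affine_flat k L \<longleftrightarrow> affine L \<and> aff_dim L = int k"

definition refl_flat :: "'a::euclidean_space set \<Rightarrow> 'a \<Rightarrow> 'a" where
  "refl_flat L x = 2 *\<^sub>R closest_point L x - x"

definition Sym :: "nat \<Rightarrow> 'a::euclidean_space set \<Rightarrow> real" where
  "Sym k K = (SUP L \<in> {L. affine_flat k L}.
       measure lebesgue (K \<inter> refl_flat L ` K)) / measure lebesgue K"

text \<open>sigma(n,k), with the ambient space R^n given as a type of dimension n.\<close>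
definition sigma :: "'a::euclidean_space itself \<Rightarrow> nat \<Rightarrow> real" where
  "sigma _ k = (INF K \<in> {K :: 'a set. convex_body K}. Sym k K)"

end

theory Submission
  imports Defs
begin

text \<open>
Stretch a body by a factor h along one coordinate. As h tends to infinity, the reflections with a nonempty
overlap, written in the unstretched coordinates, subconverge to affine maps that either preserve or reverse
the stretched coordinate, and the overlap is upper semicontinuous. So the symmetry of the tall body is at most
that of the limit maps, up to an arbitrarily small error.

For the cone over K, a limit map that preserves the height acts on each slice, a homothetic copy of K, as a
reflection in a k-flat composed with a translation orthogonal to that flat, that is, as a reflection in a
parallel flat; this gives sigma(n,k). For a limit map that reverses the height, the overlap is at most twice
the volume of the cone between two levels, and maximising over the levels gives (2 - 2 powr (-1/n)) powr (-n).

Iterating from the plane, the maximum is always attained by the symmetry of the planar body K: the other term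
is at most 5/8 for n at least 2, and Sym_1(K) is at least 5/8. For the latter, take an inscribed rectangle which
has largest area among the inscribed parallelograms with two sides in one of its directions. The reflections in
its two axes have overlaps that add up to at least 5/4 of the area of K.

The bound (sqrt 2 + 1)/3 comes from stretching the region 0 \<le> x \<le> 1, 0 \<le> y \<le> min x (sqrt 2 - x), whose area is
sqrt 2 - 1, while the overlaps with all limit maps are at most 1/3.
\<close>

text \<open>Dimensions are types here, so the iteration from the plane to R^n cannot pass through
  the spaces in between. It runs inside \<open>real^'n\<close>: the missing coordinates
  \<open>J\<close> are filled by a unit cube, and only reflections that fix the axes in
  \<open>J\<close> are tested (\<open>F\<close> in \<open>sym_le\<close>). Each cone takes one
  coordinate of \<open>J\<close> as its height, which frees that axis. Once \<open>J\<close> is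
  empty, all reflections are covered. The limit maps are affine involutions with a possible shear,
  not isometries in general; hence volume preservation is shown for arbitrary linear involutions.
  The heights come from a compactness argument by contradiction, and the infimum
  \<open>sigma\<close> is only approached, so every step costs an epsilon. The lower bound 5/8 in
  the plane is there because each cone only yields a maximum of two terms: it keeps the cone term
  from ever exceeding the symmetry of the planar body that is carried along.\<close>

section \<open>Reflections in flats as linear involutions with a normal translation\<close>

text \<open>The linear part of a reflection in a d-flat. The dimension is recorded by the trace, d -
  (n - d), because the trace, like the other clauses, passes to limits of maps.\<close>

definition flat_involution :: "nat \<Rightarrow> ('a::euclidean_space \<Rightarrow> 'a) \<Rightarrow> bool" where
  "flat_involution d S \<longleftrightarrow> linear S \<and> (\<forall>x. S (S x) = x) \<and> (\<forall>x y. S x \<bullet> y = x \<bullet> S y)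
     \<and> (\<Sum>b\<in>Basis. S b \<bullet> b) = 2 * real d - real DIM('a)"

text \<open>Expand along an orthonormal basis of \<open>U\<close>. The trace then counts the basis
  vectors, and this is how dimensions enter \<open>flat_involution\<close>.\<close>

lemma orthogonal_projection_exists:
  fixes U :: "'a::euclidean_space set"
  assumes "subspace U"
  obtains P where "linear P" "\<And>x. P x \<in> U" "\<And>x y. y \<in> U \<Longrightarrow> (x - P x) \<bullet> y = 0"
    "(\<Sum>b\<in>Basis. P b \<bullet> b) = real (dim U)"
proof -
  obtain B where B: "B \<subseteq> U" "pairwise orthogonal B" "\<And>x. x \<in> B \<Longrightarrow> norm x = 1"
      "independent B" "finite B" "card B = dim U" "span B = U"
    by (metis orthonormal_basis_subspace[OF assms] independent_imp_finite)
  note fB = B(5)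
  define P where "P x = (\<Sum>u\<in>B. (x \<bullet> u) *\<^sub>R u)" for x
  have "linear P"
  proof (rule linearI)
    show "P (x + y) = P x + P y" for x y
      by (simp add: P_def inner_add_left scaleR_left_distrib sum.distrib)
    show "P (c *\<^sub>R x) = c *\<^sub>R P x" for c x by (simp add: P_def scaleR_sum_right)
  qed
  moreover have PU: "P x \<in> U" for x
    unfolding P_def B(7)[symmetric] by (intro span_sum span_scale span_base)
  moreover have "(x - P x) \<bullet> y = 0" if "y \<in> U" for x y
  proof -
    have "(x - P x) \<bullet> u = 0" if u: "u \<in> B" for u
    proof -
      have "P x \<bullet> u = (\<Sum>v\<in>B. (x \<bullet> v) * (v \<bullet> u))"
        by (simp add: P_def inner_sum_left)
      also have "\<dots> = (\<Sum>v\<in>B. if v = u then x \<bullet> u else 0)"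
      proof (rule sum.cong[OF refl])
        fix v assume v: "v \<in> B"
        show "(x \<bullet> v) * (v \<bullet> u) = (if v = u then x \<bullet> u else 0)"
        proof (cases "v = u")
          case True
          then show ?thesis using B(3)[OF u] by (simp add: norm_eq_1)
        next
          case False
          then have "v \<bullet> u = 0" using B(2) u v by (auto simp: pairwise_def orthogonal_def)
          then show ?thesis using False by simp
        qed
      qed
      also have "\<dots> = x \<bullet> u" using u fB by simp
      finally show ?thesis by (simp add: inner_diff_left)
    qed
    then have "orthogonal (x - P x) y"
      using that B(7) by (intro orthogonal_to_span[of y B]) (auto simp: orthogonal_def)
    then show ?thesis by (simp add: orthogonal_def)
  qed
  moreover have "(\<Sum>b\<in>Basis. P b \<bullet> b) = real (dim U)"
  proof -
    have "(\<Sum>b\<in>Basis. P b \<bullet> b) = (\<Sum>b\<in>Basis. \<Sum>u\<in>B. (u \<bullet> b) * (u \<bullet> b))"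
      unfolding P_def inner_sum_left inner_scaleR_left by (simp only: inner_commute)
    also have "\<dots> = (\<Sum>u\<in>B. u \<bullet> u)"
      by (subst sum.swap) (simp add: euclidean_inner[symmetric])
    also have "\<dots> = (\<Sum>u\<in>B. 1)"
      using B(3) by (intro sum.cong) (auto simp: norm_eq_1)
    finally show ?thesis using B(6) by simp
  qed
  ultimately show ?thesis using that by blast
qed

lemma closest_point_translated_subspace:
  fixes U :: "'a::euclidean_space set"
  assumes U: "subspace U" and P: "\<And>x. P x \<in> U" "\<And>x y. y \<in> U \<Longrightarrow> (x - P x) \<bullet> y = 0"
  shows "closest_point ((+) a ` U) x = a + P (x - a)"
proof (rule sym, rule closest_point_unique)
  show "convex ((+) a ` U)" using U by (simp add: subspace_imp_convex convex_translation)
  show "closed ((+) a ` U)" using U by (simp add: closed_subspace closed_translation)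
  show "a + P (x - a) \<in> (+) a ` U" using P(1) by auto
  show "\<forall>z\<in>(+) a ` U. dist x (a + P (x - a)) \<le> dist x z"
  proof
    fix z assume "z \<in> (+) a ` U"
    then obtain u where u: "u \<in> U" "z = a + u" by auto
    let ?w = "x - a - P (x - a)" and ?v = "P (x - a) - u"
    have "?v \<in> U" using u(1) P(1) U by (simp add: subspace_diff)
    then have "?w \<bullet> ?v = 0" using P(2) by simp
    then have "norm (?w + ?v) ^ 2 = norm ?w ^ 2 + norm ?v ^ 2"
      by (intro norm_add_Pythagorean) (simp only: orthogonal_def)
    then have "norm ?w ^ 2 \<le> norm (?w + ?v) ^ 2" by simp
    then have "norm ?w \<le> norm (?w + ?v)" by (rule power2_le_imp_le) simp
    then show "dist x (a + P (x - a)) \<le> dist x z"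
      by (simp add: dist_norm u(2) algebra_simps)
  qed
qed

text \<open>With \<open>P\<close> the projection onto the direction space and \<open>a\<close> a
  point of the flat, the reflection is \<open>2 P - id\<close> plus twice the part of
  \<open>a\<close> normal to the flat. Normality is what \<open>S e = - e\<close> expresses.\<close>

lemma affine_flat_reflection:
  fixes L :: "'a::euclidean_space set"
  assumes "affine_flat d L"
  obtains S e where "flat_involution d S" "S e = - e" "refl_flat L = (\<lambda>x. S x + e)"
proof -
  have L: "affine L" "aff_dim L = int d" using assms by (auto simp: affine_flat_def)
  then have "L \<noteq> {}" by force
  then obtain a where a: "a \<in> L" by auto
  define U where "U = (\<lambda>x. - a + x) ` L"
  have U: "subspace U" unfolding U_def using affine_diffs_subspace[OF L(1) a] by simp
  have LU: "L = (+) a ` U" by (auto simp: U_def image_image)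
  have dU: "dim U = d"
    using L(2) aff_dim_subspace[OF U] by (simp add: LU aff_dim_translation_eq)
  obtain P where P: "linear P" "\<And>x. P x \<in> U" "\<And>x y. y \<in> U \<Longrightarrow> (x - P x) \<bullet> y = 0"
    "(\<Sum>b\<in>Basis. P b \<bullet> b) = real (dim U)"
    by (metis orthogonal_projection_exists[OF U])
  interpret P: linear P by fact
  have PP: "P u = u" if "u \<in> U" for u
  proof -
    have "u - P u \<in> U" using U that P(2) by (simp add: subspace_diff)
    then have "(u - P u) \<bullet> (u - P u) = 0" using P(3) by blast
    then show ?thesis by simp
  qed
  have sa: "P x \<bullet> y = P x \<bullet> P y" for x y
    using P(3)[OF P(2)[of x], of y] inner_diff_left[of y "P y" "P x"]
    by (simp only: inner_commute[of "P x"])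
  define S where "S x = 2 *\<^sub>R P x - x" for x
  define e where "e = 2 *\<^sub>R (a - P a)"
  have "linear S" unfolding S_def
    by (intro linear_compose_sub linear_compose_scale_right P(1)) (auto simp: linear_iff)
  moreover have "S (S x) = x" for x
    by (simp add: S_def P.diff P.add PP P(2) scaleR_2)
  moreover have "S x \<bullet> y = x \<bullet> S y" for x y
    using sa[of x y] sa[of y x] by (simp add: S_def inner_diff_left inner_diff_right inner_commute)
  moreover have "(\<Sum>b\<in>Basis. S b \<bullet> b) = 2 * real d - real DIM('a)"
    using P(4) dU by (simp add: S_def inner_diff_left sum_subtractf sum_distrib_left[symmetric] norm_eq_1)
  ultimately have "flat_involution d S" by (auto simp: flat_involution_def)
  moreover have "S e = - e"
    by (simp add: S_def e_def P.diff P.scaleR PP P(2))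
  moreover have "refl_flat L = (\<lambda>x. S x + e)"
  proof
    fix x
    have "closest_point L x = a + P (x - a)"
      unfolding LU by (rule closest_point_translated_subspace[OF U P(2,3)])
    also have "\<dots> = a + P x - P a" by (simp add: P.diff)
    finally show "refl_flat L x = S x + e"
      by (simp only: refl_flat_def S_def e_def scaleR_2) simp
  qed
  ultimately show ?thesis using that by blast
qed

text \<open>The flat is the fixed space of \<open>S\<close> moved by \<open>e / 2\<close>. Its
  dimension is the trace of the projection \<open>(id + S) / 2\<close>.\<close>

lemma reflection_affine_flat:
  fixes S :: "'a::euclidean_space \<Rightarrow> 'a"
  assumes S: "flat_involution d S" and e: "S e = - e"
  obtains L where "affine_flat d L" "refl_flat L = (\<lambda>x. S x + e)"
proof -
  interpret S: linear S using S by (simp add: flat_involution_def)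
  have SS: "\<And>x. S (S x) = x" and sa: "\<And>x y. S x \<bullet> y = x \<bullet> S y"
    and tr: "(\<Sum>b\<in>Basis. S b \<bullet> b) = 2 * real d - real DIM('a)"
    using S by (auto simp: flat_involution_def)
  define U where "U = {x. S x = x}"
  have U: "subspace U" by (auto simp: U_def subspace_def S.add S.scaleR S.zero)
  define P where "P x = (1/2) *\<^sub>R (x + S x)" for x
  have PU: "P x \<in> U" for x by (simp add: U_def P_def S.add S.scaleR SS add.commute)
  have orth: "(x - P x) \<bullet> y = 0" if "y \<in> U" for x y
  proof -
    have "(x - P x) \<bullet> y = (1/2) * (x \<bullet> y - S x \<bullet> y)"
      by (simp add: P_def inner_diff_left inner_add_left field_simps)
    then show ?thesis using sa[of x y] that by (simp add: U_def)
  qed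
  obtain Q where Q: "linear Q" "\<And>x. Q x \<in> U" "\<And>x y. y \<in> U \<Longrightarrow> (x - Q x) \<bullet> y = 0"
    "(\<Sum>b\<in>Basis. Q b \<bullet> b) = real (dim U)"
    by (metis orthogonal_projection_exists[OF U])
  \<comment> \<open>Both are closest-point maps of \<open>U\<close>, so the trace formula for
    \<open>Q\<close> applies to \<open>P\<close>.\<close>
  have "P x = Q x" for x
    using closest_point_translated_subspace[OF U PU orth, of 0 x]
      closest_point_translated_subspace[OF U Q(2,3), of 0 x] by simp
  then have "real (dim U) = (\<Sum>b\<in>Basis. P b \<bullet> b)" using Q(4) by simp
  also have "\<dots> = (1/2) * ((\<Sum>b\<in>(Basis::'a set). b \<bullet> b) + (\<Sum>b\<in>Basis. S b \<bullet> b))"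
    by (simp add: P_def inner_add_left sum.distrib sum_divide_distrib add_divide_distrib)
  also have "\<dots> = real d" using tr by simp
  finally have dU: "dim U = d" by simp
  define L where "L = (+) ((1/2) *\<^sub>R e) ` U"
  have "affine_flat d L"
    using U dU by (simp add: L_def affine_flat_def affine_translation[symmetric] subspace_imp_affine
        aff_dim_translation_eq aff_dim_subspace)
  moreover have "refl_flat L = (\<lambda>x. S x + e)"
  proof
    fix x show "refl_flat L x = S x + e"
      unfolding refl_flat_def L_def
      by (simp add: closest_point_translated_subspace[OF U PU orth] P_def S.diff S.scaleR e
          scaleR_right_distrib scaleR_right_diff_distrib flip: scaleR_left_distrib)
  qed
  ultimately show ?thesis using that by blast
qed

section \<open>Overlaps and the symmetry of a convex body\<close>

text \<open>For a reflection this is the volume of the intersection with the image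
  (\<open>Int_image_reflection\<close>). The preimage form also suits pointwise limits of
  maps.\<close>

definition overlap :: "'a::euclidean_space set \<Rightarrow> ('a \<Rightarrow> 'a) \<Rightarrow> real" where
  "overlap C R = measure lebesgue {x \<in> C. R x \<in> C}"

text \<open>For a convex body and empty \<open>F\<close> this bounds \<open>Sym d C\<close> by
  \<open>s\<close>. Otherwise \<open>F\<close> holds the cube axes of a cylinder, and the
  reflections that fix them are those induced from the lower-dimensional base.\<close>

definition sym_le :: "nat \<Rightarrow> 'a::euclidean_space set \<Rightarrow> 'a set \<Rightarrow> real \<Rightarrow> bool" where
  "sym_le d F C s \<longleftrightarrow> (\<forall>S e. flat_involution d S \<longrightarrow> (\<forall>w\<in>F. S w = w) \<longrightarrow> S e = - e \<longrightarrow>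
      overlap C (\<lambda>x. S x + e) \<le> s * measure lebesgue C)"

lemma flat_involutionD:
  assumes "flat_involution d (S :: 'a::euclidean_space \<Rightarrow> 'a)"
  shows "linear S" "S (S x) = x" "S x \<bullet> y = x \<bullet> S y" "norm (S x) = norm x"
    "(\<Sum>b\<in>Basis. S b \<bullet> b) = 2 * real d - real DIM('a)"
proof -
  show "linear S" "S (S x) = x" "S x \<bullet> y = x \<bullet> S y"
    "(\<Sum>b\<in>Basis. S b \<bullet> b) = 2 * real d - real DIM('a)"
    using assms by (auto simp: flat_involution_def)
  have "S x \<bullet> S x = x \<bullet> S (S x)" using assms by (simp add: flat_involution_def)
  then show "norm (S x) = norm x" using assms by (simp add: flat_involution_def norm_eq_sqrt_inner)
qed

lemma Int_image_reflection:
  assumes "flat_involution d S" "S e = - e"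
  shows "K \<inter> (\<lambda>x. S x + e) ` K = {x \<in> K. S x + e \<in> K}"
proof -
  interpret S: linear S using assms flat_involutionD(1) by blast
  have "S (S x + e) + e = x" for x
    using flat_involutionD(2)[OF assms(1)] assms(2) by (simp add: S.add)
  then show ?thesis by (auto simp: image_iff) metis
qed

lemma compact_overlap_set:
  fixes C :: "'a::euclidean_space set"
  assumes "compact C" "continuous_on UNIV R"
  shows "compact {x \<in> C. R x \<in> C}"
proof -
  have "{x \<in> C. R x \<in> C} = C \<inter> R -` C" by auto
  moreover have "closed (R -` C)"
    using assms by (simp add: closed_vimage compact_imp_closed)
  ultimately show ?thesis using assms by (simp add: compact_Int_closed)
qed

lemma continuous_reflection:
  assumes "flat_involution d S"
  shows "continuous_on UNIV (\<lambda>x. S x + e)"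
  using flat_involutionD(1)[OF assms] by (intro continuous_on_add linear_continuous_on continuous_on_const) (simp add: linear_linear)

lemma overlap_le_measure:
  fixes C :: "'a::euclidean_space set"
  assumes "compact C" "continuous_on UNIV R"
  shows "overlap C R \<le> measure lebesgue C"
  unfolding overlap_def
  by (rule measure_mono_fmeasurable)
     (use lmeasurable_compact[OF compact_overlap_set[OF assms]] lmeasurable_compact[OF assms(1)]
       in \<open>auto simp: fmeasurableD\<close>)

lemma convex_body_measure_pos:
  assumes "convex_body (K :: 'a::euclidean_space set)"
  shows "measure lebesgue K > 0"
proof -
  have K: "compact K" "convex K" "interior K \<noteq> {}" using assms by (auto simp: convex_body_def)
  then have "measure lebesgue K \<noteq> 0"
    using negligible_convex_interior[OF K(2)] lmeasurable_compact[OF K(1)] K(3)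
    by (metis negligible_iff_measure)
  then show ?thesis by (simp add: zero_less_measure_iff)
qed

lemma Sym_upper:
  fixes K :: "'a::euclidean_space set"
  assumes K: "convex_body K" and S: "flat_involution k S" "S e = - e"
  shows "overlap K (\<lambda>x. S x + e) \<le> Sym k K * measure lebesgue K"
proof -
  have cK: "compact K" using K by (simp add: convex_body_def)
  obtain L where L: "affine_flat k L" "refl_flat L = (\<lambda>x. S x + e)"
    using reflection_affine_flat[OF S] by blast
  let ?f = "\<lambda>L. measure lebesgue (K \<inter> refl_flat L ` K)"
  have "?f L \<le> (SUP L \<in> {L. affine_flat k L}. ?f L)"
  proof (rule cSUP_upper)
    show "L \<in> {L. affine_flat k L}" using L by simp
    show "bdd_above (?f ` {L. affine_flat k L})"
    proof (rule bdd_aboveI2)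
      fix M :: "'a set" assume "M \<in> {L. affine_flat k L}"
      then obtain S' e' where S': "flat_involution k S'" "S' e' = - e'" "refl_flat M = (\<lambda>x. S' x + e')"
        using affine_flat_reflection[of k M] by auto
      then show "?f M \<le> measure lebesgue K"
        using overlap_le_measure[OF cK continuous_reflection[OF S'(1)]]
        by (simp add: Int_image_reflection overlap_def)
    qed
  qed
  also have "\<dots> = Sym k K * measure lebesgue K"
    using convex_body_measure_pos[OF K] by (simp add: Sym_def)
  finally show ?thesis using S L by (simp add: Int_image_reflection overlap_def)
qed

lemma coordinate_flat_exists:
  assumes "k \<le> DIM('a)"
  shows "\<exists>L :: 'a::euclidean_space set. affine_flat k L"
proof -
  obtain U :: "'a set" where "subspace U" "dim U = k"
    using choose_subspace_of_subspace[of k "UNIV :: 'a set"] assms by (metis dim_UNIV)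
  then have "affine_flat k U" by (simp add: affine_flat_def subspace_imp_affine aff_dim_subspace)
  then show ?thesis by blast
qed

lemma Sym_le:
  fixes K :: "'a::euclidean_space set"
  assumes K: "convex_body K" and "sym_le k {} K s" "k \<le> DIM('a)"
  shows "Sym k K \<le> s"
proof -
  let ?f = "\<lambda>L. measure lebesgue (K \<inter> refl_flat L ` K)"
  have "(SUP L \<in> {L. affine_flat k L}. ?f L) \<le> s * measure lebesgue K"
  proof (rule cSUP_least)
    show "{L :: 'a set. affine_flat k L} \<noteq> {}" using coordinate_flat_exists assms(3) by auto
    fix M :: "'a set" assume "M \<in> {L. affine_flat k L}"
    then obtain S' e' where S': "flat_involution k S'" "S' e' = - e'" "refl_flat M = (\<lambda>x. S' x + e')"
      using affine_flat_reflection[of k M] by auto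
    then show "?f M \<le> s * measure lebesgue K"
      using assms(2) by (auto simp: Int_image_reflection overlap_def sym_le_def)
  qed
  then show ?thesis using convex_body_measure_pos[OF K] by (simp add: Sym_def field_simps)
qed

lemma Sym_nonneg:
  fixes K :: "'a::euclidean_space set"
  assumes K: "convex_body K" and "k \<le> DIM('a)"
  shows "0 \<le> Sym k K"
proof -
  obtain L :: "'a set" where "affine_flat k L" using coordinate_flat_exists assms by blast
  then obtain S e where S: "flat_involution k S" "S e = - e" "refl_flat L = (\<lambda>x. S x + e)"
    using affine_flat_reflection by blast
  have "0 \<le> overlap K (\<lambda>x. S x + e)" by (simp add: overlap_def)
  also have "\<dots> \<le> Sym k K * measure lebesgue K" by (rule Sym_upper[OF K S(1,2)])
  finally show ?thesis using convex_body_measure_pos[OF K] by (simp add: zero_le_mult_iff)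
qed

lemma sigma_le_Sym:
  fixes K :: "'a::euclidean_space set"
  assumes "convex_body K" "k \<le> DIM('a)"
  shows "sigma TYPE('a) k \<le> Sym k K"
proof -
  have "bdd_below (Sym k ` {K :: 'a set. convex_body K})"
    by (rule bdd_belowI2[where m = 0]) (simp add: Sym_nonneg assms(2))
  then show ?thesis unfolding sigma_def using assms(1) by (intro cINF_lower) auto
qed

lemma convex_body_cball: "convex_body (cball (0::'a::euclidean_space) 1)"
  by (simp add: convex_body_def)

lemma sigma_approx:
  assumes "\<epsilon> > 0"
  obtains K :: "'a::euclidean_space set" where "convex_body K" "Sym k K \<le> sigma TYPE('a) k + \<epsilon>"
proof -
  have ne: "Sym k ` {K :: 'a set. convex_body K} \<noteq> {}" using convex_body_cball by blast
  have "Inf (Sym k ` {K :: 'a set. convex_body K}) < sigma TYPE('a) k + \<epsilon>"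
    using assms by (simp add: sigma_def)
  then obtain x where "x \<in> Sym k ` {K :: 'a set. convex_body K}" "x < sigma TYPE('a) k + \<epsilon>"
    using cInf_lessD[OF ne] by blast
  then show ?thesis using that by auto
qed

section \<open>Limits of reflections of ever taller bodies\<close>

text \<open>Reverse Fatou for sets: the unions of the tails decrease to the limit superior, and the
  common superset \<open>C\<close> of finite measure gives continuity from above.\<close>

lemma measure_limsup_ge:
  fixes E :: "nat \<Rightarrow> 'a::euclidean_space set"
  assumes C: "C \<in> lmeasurable" and E: "\<And>j. E j \<in> sets lebesgue" "\<And>j. E j \<subseteq> C"
    and ge: "\<And>j. \<epsilon> \<le> measure lebesgue (E j)"
    and F: "F \<in> lmeasurable" "\<And>y. (\<exists>\<^sub>F j in sequentially. y \<in> E j) \<Longrightarrow> y \<in> F"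
  shows "\<epsilon> \<le> measure lebesgue F"
proof -
  define G where "G n = (\<Union>j\<in>{n..}. E j)" for n
  have Gs: "G n \<in> sets lebesgue" for n unfolding G_def by (intro sets.countable_UN'') (auto simp: E)
  have GC: "G n \<subseteq> C" for n unfolding G_def using E(2) by blast
  have Gl: "G n \<in> lmeasurable" for n using fmeasurableI2[OF C GC Gs] .
  have El: "E n \<in> lmeasurable" for n using fmeasurableI2[OF C E(2) E(1)] .
  have "decseq G" unfolding G_def decseq_def by fastforce
  then have lim: "(\<lambda>n. measure lebesgue (G n)) \<longlonglongrightarrow> measure lebesgue (\<Inter>n. G n)"
    using Gs fmeasurableD2[OF Gl] by (intro Lim_measure_decseq) (auto simp: top_unique)
  have ge': "\<epsilon> \<le> measure lebesgue (G n)" for n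
  proof -
    have "measure lebesgue (E n) \<le> measure lebesgue (G n)"
      by (rule measure_mono_fmeasurable) (use El Gl in \<open>auto simp: G_def\<close>)
    then show ?thesis using ge[of n] by simp
  qed
  have "\<epsilon> \<le> measure lebesgue (\<Inter>n. G n)"
    by (rule LIMSEQ_le_const[OF lim]) (use ge' in auto)
  also have "\<dots> \<le> measure lebesgue F"
  proof (rule measure_mono_fmeasurable[OF _ _ F(1)])
    show "(\<Inter>n. G n) \<subseteq> F"
    proof
      fix y assume "y \<in> (\<Inter>n. G n)"
      then have "\<exists>\<^sub>F j in sequentially. y \<in> E j"
        by (auto simp: frequently_sequentially G_def)
      then show "y \<in> F" by (rule F(2))
    qed
    show "(\<Inter>n. G n) \<in> sets lebesgue" using Gs by (intro sets.countable_INT'') auto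
  qed
  finally show ?thesis .
qed

definition stretch :: "real \<Rightarrow> 'a::euclidean_space \<Rightarrow> 'a \<Rightarrow> 'a" where
  "stretch h b y = y + ((h - 1) * (y \<bullet> b)) *\<^sub>R b"

lemma linear_stretch: "linear (stretch h b)"
  by (rule linearI) (simp_all add: stretch_def algebra_simps inner_add_left)

lemma stretch_stretch:
  assumes "norm b = 1"
  shows "stretch h b (stretch k b y) = stretch (h * k) b y"
  using assms by (simp add: stretch_def inner_add_left norm_eq_1 algebra_simps)

lemma stretch_1 [simp]: "stretch 1 b = (\<lambda>y. y)"
  by (simp add: stretch_def fun_eq_iff)

text \<open>Conjugation with the stretch multiplies the tilt of \<open>b\<close> under
  \<open>S j\<close> by the factor \<open>h j\<close>; this product \<open>P j\<close> becomes a
  shear. If it were unbounded, the overlaps would be squeezed into ever thinner slabs and lose their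
  volume. Hence \<open>S j\<close>, \<open>P j\<close> and the rescaled translation
  \<open>E j\<close> are bounded and converge along a subsequence, and upper semicontinuity of the
  overlap carries \<open>\<epsilon>\<close> to the limit. The relations between \<open>S'\<close>,
  \<open>p\<close> and \<open>q\<close> are the limits of \<open>S j (S j b) = b\<close> and
  \<open>S j (e j) = - e j\<close>.\<close>

lemma stretched_reflections_limit:
  fixes C :: "'a::euclidean_space set"
  assumes C: "compact C" and b: "norm b = 1" and eps: "\<epsilon> > 0"
    and S: "\<And>j. flat_involution d (S j)" and SF: "\<And>j w. w \<in> F \<Longrightarrow> S j w = w"
    and e: "\<And>j. S j (e j) = - e j"
    and ov: "\<And>j. \<epsilon> \<le> overlap C (\<lambda>y. stretch (1 / real (Suc j)) b (S j (stretch (real (Suc j)) b y) + e j))"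
  shows "\<exists>S' p q. flat_involution d S' \<and> (\<forall>w\<in>F. S' w = w) \<and>
    \<epsilon> \<le> overlap C (\<lambda>y. S' y + (y \<bullet> b) *\<^sub>R p + q) \<and>
    (S' b = b \<and> S' p = - p \<and> S' q = - q \<or>
     S' b = - b \<and> p \<bullet> b = 0 \<and> S' p = p \<and> S' q + q + (q \<bullet> b) *\<^sub>R p = 0)"
proof -
  define h where "h j = real (Suc j)" for j
  define Q where "Q z = z - (z \<bullet> b) *\<^sub>R b" for z :: 'a
  define P where "P j = h j *\<^sub>R Q (S j b)" for j
  define E where "E j = stretch (1 / h j) b (e j)" for j
  define \<sigma> where "\<sigma> j = S j b \<bullet> b" for j
  define R where "R j y = stretch (1 / h j) b (S j (stretch (h j) b y) + e j)" for j y
  have hpos: "h j > 0" and h1: "h j \<ge> 1" for j by (auto simp: h_def)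
  have bb: "b \<bullet> b = 1" using b by (simp add: norm_eq_1)
  have linS: "linear (S j)" for j using flat_involutionD(1)[OF S] .
  have Sadd: "S j (x + y) = S j x + S j y" and Ssc: "S j (c *\<^sub>R x) = c *\<^sub>R S j x"
    and Sdiff: "S j (x - y) = S j x - S j y" for j x y c
    using linS[of j] by (simp_all add: linear_add linear_scale linear_diff)
  have SS: "S j (S j x) = x" and Ssa: "S j x \<bullet> y = x \<bullet> S j y" and Sn: "norm (S j x) = norm x" for j x y
    using flat_involutionD(2-4)[OF S] by auto
  have Qb: "Q z \<bullet> b = 0" for z by (simp add: Q_def inner_diff_left bb)
  have bQ: "b \<bullet> Q z = 0" for z using Qb[of z] by (simp add: inner_commute)
  have Qdec: "z = Q z + (z \<bullet> b) *\<^sub>R b" for z by (simp add: Q_def)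
  have QQ: "w \<bullet> Q z = w \<bullet> z" if "w \<bullet> b = 0" for w z
    using that by (simp add: Q_def inner_diff_right)
  have Qadd: "Q (x + y) = Q x + Q y" and Qsc: "Q (c *\<^sub>R x) = c *\<^sub>R Q x" and Qdiff: "Q (x - y) = Q x - Q y" for x y c
    by (simp_all add: Q_def inner_add_left inner_diff_left scaleR_left_distrib scaleR_right_diff_distrib
        scaleR_left_diff_distrib)
  have Qnorm: "norm (Q z) \<le> norm z" for z
  proof -
    have "norm z ^ 2 = norm (Q z + (z \<bullet> b) *\<^sub>R b) ^ 2" using Qdec[of z] by simp
    also have "\<dots> = norm (Q z) ^ 2 + norm ((z \<bullet> b) *\<^sub>R b) ^ 2"
      by (intro norm_add_Pythagorean) (simp add: orthogonal_def Qb)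
    finally have "norm (Q z) ^ 2 \<le> norm z ^ 2" by simp
    then show ?thesis by (rule power2_le_imp_le) simp
  qed
  have st: "stretch c b z = Q z + (c * (z \<bullet> b)) *\<^sub>R b" for c z
    by (simp add: stretch_def Q_def left_diff_distrib scaleR_left_diff_distrib)
  have Pb: "P j \<bullet> b = 0" for j by (simp add: P_def Qb)
  have bP: "b \<bullet> P j = 0" for j using Pb[of j] by (simp add: inner_commute)
  have QP: "Q z \<bullet> P j = z \<bullet> P j" for z j using QQ[OF Pb, of j z] by (simp add: inner_commute)
  have SQb: "S j (Q y) \<bullet> b = (Q y \<bullet> P j) / h j" for j y
  proof -
    have "S j (Q y) \<bullet> b = Q y \<bullet> S j b" by (simp add: Ssa)
    also have "\<dots> = Q y \<bullet> Q (S j b)" by (simp add: QQ Qb)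
    finally show ?thesis using hpos[of j] by (simp add: P_def)
  qed
  \<comment> \<open>The conjugated map, split into components across and along \<open>b\<close>. The
    term over the square of \<open>h j\<close> is the one that disappears in the limit.\<close>
  have Rform: "R j y = Q (S j (Q y)) + (y \<bullet> b) *\<^sub>R P j + ((y \<bullet> b) * \<sigma> j + (Q y \<bullet> P j) / (h j)\<^sup>2) *\<^sub>R b + E j" for j y
  proof -
    have "R j y = stretch (1 / h j) b (S j (Q y)) + (h j * (y \<bullet> b)) *\<^sub>R stretch (1 / h j) b (S j b) + E j"
      unfolding R_def E_def st[of "h j"] using linear_stretch[of "1 / h j" b]
      by (simp add: linear_add linear_scale Sadd Ssc)
    also have "\<dots> = Q (S j (Q y)) + (1 / h j * (S j (Q y) \<bullet> b)) *\<^sub>R b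
        + ((y \<bullet> b) *\<^sub>R P j + (h j * (y \<bullet> b) * (1 / h j * \<sigma> j)) *\<^sub>R b) + E j"
      by (simp add: st P_def \<sigma>_def scaleR_right_distrib mult.commute)
    also have "h j * (y \<bullet> b) * (1 / h j * \<sigma> j) = (y \<bullet> b) * \<sigma> j" using hpos[of j] by simp
    also have "1 / h j * (S j (Q y) \<bullet> b) = (Q y \<bullet> P j) / (h j)\<^sup>2"
      by (simp add: SQb power2_eq_square)
    finally show ?thesis by (simp add: scaleR_left_distrib)
  qed
  have contR: "continuous_on UNIV (R j)" for j
  proof -
    have "linear (\<lambda>y. stretch (1 / h j) b (S j (stretch (h j) b y)))"
      using linear_compose[OF linear_compose[OF linear_stretch linS] linear_stretch] by (simp add: o_def)
    then have "continuous_on UNIV (\<lambda>y. stretch (1 / h j) b (S j (stretch (h j) b y)) + stretch (1 / h j) b (e j))"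
      by (intro continuous_on_add linear_continuous_on continuous_on_const) (simp add: linear_linear)
    then show ?thesis using linear_stretch[of "1 / h j" b] by (simp add: R_def[abs_def] linear_add)
  qed
  define G where "G j = {y \<in> C. R j y \<in> C}" for j
  have Gc: "compact (G j)" for j unfolding G_def by (rule compact_overlap_set[OF C contR])
  have Gm: "\<epsilon> \<le> measure lebesgue (G j)" for j
    using ov[of j] by (simp add: overlap_def G_def R_def h_def)
  have Gne: "G j \<noteq> {}" for j using Gm[of j] eps by auto
  have Gs: "G j \<in> sets lebesgue" for j using lmeasurable_compact[OF Gc] by (simp add: fmeasurableD)
  have GC: "G j \<subseteq> C" for j by (auto simp: G_def)
  have Cl: "C \<in> lmeasurable" using lmeasurable_compact[OF C] .
  obtain D where D0: "D > 0 \<and> (\<forall>x\<in>C. norm x \<le> D)"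
    using compact_imp_bounded[OF C] unfolding bounded_pos by blast
  then have D: "D > 0" "\<And>x. x \<in> C \<Longrightarrow> norm x \<le> D" by auto
  define z where "z j = (SOME y. y \<in> G j)" for j
  have z: "z j \<in> G j" for j using Gne[of j] by (auto simp: z_def some_in_eq)
  \<comment> \<open>Pair the difference of two values of \<open>R j\<close> with \<open>P j\<close>:
    the shear contributes the height difference times the squared norm of \<open>P j\<close>, and
    each of the two remaining terms is at most \<open>2 * D * norm (P j)\<close>.\<close>
  have thin: "\<bar>(y - y') \<bullet> b\<bar> * norm (P j) \<le> 4 * D" if y: "y \<in> G j" "y' \<in> G j" for j y y'
  proof (cases "P j = 0")
    case False
    have nd: "norm (u - v) \<le> 2 * D" if "u \<in> C" "v \<in> C" for u v
      using norm_triangle_ineq4[of u v] D(2)[OF that(1)] D(2)[OF that(2)] by simp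
    have "R j y - R j y' = Q (S j (Q (y - y'))) + ((y - y') \<bullet> b) *\<^sub>R P j
        + (((y - y') \<bullet> b) * \<sigma> j + (Q (y - y') \<bullet> P j) / (h j)\<^sup>2) *\<^sub>R b"
      unfolding Rform by (simp add: Qdiff Sdiff inner_diff_left algebra_simps diff_divide_distrib)
    then have "(R j y - R j y') \<bullet> P j = S j (Q (y - y')) \<bullet> P j + ((y - y') \<bullet> b) * (P j \<bullet> P j)"
      by (simp add: inner_add_left bP QP)
    then have "((y - y') \<bullet> b) * (norm (P j))\<^sup>2 = (R j y - R j y') \<bullet> P j - S j (Q (y - y')) \<bullet> P j"
      by (simp add: power2_norm_eq_inner)
    then have "\<bar>(y - y') \<bullet> b\<bar> * (norm (P j))\<^sup>2 = \<bar>(R j y - R j y') \<bullet> P j - S j (Q (y - y')) \<bullet> P j\<bar>"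
      by (metis abs_mult abs_power2)
    also have "\<dots> \<le> \<bar>(R j y - R j y') \<bullet> P j\<bar> + \<bar>S j (Q (y - y')) \<bullet> P j\<bar>" by (rule abs_triangle_ineq4)
    also have "\<dots> \<le> norm (R j y - R j y') * norm (P j) + norm (S j (Q (y - y'))) * norm (P j)"
      by (intro add_mono Cauchy_Schwarz_ineq2)
    also have "\<dots> \<le> (2 * D) * norm (P j) + (2 * D) * norm (P j)"
    proof (intro add_mono mult_right_mono norm_ge_zero)
      show "norm (R j y - R j y') \<le> 2 * D" using y by (intro nd) (auto simp: G_def)
      have "norm (y - y') \<le> 2 * D" using y by (intro nd) (auto simp: G_def)
      then show "norm (S j (Q (y - y'))) \<le> 2 * D" using Qnorm[of "y - y'"] by (simp add: Sn)
    qed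
    finally have "(\<bar>(y - y') \<bullet> b\<bar> * norm (P j)) * norm (P j) \<le> (4 * D) * norm (P j)"
      by (simp add: power2_eq_square algebra_simps)
    then show ?thesis using False by simp
  qed (use D in auto)
  \<comment> \<open>Otherwise choose indices along which \<open>P\<close> grows. The heights of
    points \<open>z\<close> of the overlap sets converge to some \<open>\<tau>\<close> along a
    subsequence, and by \<open>thin\<close> the sets close in on the hyperplane at height
    \<open>\<tau>\<close>, which is null, although each has measure at least
    \<open>\<epsilon>\<close>.\<close>
  have "bounded (range P)"
  proof (rule ccontr)
    assume nb: "\<not> bounded (range P)"
    have "\<exists>j. norm (P j) > real n + 1" for n
    proof (rule ccontr)
      assume "\<not> ?thesis"
      then have "\<forall>x\<in>range P. norm x \<le> real n + 1" by (auto simp: not_less)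
      then show False using nb by (meson boundedI)
    qed
    then obtain k where k: "\<And>n. norm (P (k n)) > real n + 1" by metis
    define t where "t n = z (k n) \<bullet> b" for n
    have "\<bar>t n\<bar> \<le> D" for n
      using Cauchy_Schwarz_ineq2[of "z (k n)" b] D(2)[of "z (k n)"] z GC b by (force simp: t_def)
    then have "bounded (range t)" by (intro boundedI[where B = D]) auto
    then obtain \<tau> r where r: "strict_mono r" "(t \<circ> r) \<longlonglongrightarrow> \<tau>"
      using bounded_imp_convergent_subsequence by blast
    have "\<epsilon> \<le> measure lebesgue {y. b \<bullet> y = \<tau>}"
    proof (rule measure_limsup_ge[OF Cl, where E = "\<lambda>n. G (k (r n))"])
      have neg: "negligible {y. b \<bullet> y = \<tau>}" using bb by (intro negligible_hyperplane) auto
      then show "{y. b \<bullet> y = \<tau>} \<in> lmeasurable" by (rule negligible_imp_measurable)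
      fix y assume fr: "\<exists>\<^sub>F j in sequentially. y \<in> G (k (r j))"
      show "y \<in> {y. b \<bullet> y = \<tau>}"
      proof (rule ccontr)
        assume "y \<notin> {y. b \<bullet> y = \<tau>}"
        then have d: "\<bar>y \<bullet> b - \<tau>\<bar> / 2 > 0" (is "?d > 0") by (simp add: inner_commute)
        have "\<forall>\<^sub>F n in sequentially. \<bar>t (r n) - \<tau>\<bar> < ?d"
          using tendstoD[OF r(2) d] by (simp add: dist_real_def)
        moreover have "\<forall>\<^sub>F n in sequentially. 4 * D / (real n + 1) < ?d"
        proof -
          have "(\<lambda>n. 4 * D / (real n + 1)) \<longlonglongrightarrow> 0"
            using LIMSEQ_inverse_real_of_nat[THEN tendsto_mult_right, of "4 * D"]
            by (simp add: field_simps)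
          then show ?thesis using d by (rule order_tendstoD(2))
        qed
        ultimately have "\<forall>\<^sub>F n in sequentially. y \<notin> G (k (r n))"
        proof eventually_elim
          case (elim n)
          show ?case
          proof
            assume "y \<in> G (k (r n))"
            then have 1: "\<bar>(y - z (k (r n))) \<bullet> b\<bar> * norm (P (k (r n))) \<le> 4 * D" using thin z by blast
            have "real n \<le> real (r n)" using r(1) by (simp add: seq_suble)
            then have 2: "real n + 1 \<le> norm (P (k (r n)))" using k[of "r n"] by linarith
            have "\<bar>(y - z (k (r n))) \<bullet> b\<bar> * (real n + 1) \<le> 4 * D"
              using mult_left_mono[OF 2, of "\<bar>(y - z (k (r n))) \<bullet> b\<bar>"] 1 by linarith
            then have "\<bar>(y - z (k (r n))) \<bullet> b\<bar> \<le> 4 * D / (real n + 1)" by (simp add: field_simps)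
            then have "\<bar>y \<bullet> b - t (r n)\<bar> < ?d" using elim by (simp add: t_def inner_diff_left)
            moreover have "\<bar>y \<bullet> b - \<tau>\<bar> \<le> \<bar>y \<bullet> b - t (r n)\<bar> + \<bar>t (r n) - \<tau>\<bar>" by linarith
            ultimately show False using elim(1) field_sum_of_halves[of "\<bar>y \<bullet> b - \<tau>\<bar>"] by argo
          qed
        qed
        then show False using fr by (simp add: frequently_def)
      qed
    qed (use Gs GC Gm in auto)
    moreover have "measure lebesgue {y. b \<bullet> y = \<tau>} = 0"
      using bb by (intro negligible_imp_measure0 negligible_hyperplane) auto
    ultimately show False using eps by simp
  qed
  then obtain B where B: "\<And>j. norm (P j) \<le> B" by (auto simp: bounded_iff)
  have B0: "B \<ge> 0" using B[of 0] norm_ge_zero order_trans by blast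
  have sig: "\<bar>\<sigma> j\<bar> \<le> 1" for j
    using Cauchy_Schwarz_ineq2[of "S j b" b] b by (simp add: \<sigma>_def Sn)
  \<comment> \<open>Solve the formula for \<open>R j\<close> for \<open>E j\<close> at a point of
    the overlap set, where every other term is bounded.\<close>
  have "norm (E j) \<le> D + D + D * B + (D + D * B)" for j
  proof -
    let ?y = "z j"
    have y: "norm ?y \<le> D" "norm (R j ?y) \<le> D" using z[of j] D(2) by (auto simp: G_def)
    have yb: "\<bar>?y \<bullet> b\<bar> \<le> D" using Cauchy_Schwarz_ineq2[of ?y b] b y by simp
    have tri: "norm (u - v - w - x) \<le> norm u + norm v + norm w + norm x" for u v w x :: 'a
      using norm_triangle_ineq4[of "u - v - w" x] norm_triangle_ineq4[of "u - v" w] norm_triangle_ineq4[of u v]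
      by linarith
    have "E j = R j ?y - Q (S j (Q ?y)) - (?y \<bullet> b) *\<^sub>R P j
       - ((?y \<bullet> b) * \<sigma> j + (Q ?y \<bullet> P j) / (h j)\<^sup>2) *\<^sub>R b"
      unfolding Rform by (simp add: algebra_simps)
    then have "norm (E j) \<le> norm (R j ?y) + norm (Q (S j (Q ?y))) + norm ((?y \<bullet> b) *\<^sub>R P j)
       + norm (((?y \<bullet> b) * \<sigma> j + (Q ?y \<bullet> P j) / (h j)\<^sup>2) *\<^sub>R b)"
      using tri by metis
    also have "\<dots> \<le> D + D + D * B + (D + D * B)"
    proof (intro add_mono)
      show "norm (R j ?y) \<le> D" by (rule y)
      show "norm (Q (S j (Q ?y))) \<le> D" using Qnorm[of "S j (Q ?y)"] Qnorm[of ?y] y by (simp add: Sn)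
      show "norm ((?y \<bullet> b) *\<^sub>R P j) \<le> D * B" using yb B[of j] D(1) by (simp add: mult_mono)
      have "\<bar>Q ?y \<bullet> P j\<bar> \<le> norm (Q ?y) * norm (P j)" by (rule Cauchy_Schwarz_ineq2)
      also have "\<dots> \<le> D * B" using Qnorm[of ?y] y B[of j] D(1) by (intro mult_mono) auto
      finally have "\<bar>Q ?y \<bullet> P j\<bar> \<le> D * B" .
      moreover have "\<bar>(Q ?y \<bullet> P j) / (h j)\<^sup>2\<bar> \<le> \<bar>Q ?y \<bullet> P j\<bar>"
      proof -
        have "1 \<le> (h j)\<^sup>2" using h1[of j] by simp
        then have "\<bar>Q ?y \<bullet> P j\<bar> / (h j)\<^sup>2 \<le> \<bar>Q ?y \<bullet> P j\<bar> / 1" by (intro divide_left_mono) auto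
        then show ?thesis by simp
      qed
      moreover have "\<bar>(?y \<bullet> b) * \<sigma> j\<bar> \<le> D * 1"
        unfolding abs_mult using yb sig[of j] D(1) by (intro mult_mono) auto
      moreover have "norm (((?y \<bullet> b) * \<sigma> j + (Q ?y \<bullet> P j) / (h j)\<^sup>2) *\<^sub>R b)
         = \<bar>(?y \<bullet> b) * \<sigma> j + (Q ?y \<bullet> P j) / (h j)\<^sup>2\<bar>"
        by (simp only: norm_scaleR b mult_1_right)
      ultimately show "norm (((?y \<bullet> b) * \<sigma> j + (Q ?y \<bullet> P j) / (h j)\<^sup>2) *\<^sub>R b) \<le> D + D * B"
        by linarith
    qed
    finally show ?thesis .
  qed
  then have bE: "bounded (range E)" by (intro boundedI[where B = "D + D + D * B + (D + D * B)"]) auto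
  \<comment> \<open>As bounded operators the maps \<open>S j\<close> lie in a normed space of finite
    dimension, so one subsequence serves them together with \<open>P\<close> and
    \<open>E\<close>.\<close>
  define T where "T j = Blinfun (S j)" for j
  have bl: "bounded_linear (S j)" for j using linS by (simp add: linear_linear)
  have T: "blinfun_apply (T j) = S j" for j by (simp add: T_def bounded_linear_Blinfun_apply bl)
  have "norm (T j) \<le> 1" for j by (rule norm_blinfun_bound) (auto simp: T Sn)
  then have bT: "bounded (range T)" by (intro boundedI[where B = 1]) auto
  have "range (\<lambda>j. (T j, P j, E j)) \<subseteq> range T \<times> range P \<times> range E" by auto
  then have "bounded (range (\<lambda>j. (T j, P j, E j)))"
    by (rule bounded_subset[OF bounded_Times[OF bT bounded_Times[OF \<open>bounded (range P)\<close> bE]]])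
  then obtain l r where r: "strict_mono r" and lim: "((\<lambda>j. (T j, P j, E j)) \<circ> r) \<longlonglongrightarrow> l"
    using bounded_imp_convergent_subsequence by blast
  obtain T' p q where l: "l = (T', p, q)" by (cases l) auto
  define S' where "S' = blinfun_apply T'"
  have limT: "(\<lambda>j. T (r j)) \<longlonglongrightarrow> T'" and limP: "(\<lambda>j. P (r j)) \<longlonglongrightarrow> p" and limE: "(\<lambda>j. E (r j)) \<longlonglongrightarrow> q"
    using tendsto_fst[OF lim] tendsto_fst[OF tendsto_snd[OF lim]] tendsto_snd[OF tendsto_snd[OF lim]]
    by (auto simp: l o_def)
  have limS: "(\<lambda>j. S (r j) (x j)) \<longlonglongrightarrow> S' x'" if "x \<longlonglongrightarrow> x'" for x x'
    using blinfun.tendsto[OF limT that] by (simp add: T S'_def)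
  have limS0: "(\<lambda>j. S (r j) x) \<longlonglongrightarrow> S' x" for x by (rule limS) simp
  have limQ: "(\<lambda>j. Q (x j)) \<longlonglongrightarrow> Q x'" if "x \<longlonglongrightarrow> x'" for x x'
    unfolding Q_def by (intro tendsto_intros that)
  have limh: "(\<lambda>j. 1 / h (r j)) \<longlonglongrightarrow> 0"
    using LIMSEQ_subseq_LIMSEQ[OF LIMSEQ_inverse_real_of_nat r] by (simp add: h_def o_def inverse_eq_divide)
  have limh2: "(\<lambda>j. x j / (h (r j))\<^sup>2) \<longlonglongrightarrow> 0" if "x \<longlonglongrightarrow> x'" for x :: "nat \<Rightarrow> real" and x'
    using tendsto_mult[OF that tendsto_mult[OF limh limh]] by (simp add: power2_eq_square)
  have linS': "linear S'" unfolding S'_def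
    by (rule bounded_linear.linear[OF blinfun.bounded_linear_right])
  have S'S': "S' (S' x) = x" for x
    using LIMSEQ_unique[OF limS[OF limS0[of x]]] by (simp add: SS)
  have S'sa: "S' x \<bullet> y = x \<bullet> S' y" for x y
  proof -
    have "(\<lambda>j. S (r j) x \<bullet> y) \<longlonglongrightarrow> S' x \<bullet> y" "(\<lambda>j. x \<bullet> S (r j) y) \<longlonglongrightarrow> x \<bullet> S' y"
      by (intro tendsto_intros limS0)+
    then show ?thesis by (simp add: Ssa LIMSEQ_unique)
  qed
  have S'tr: "(\<Sum>b\<in>Basis. S' b \<bullet> b) = 2 * real d - real DIM('a)"
  proof -
    have "(\<lambda>j. \<Sum>b\<in>Basis. S (r j) b \<bullet> b) \<longlonglongrightarrow> (\<Sum>b\<in>Basis. S' b \<bullet> b)"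
      by (intro tendsto_intros limS0)
    then show ?thesis by (simp add: flat_involutionD(5)[OF S] LIMSEQ_const_iff)
  qed
  have invS': "flat_involution d S'" using linS' S'S' S'sa S'tr by (simp add: flat_involution_def)
  have S'F: "S' w = w" if "w \<in> F" for w
    using LIMSEQ_unique[OF limS0[of w]] SF[OF that] by simp
  define s where "s = S' b \<bullet> b"
  have lims: "(\<lambda>j. \<sigma> (r j)) \<longlonglongrightarrow> s" unfolding \<sigma>_def s_def by (intro tendsto_intros limS0)
  \<comment> \<open>The tilt of \<open>b\<close> is \<open>P j / h j\<close>, which tends to 0; so
    \<open>b\<close> is an eigenvector of the limit.\<close>
  have S'b: "S' b = s *\<^sub>R b"
  proof -
    have "(\<lambda>j. (1 / h (r j)) *\<^sub>R P (r j)) \<longlonglongrightarrow> 0 *\<^sub>R p" by (intro tendsto_intros limh limP)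
    moreover have "(1 / h j) *\<^sub>R P j = Q (S j b)" for j using hpos[of j] by (simp add: P_def)
    ultimately have "Q (S' b) = 0" using LIMSEQ_unique[OF limQ[OF limS0]] by auto
    then show ?thesis using Qdec[of "S' b"] by (simp add: s_def)
  qed
  have s1: "s = 1 \<or> s = -1"
  proof -
    have "norm (S' b) = 1" using flat_involutionD(4)[OF invS'] b by simp
    then show ?thesis using S'b b by (simp add: abs_eq_iff')
  qed
  have pb: "p \<bullet> b = 0"
  proof -
    have "(\<lambda>j. P (r j) \<bullet> b) \<longlonglongrightarrow> p \<bullet> b" by (intro tendsto_intros limP)
    then show ?thesis by (simp add: Pb LIMSEQ_const_iff)
  qed
  \<comment> \<open>\<open>S j\<close> maps \<open>P j\<close> to \<open>- \<sigma> j\<close> times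
    \<open>P j\<close>, up to a multiple of \<open>b\<close> of size
    \<open>(P j \<bullet> P j) / h j\<close>, which vanishes in the limit.\<close>
  have S'p: "S' p = - s *\<^sub>R p"
  proof -
    have SP: "S j (P j) = (1 / h j * (P j \<bullet> P j)) *\<^sub>R b - \<sigma> j *\<^sub>R P j" for j
    proof -
      have Sb: "S j b = Q (S j b) + \<sigma> j *\<^sub>R b" using Qdec[of "S j b"] by (simp add: \<sigma>_def)
      have 1: "S j (Q (S j b)) = (1 - (\<sigma> j)\<^sup>2) *\<^sub>R b - \<sigma> j *\<^sub>R Q (S j b)"
      proof -
        have "S j (Q (S j b)) = b - \<sigma> j *\<^sub>R S j b"
          by (simp add: Q_def Sdiff Ssc SS \<sigma>_def)
        also have "\<dots> = b - \<sigma> j *\<^sub>R (Q (S j b) + \<sigma> j *\<^sub>R b)" using Sb by simp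
        finally show ?thesis by (simp add: algebra_simps power2_eq_square)
      qed
      have "1 = (norm (S j b))\<^sup>2" using b by (simp add: Sn)
      also have "\<dots> = (norm (Q (S j b) + \<sigma> j *\<^sub>R b))\<^sup>2" using Sb by simp
      also have "\<dots> = (norm (Q (S j b)))\<^sup>2 + (norm (\<sigma> j *\<^sub>R b))\<^sup>2"
        by (intro norm_add_Pythagorean) (simp add: orthogonal_def Qb)
      finally have "1 - (\<sigma> j)\<^sup>2 = Q (S j b) \<bullet> Q (S j b)" using b by (simp add: power2_norm_eq_inner)
      then have "1 / h j * (P j \<bullet> P j) = h j * (1 - (\<sigma> j)\<^sup>2)" using hpos[of j] by (simp add: P_def)
      moreover have "S j (P j) = (h j * (1 - (\<sigma> j)\<^sup>2)) *\<^sub>R b - \<sigma> j *\<^sub>R P j"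
        unfolding P_def Ssc 1 by (simp add: scaleR_right_diff_distrib mult.commute)
      ultimately show ?thesis by simp
    qed
    have "(\<lambda>j. (1 / h (r j) * (P (r j) \<bullet> P (r j))) *\<^sub>R b - \<sigma> (r j) *\<^sub>R P (r j))
       \<longlonglongrightarrow> (0 * (p \<bullet> p)) *\<^sub>R b - s *\<^sub>R p"
      by (intro tendsto_intros limh limP lims)
    then have "(\<lambda>j. S (r j) (P (r j))) \<longlonglongrightarrow> - s *\<^sub>R p" by (simp add: SP)
    then show ?thesis using LIMSEQ_unique[OF limS[OF limP]] by blast
  qed
  have eE: "e j = Q (E j) + (h j * (E j \<bullet> b)) *\<^sub>R b" for j
  proof -
    have "stretch (h j) b (E j) = e j" using hpos[of j] by (simp add: E_def stretch_stretch[OF b])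
    then show ?thesis by (simp add: st)
  qed
  \<comment> \<open>\<open>S j (e j) = - e j\<close> in rescaled terms. Its component along
    \<open>b\<close>, divided by \<open>h j\<close>, gives \<open>e1\<close> in the limit; its
    component across \<open>b\<close> gives \<open>e2\<close>.\<close>
  have Se: "S j (Q (E j)) + (h j * (E j \<bullet> b)) *\<^sub>R S j b = - Q (E j) - (h j * (E j \<bullet> b)) *\<^sub>R b" for j
    using e[of j] unfolding eE[of j] by (simp add: Sadd Ssc)
  have e1: "(q \<bullet> b) * (1 + s) = 0"
  proof -
    have eq: "(E j \<bullet> b) * (1 + \<sigma> j) = - ((Q (E j) \<bullet> P j) / (h j)\<^sup>2)" for j
    proof -
      have "(S j (Q (E j)) + (h j * (E j \<bullet> b)) *\<^sub>R S j b) \<bullet> b = (- Q (E j) - (h j * (E j \<bullet> b)) *\<^sub>R b) \<bullet> b"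
        using Se by simp
      then have "(Q (E j) \<bullet> P j) / h j + h j * (E j \<bullet> b) * \<sigma> j = - (h j * (E j \<bullet> b))"
        by (simp add: inner_add_left inner_diff_left SQb Qb bb \<sigma>_def)
      then show ?thesis using hpos[of j] by (simp add: field_simps power2_eq_square)
    qed
    have l1: "(\<lambda>j. (E (r j) \<bullet> b) * (1 + \<sigma> (r j))) \<longlonglongrightarrow> (q \<bullet> b) * (1 + s)"
      by (intro tendsto_intros limE lims)
    have l2: "(\<lambda>j. - ((Q (E (r j)) \<bullet> P (r j)) / (h (r j))\<^sup>2)) \<longlonglongrightarrow> - 0"
      by (intro tendsto_minus limh2[OF tendsto_inner[OF limQ[OF limE] limP]])
    show ?thesis using LIMSEQ_unique[OF l1[unfolded eq] l2] by simp
  qed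
  have e2: "Q (S' (Q q)) + (q \<bullet> b) *\<^sub>R p = - Q q"
  proof -
    have eq: "Q (S j (Q (E j))) + (E j \<bullet> b) *\<^sub>R P j = - Q (E j)" for j
    proof -
      have "Q (S j (Q (E j)) + (h j * (E j \<bullet> b)) *\<^sub>R S j b) = Q (- Q (E j) - (h j * (E j \<bullet> b)) *\<^sub>R b)"
        using Se by simp
      moreover have "Q b = 0" by (simp add: Q_def bb)
      moreover have "Q (- Q x) = - Q x" for x by (simp add: Q_def inner_diff_left bb)
      ultimately show ?thesis by (simp add: Qadd Qdiff Qsc P_def mult.commute)
    qed
    have "(\<lambda>j. Q (S (r j) (Q (E (r j)))) + (E (r j) \<bullet> b) *\<^sub>R P (r j)) \<longlonglongrightarrow> Q (S' (Q q)) + (q \<bullet> b) *\<^sub>R p"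
      by (intro tendsto_intros limQ limS limE limP)
    moreover have "(\<lambda>j. - Q (E (r j))) \<longlonglongrightarrow> - Q q" by (intro tendsto_intros limQ limE)
    ultimately show ?thesis unfolding eq using LIMSEQ_unique by blast
  qed
  define R' where "R' y = S' y + (y \<bullet> b) *\<^sub>R p + q" for y
  have S'Q: "Q (S' (Q y)) = S' (Q y)" for y
  proof -
    have "S' (Q y) \<bullet> b = Q y \<bullet> S' b" by (simp add: S'sa)
    then show ?thesis by (simp add: S'b Qb Q_def[of "S' (Q y)"])
  qed
  have S'Q2: "S' (Q y) = S' y - ((y \<bullet> b) * s) *\<^sub>R b" for y
    using linS' by (simp add: Q_def linear_diff linear_scale S'b)
  have QSQ: "Q (S' (Q y)) = S' y - ((y \<bullet> b) * s) *\<^sub>R b" for y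
    by (rule trans[OF S'Q S'Q2])
  have limR: "(\<lambda>j. R (r j) y) \<longlonglongrightarrow> R' y" for y
  proof -
    have "(\<lambda>j. R (r j) y) \<longlonglongrightarrow> Q (S' (Q y)) + (y \<bullet> b) *\<^sub>R p + ((y \<bullet> b) * s + 0) *\<^sub>R b + q"
      unfolding Rform
      by (rule tendsto_add[OF tendsto_add[OF tendsto_add[OF limQ[OF limS0] tendsto_scaleR[OF tendsto_const limP]]
          tendsto_scaleR[OF tendsto_add[OF tendsto_mult[OF tendsto_const lims]
          limh2[OF tendsto_inner[OF tendsto_const limP]]] tendsto_const]] limE])
    also have "Q (S' (Q y)) + (y \<bullet> b) *\<^sub>R p + ((y \<bullet> b) * s + 0) *\<^sub>R b + q = R' y"
      unfolding QSQ by (simp add: R'_def)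
    finally show ?thesis .
  qed
  have contR': "continuous_on UNIV R'"
    unfolding R'_def using linS'
    by (intro continuous_intros linear_continuous_on) (simp add: linear_linear)
  have "\<epsilon> \<le> overlap C R'"
    unfolding overlap_def
  proof (rule measure_limsup_ge[OF Cl, where E = "\<lambda>n. G (r n)"])
    show "{y \<in> C. R' y \<in> C} \<in> lmeasurable" using lmeasurable_compact[OF compact_overlap_set[OF C contR']] .
    fix y assume fr: "\<exists>\<^sub>F j in sequentially. y \<in> G (r j)"
    have "y \<in> C" using fr by (auto simp: G_def frequently_ex dest!: frequently_ex)
    moreover have "R' y \<in> C"
    proof (rule ccontr)
      assume "R' y \<notin> C"
      then have "\<forall>\<^sub>F j in sequentially. R (r j) y \<in> - C"
        using compact_imp_closed[OF C] limR[of y] by (intro topological_tendstoD) auto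
      then have "\<forall>\<^sub>F j in sequentially. y \<notin> G (r j)" by eventually_elim (auto simp: G_def)
      then show False using fr by (simp add: frequently_def)
    qed
    ultimately show "y \<in> {y \<in> C. R' y \<in> C}" by simp
  qed (use Gs GC Gm in auto)
  moreover have "S' b = b \<and> S' p = - p \<and> S' q = - q \<or>
     S' b = - b \<and> p \<bullet> b = 0 \<and> S' p = p \<and> S' q + q + (q \<bullet> b) *\<^sub>R p = 0"
  proof (cases "s = 1")
    case True
    then have "q \<bullet> b = 0" using e1 by simp
    then have "S' q = - q" using e2 S'Q[of q] by (simp add: Q_def)
    then show ?thesis using True S'b S'p by simp
  next
    case False
    then have s: "s = -1" using s1 by simp
    have "S' q + q + (q \<bullet> b) *\<^sub>R p = 0"
      using e2 unfolding QSQ s by (simp add: Q_def algebra_simps)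
    then show ?thesis using s S'b S'p pb by simp
  qed
  ultimately show ?thesis using invS' S'F unfolding R'_def by blast
qed

section \<open>Lebesgue measure under linear maps\<close>

lemma emeasure_compact_eq_measure:
  fixes X :: "'a::euclidean_space set"
  assumes "compact X"
  shows "emeasure lborel X = ennreal (measure lebesgue X)"
proof -
  have "emeasure lborel X = emeasure lebesgue X"
    using assms by (simp add: borel_compact)
  also have "\<dots> = ennreal (measure lebesgue X)"
    using lmeasurable_compact[OF assms] by (intro emeasure_eq_measure2) (auto simp: fmeasurable_def)
  finally show ?thesis .
qed

lemma nn_integral_lborel_shift:
  fixes u :: "'a::euclidean_space \<Rightarrow> ennreal"
  assumes [measurable]: "u \<in> borel_measurable borel"
  shows "(\<integral>\<^sup>+x. u (a + x) \<partial>lborel) = (\<integral>\<^sup>+x. u x \<partial>lborel)"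
proof -
  have "(\<integral>\<^sup>+x. u x \<partial>lborel) = (\<integral>\<^sup>+x. u x \<partial>distr lborel borel ((+) a))"
    by (simp add: lborel_distr_plus)
  also have "\<dots> = (\<integral>\<^sup>+x. u (a + x) \<partial>lborel)" by (subst nn_integral_distr) auto
  finally show ?thesis by simp
qed

text \<open>Uniqueness of translation-invariant measures, in the form needed for the image of Lebesgue measure
  under a linear bijection.\<close>

lemma linear_vimage_lborel_swap:
  fixes f g :: "'a::euclidean_space \<Rightarrow> 'a"
  assumes f: "linear f" and fg: "\<And>x. f (g x) = x"
    and A[measurable]: "A \<in> sets borel" and B[measurable]: "B \<in> sets borel"
  shows "emeasure lborel (f -` A) * emeasure lborel B = emeasure lborel A * emeasure lborel {x. - f x \<in> B}"
proof -
  have fm[measurable]: "f \<in> borel_measurable borel"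
    using f by (intro borel_measurable_continuous_onI linear_continuous_on) (simp add: linear_linear)
  have fadd: "f (x + y) = f x + f y" for x y using f by (simp add: linear_add)
  have fA: "f -` A \<in> sets borel" using measurable_sets[OF fm A] by simp
  have contf: "continuous_on X f" for X
    using f by (intro linear_continuous_on) (simp add: linear_linear)
  have mB: "{x. - f x \<in> B} \<in> sets borel"
    using measurable_sets[OF borel_measurable_continuous_onI[OF continuous_on_minus[OF contf]] B]
    by (simp add: vimage_def)
  have ind1: "(\<lambda>x. indicator X (h x) :: ennreal) \<in> borel_measurable borel"
    if "X \<in> sets borel" "continuous_on UNIV h" for X :: "'a set" and h :: "'a \<Rightarrow> 'a"
    by (rule measurable_compose[OF borel_measurable_continuous_onI[OF that(2)] borel_measurable_indicator[OF that(1)]])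
  have ind2: "(\<lambda>p. indicator X (h p) :: ennreal) \<in> borel_measurable (lborel \<Otimes>\<^sub>M lborel)"
    if "X \<in> sets borel" "continuous_on UNIV h" for X :: "'a set" and h :: "'a \<times> 'a \<Rightarrow> 'a"
  proof -
    have "(\<lambda>p. indicator X (h p) :: ennreal) \<in> borel_measurable borel"
      by (rule measurable_compose[OF borel_measurable_continuous_onI[OF that(2)] borel_measurable_indicator[OF that(1)]])
    then show ?thesis unfolding lborel_prod by simp
  qed
  have "emeasure lborel (f -` A) * emeasure lborel B
      = (\<integral>\<^sup>+y. (\<integral>\<^sup>+x. indicator A (f x) \<partial>lborel) * indicator B y \<partial>lborel)"
  proof -
    have "(\<integral>\<^sup>+x. indicator A (f x) \<partial>lborel) = (\<integral>\<^sup>+x. indicator (f -` A) x \<partial>lborel)"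
      by (intro nn_integral_cong) (auto simp: indicator_def)
    also have "\<dots> = emeasure lborel (f -` A)" using fA by (intro nn_integral_indicator) auto
    finally show ?thesis by (subst nn_integral_cmult) auto
  qed
  \<comment> \<open>Shifting \<open>x\<close> by \<open>g y\<close> turns \<open>f x\<close> into
    \<open>y + f x\<close>. After exchanging the integrals, a shift of \<open>y\<close> by
    \<open>- f x\<close> moves the dependence on \<open>x\<close> from \<open>A\<close> to
    \<open>B\<close>, and a last shift by \<open>g y\<close> separates the factors.\<close>
  also have "\<dots> = (\<integral>\<^sup>+y. (\<integral>\<^sup>+x. indicator A (y + f x) * indicator B y \<partial>lborel) \<partial>lborel)"
  proof (rule nn_integral_cong)
    fix y
    have "(\<integral>\<^sup>+x. indicator A (f x) \<partial>lborel) = (\<integral>\<^sup>+x. indicator A (f (g y + x)) \<partial>lborel :: ennreal)"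
      by (rule nn_integral_lborel_shift[symmetric, where u = "\<lambda>x. indicator A (f x)"])
        (intro ind1 A contf)
    also have "\<dots> = (\<integral>\<^sup>+x. indicator A (y + f x) \<partial>lborel)" by (simp add: fadd fg)
    finally show "(\<integral>\<^sup>+x. indicator A (f x) \<partial>lborel) * indicator B y
        = (\<integral>\<^sup>+x. indicator A (y + f x) * indicator B y \<partial>lborel :: ennreal)"
      by (subst nn_integral_multc) (auto intro!: ind1 A continuous_intros contf)
  qed
  also have "\<dots> = (\<integral>\<^sup>+x. (\<integral>\<^sup>+y. indicator A (y + f x) * indicator B y \<partial>lborel) \<partial>lborel)"
    by (rule lborel_pair.Fubini'[where f = "\<lambda>x y. indicator A (y + f x) * indicator B y"])
      (unfold case_prod_beta, intro borel_measurable_times_ennreal ind2 A B continuous_intros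
        continuous_on_compose2[OF contf[of UNIV]], auto)
  also have "\<dots> = (\<integral>\<^sup>+x. (\<integral>\<^sup>+y. indicator A y * indicator B (y - f x) \<partial>lborel) \<partial>lborel)"
  proof (rule nn_integral_cong)
    fix x
    show "(\<integral>\<^sup>+y. indicator A (y + f x) * indicator B y \<partial>lborel)
        = (\<integral>\<^sup>+y. indicator A y * indicator B (y - f x) \<partial>lborel :: ennreal)"
      by (subst nn_integral_lborel_shift[symmetric, where a = "- f x" and u = "\<lambda>y. indicator A (y + f x) * indicator B y"])
         (intro borel_measurable_times_ennreal ind1 A B continuous_intros, simp)
  qed
  also have "\<dots> = (\<integral>\<^sup>+y. (\<integral>\<^sup>+x. indicator A y * indicator B (y - f x) \<partial>lborel) \<partial>lborel)"
    by (rule lborel_pair.Fubini'[where f = "\<lambda>y x. indicator A y * indicator B (y - f x)"])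
      (unfold case_prod_beta, intro borel_measurable_times_ennreal ind2 A B continuous_intros
        continuous_on_compose2[OF contf[of UNIV]], auto)
  also have "\<dots> = (\<integral>\<^sup>+y. indicator A y * emeasure lborel {x. - f x \<in> B} \<partial>lborel)"
  proof (rule nn_integral_cong)
    fix y
    have "(\<integral>\<^sup>+x. indicator B (y - f x) \<partial>lborel) = (\<integral>\<^sup>+x. indicator B (y - f (g y + x)) \<partial>lborel :: ennreal)"
      by (rule nn_integral_lborel_shift[symmetric, where u = "\<lambda>x. indicator B (y - f x)"])
        (intro ind1 B contf continuous_intros)
    also have "\<dots> = (\<integral>\<^sup>+x. indicator {x. - f x \<in> B} x \<partial>lborel)"
      by (intro nn_integral_cong) (simp add: fadd fg indicator_def)
    also have "\<dots> = emeasure lborel {x. - f x \<in> B}" using mB by (intro nn_integral_indicator) simp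
    finally show "(\<integral>\<^sup>+x. indicator A y * indicator B (y - f x) \<partial>lborel)
        = (indicator A y * emeasure lborel {x. - f x \<in> B} :: ennreal)"
      by (subst nn_integral_cmult) (auto intro!: ind1 B continuous_intros contf)
  qed
  also have "\<dots> = emeasure lborel A * emeasure lborel {x. - f x \<in> B}"
    by (subst nn_integral_multc) auto
  finally show ?thesis .
qed

lemma emeasure_ball_pos_finite:
  "emeasure lborel (ball (0::'a::euclidean_space) 1) \<noteq> 0" "emeasure lborel (ball (0::'a) 1) \<noteq> \<infinity>"
proof -
  show "emeasure lborel (ball (0::'a) 1) \<noteq> \<infinity>"
    using emeasure_bounded_finite[of "ball (0::'a) 1"] by auto
  show "emeasure lborel (ball (0::'a) 1) \<noteq> 0"
    using content_ball_pos[of 1 "0::'a"] by (auto simp: measure_def)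
qed

text \<open>Test against the unit ball, which is its own preimage under \<open>- f\<close>.\<close>

lemma emeasure_vimage_isometry:
  fixes f g :: "'a::euclidean_space \<Rightarrow> 'a"
  assumes f: "linear f" and fg: "\<And>x. f (g x) = x" and n: "\<And>x. norm (f x) = norm x" and A: "A \<in> sets borel"
  shows "emeasure lborel (f -` A) = emeasure lborel A"
proof -
  have "{x. - f x \<in> ball 0 1} = ball (0::'a) 1" using n by auto
  then have "emeasure lborel (f -` A) * emeasure lborel (ball (0::'a) 1) = emeasure lborel A * emeasure lborel (ball (0::'a) 1)"
    using linear_vimage_lborel_swap[OF f fg A borel_open[OF open_ball], of 0 1] by simp
  then show ?thesis using emeasure_ball_pos_finite[where 'a = 'a]
    by (metis mult_divide_eq_ennreal infinity_ennreal_def)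
qed

text \<open>Applied to the preimage \<open>?C\<close> of the unit ball \<open>?B\<close>, the
  exchange identity says that the two have equal squared volumes, hence equal volumes; with this,
  the ball can again serve as test set. It stands in for the fact that the determinant is 1 or
  -1.\<close>

lemma emeasure_vimage_involution:
  fixes f :: "'a::euclidean_space \<Rightarrow> 'a"
  assumes f: "linear f" and ff: "\<And>x. f (f x) = x" and A: "A \<in> sets borel"
  shows "emeasure lborel (f -` A) = emeasure lborel A"
proof -
  let ?B = "ball (0::'a) 1" and ?C = "f -` ball (0::'a) 1"
  have fm: "f \<in> borel_measurable borel"
    using f by (intro borel_measurable_continuous_onI linear_continuous_on) (simp add: linear_linear)
  have C: "?C \<in> sets borel" using measurable_sets[OF fm, of ?B] by simp
  have mC: "{x. - f x \<in> ?B} = ?C" by auto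
  have fC: "f -` ?C = ?B" using ff by auto
  have "emeasure lborel ?B * emeasure lborel ?B = emeasure lborel ?C * emeasure lborel ?C"
    using linear_vimage_lborel_swap[OF f ff C borel_open[OF open_ball], of 0 1] by (simp only: mC fC)
  moreover have "emeasure lborel ?C \<noteq> \<infinity>"
  proof
    assume "emeasure lborel ?C = \<infinity>"
    then have "emeasure lborel ?B * emeasure lborel ?B = \<infinity>" using calculation by (simp add: ennreal_mult_top)
    then show False using emeasure_ball_pos_finite[where 'a = 'a] by (simp add: ennreal_mult_eq_top_iff)
  qed
  ultimately have eq: "emeasure lborel ?C = emeasure lborel ?B"
  proof -
    obtain c where c: "c \<ge> 0" "emeasure lborel ?C = ennreal c"
      using \<open>emeasure lborel ?C \<noteq> \<infinity>\<close> by (cases "emeasure lborel ?C") auto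
    obtain d where d: "d \<ge> 0" "emeasure lborel ?B = ennreal d"
      using emeasure_ball_pos_finite(2)[where 'a = 'a] by (cases "emeasure lborel ?B") auto
    have "d * d = c * c"
      using \<open>emeasure lborel ?B * emeasure lborel ?B = emeasure lborel ?C * emeasure lborel ?C\<close> c d
      by (simp add: ennreal_mult[symmetric])
    then have "d = c" using c d by (metis abs_of_nonneg real_sqrt_abs2)
    then show ?thesis using c d by simp
  qed
  have "emeasure lborel (f -` A) * emeasure lborel ?B = emeasure lborel A * emeasure lborel ?B"
    using linear_vimage_lborel_swap[OF f ff A borel_open[OF open_ball], of 0 1] by (simp only: mC eq)
  then show ?thesis using emeasure_ball_pos_finite[where 'a = 'a]
    by (metis mult_divide_eq_ennreal infinity_ennreal_def)
qed

lemma measure_diagonal_image: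
  fixes X :: "(real^'n) set"
  assumes "compact X" "\<And>i. c i > 0"
  shows "measure lebesgue ((\<lambda>x. \<chi> i. c i * x $ i) ` X) = (\<Prod>i\<in>UNIV. c i) * measure lebesgue X"
proof -
  let ?T = "\<lambda>x::real^'n. \<chi> i. c i * x $ i"
  define k :: "real^'n \<Rightarrow> real" where "k b = c (SOME i. b = axis i 1)" for b
  have k: "k (axis i 1) = c i" for i
    by (simp add: k_def axis_eq_axis some_equality)
  have B: "(Basis :: (real^'n) set) = range (\<lambda>i. axis i 1)" by (auto simp: Basis_vec_def)
  have inj: "inj (\<lambda>i::'n. axis i (1::real))" by (auto simp: inj_def axis_eq_axis)
  have T: "?T x = 0 + (\<Sum>j\<in>Basis. (k j * (x \<bullet> j)) *\<^sub>R j)" for x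
  proof -
    have "(\<Sum>j\<in>Basis. (k j * (x \<bullet> j)) *\<^sub>R j) = (\<Sum>i\<in>UNIV. (c i * x $ i) *\<^sub>R axis i 1)"
      unfolding B by (subst sum.reindex[OF inj]) (simp add: k inner_axis o_def)
    also have "\<dots> = ?T x"
      by (simp add: vec_eq_iff axis_def if_distrib cong: if_cong)
    finally show ?thesis by simp
  qed
  have P: "(\<Prod>j\<in>Basis. \<bar>k j\<bar>) = (\<Prod>i\<in>UNIV. c i)"
    unfolding B using assms(2) by (subst prod.reindex[OF inj]) (auto simp: k less_imp_le intro!: prod.cong)
  have "k j \<noteq> 0" if "j \<in> Basis" for j using that assms(2) unfolding B by (auto simp: k less_imp_neq[symmetric])
  then have "lborel = density (distr lborel borel (\<lambda>x. 0 + (\<Sum>j\<in>Basis. (k j * (x \<bullet> j)) *\<^sub>R j))) (\<lambda>_. \<Prod>j\<in>Basis. \<bar>k j\<bar>)"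
    by (rule lborel_affine_euclidean)
  then have eq: "lborel = density (distr lborel borel ?T) (\<lambda>_. \<Prod>i\<in>UNIV. c i)"
    unfolding P T[symmetric] .
  have contT: "continuous_on UNIV ?T" by (intro continuous_intros)
  have Tm: "?T \<in> borel_measurable borel" by (rule borel_measurable_continuous_onI[OF contT])
  have TX: "compact (?T ` X)" using assms(1) contT by (metis compact_continuous_image continuous_on_subset subset_UNIV)
  have inj: "?T -` (?T ` X) = X"
  proof -
    have "x = y" if "?T x = ?T y" for x y
      using that assms(2) by (simp add: vec_eq_iff less_imp_neq[symmetric])
    then show ?thesis by blast
  qed
  have pos: "(\<Prod>i\<in>UNIV. c i) > 0" using assms(2) by (simp add: prod_pos)
  have "emeasure lborel (?T ` X) = emeasure (density (distr lborel borel ?T) (\<lambda>_. \<Prod>i\<in>UNIV. c i)) (?T ` X)"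
    using eq by metis
  also have "\<dots> = (\<Prod>i\<in>UNIV. c i) * emeasure (distr lborel borel ?T) (?T ` X)"
    using borel_compact[OF TX] by (subst emeasure_density_const) auto
  also have "emeasure (distr lborel borel ?T) (?T ` X) = emeasure lborel X"
    using borel_compact[OF TX] Tm by (subst emeasure_distr) (auto simp: inj)
  finally show ?thesis
    unfolding emeasure_compact_eq_measure[OF TX] emeasure_compact_eq_measure[OF assms(1)]
    using pos by (simp add: ennreal_mult[symmetric] measure_nonneg less_imp_le)
qed

subsection \<open>Slicing by a coordinate\<close>

text \<open>Slices orthogonal to a basis vector are thickened to a slab of width one, so that they live in the same space.\<close>

definition slice :: "'a::euclidean_space set \<Rightarrow> 'a \<Rightarrow> real \<Rightarrow> 'a set" where
  "slice X b t = {x. 0 \<le> x \<bullet> b \<and> x \<bullet> b \<le> 1 \<and> x + (t - x \<bullet> b) *\<^sub>R b \<in> X}"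

text \<open>Cavalieri's principle. The map \<open>f\<close> replaces the height of a slab point by
  the first component; the image of the product measure agrees with Lebesgue measure on boxes, hence
  everywhere, and Fubini gives the integral.\<close>

lemma emeasure_slices:
  fixes X :: "'a::euclidean_space set"
  assumes b: "b \<in> Basis" and X: "X \<in> sets borel"
  shows "emeasure lborel X = (\<integral>\<^sup>+t. emeasure lborel (slice X b t) \<partial>lborel)"
proof -
  define A where "A = {p :: real \<times> 'a. 0 \<le> snd p \<bullet> b \<and> snd p \<bullet> b \<le> 1}"
  define f where "f p = snd p + (fst p - snd p \<bullet> b) *\<^sub>R b" for p :: "real \<times> 'a"
  let ?N = "lborel \<Otimes>\<^sub>M lborel :: (real \<times> 'a) measure"
  have sN: "sets ?N = sets borel" by (metis lborel_prod sets_lborel)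
  have fm: "f \<in> borel_measurable borel"
    unfolding f_def by (intro borel_measurable_continuous_onI continuous_intros)
  then have fN[measurable]: "f \<in> borel_measurable ?N"
    using measurable_cong_sets[OF sN refl] by blast
  have "closed A" unfolding A_def
    by (intro closed_Collect_conj closed_Collect_le continuous_intros)
  then have A: "A \<in> sets ?N" unfolding sN by (rule borel_closed)
  have fA: "f -` Y \<inter> A \<in> sets ?N" if "Y \<in> sets borel" for Y
    using sets.Int[OF _ A, of "f -` Y"] measurable_sets[OF fm that] unfolding sN by simp
  have spN: "space ?N = UNIV" by (simp add: space_pair_measure)
  have M: "emeasure (distr (restrict_space ?N A) borel f) Y = emeasure ?N (f -` Y \<inter> A)"
    if "Y \<in> sets borel" for Y
  proof -
    have "emeasure (distr (restrict_space ?N A) borel f) Y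
        = emeasure (restrict_space ?N A) (f -` Y \<inter> space (restrict_space ?N A))"
      by (rule emeasure_distr[OF measurable_restrict_space1[OF fN] that])
    also have "\<dots> = emeasure ?N (f -` Y \<inter> space (restrict_space ?N A))"
      by (rule emeasure_restrict_space) (use A spN in \<open>auto simp: space_restrict_space\<close>)
    finally show ?thesis by (simp only: space_restrict_space spN Int_UNIV_right)
  qed
  have "lborel = distr (restrict_space ?N A) borel f"
  proof (rule lborel_eqI)
    fix l u :: 'a assume le: "\<And>b. b \<in> Basis \<Longrightarrow> l \<bullet> b \<le> u \<bullet> b"
    define l' where "l' = l + (0 - l \<bullet> b) *\<^sub>R b"
    define u' where "u' = u + (1 - u \<bullet> b) *\<^sub>R b"
    \<comment> \<open>The slab factor is closed in the direction \<open>b\<close> and open in the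
      others, so its volume is found by squeezing it between an open and a closed box of equal
      volume.\<close>
    define A2 where "A2 = {x. 0 \<le> x \<bullet> b \<and> x \<bullet> b \<le> 1 \<and> (\<forall>c\<in>Basis - {b}. l \<bullet> c < x \<bullet> c \<and> x \<bullet> c < u \<bullet> c)}"
    have bc: "b \<bullet> c = (if c = b then 1 else 0)" if "c \<in> Basis" for c
      using b that by (simp add: inner_Basis)
    have l'c: "l' \<bullet> c = (if c = b then 0 else l \<bullet> c)" and u'c: "u' \<bullet> c = (if c = b then 1 else u \<bullet> c)"
      if "c \<in> Basis" for c using that by (simp_all add: l'_def u'_def inner_add_left inner_diff_left bc)
    have A2m: "A2 \<in> sets borel" unfolding A2_def by measurable
    have prod: "(\<Prod>c\<in>Basis. (u' - l') \<bullet> c) = (\<Prod>c\<in>Basis - {b}. (u - l) \<bullet> c)"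
      using b by (subst prod.remove[OF finite_Basis b]) (auto simp: inner_diff_left l'c u'c intro!: prod.cong)
    have le': "l' \<bullet> c \<le> u' \<bullet> c" if "c \<in> Basis" for c using le that by (simp add: l'c u'c)
    have "emeasure lborel A2 = (\<Prod>c\<in>Basis - {b}. (u - l) \<bullet> c)"
    proof (rule antisym)
      have "A2 \<subseteq> cbox l' u'" by (auto simp: A2_def mem_box l'c u'c less_imp_le)
      then have "emeasure lborel A2 \<le> emeasure lborel (cbox l' u')" by (intro emeasure_mono) auto
      also have "\<dots> = (\<Prod>c\<in>Basis - {b}. (u - l) \<bullet> c)" using le' prod by (simp add: emeasure_lborel_cbox)
      finally show "emeasure lborel A2 \<le> \<dots>" .
      have "box l' u' \<subseteq> A2" using b by (fastforce simp: A2_def mem_box l'c u'c)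
      then have "emeasure lborel (box l' u') \<le> emeasure lborel A2" using A2m by (intro emeasure_mono) auto
      moreover have "emeasure lborel (box l' u') = (\<Prod>c\<in>Basis - {b}. (u - l) \<bullet> c)"
        using le' prod by (simp add: emeasure_lborel_box)
      ultimately show "(\<Prod>c\<in>Basis - {b}. (u - l) \<bullet> c) \<le> emeasure lborel A2" by simp
    qed
    moreover have "f -` box l u \<inter> A = {l \<bullet> b <..< u \<bullet> b} \<times> A2"
    proof -
      have fc: "f p \<bullet> c = (if c = b then fst p else snd p \<bullet> c)" if "c \<in> Basis" for p c
        using that by (simp add: f_def inner_add_left bc)
      show ?thesis using b
        by (auto simp: A_def A2_def mem_box fc split: if_splits)
    qed
    ultimately have "emeasure (distr (restrict_space ?N A) borel f) (box l u) = emeasure ?N ({l \<bullet> b <..< u \<bullet> b} \<times> A2)"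
      by (simp add: M)
    also have "\<dots> = ennreal (u \<bullet> b - l \<bullet> b) * (\<Prod>c\<in>Basis - {b}. (u - l) \<bullet> c)"
      using \<open>emeasure lborel A2 = _\<close> A2m le[OF b] by (simp add: lborel.emeasure_pair_measure_Times)
    also have "\<dots> = (\<Prod>c\<in>Basis. (u - l) \<bullet> c)"
    proof -
      have "(\<Prod>c\<in>Basis. (u - l) \<bullet> c) = (u \<bullet> b - l \<bullet> b) * (\<Prod>c\<in>Basis - {b}. (u - l) \<bullet> c)"
        by (subst prod.remove[OF finite_Basis b]) (simp add: inner_diff_left)
      moreover have "0 \<le> (\<Prod>c\<in>Basis - {b}. (u - l) \<bullet> c)"
        using le by (intro prod_nonneg) (auto simp: inner_diff_left)
      ultimately show ?thesis using le[OF b] by (simp add: ennreal_mult)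
    qed
    finally show "emeasure (distr (restrict_space ?N A) borel f) (box l u) = (\<Prod>c\<in>Basis. (u - l) \<bullet> c)" .
  qed simp
  then have "emeasure lborel X = emeasure (distr (restrict_space ?N A) borel f) X" by metis
  also have "\<dots> = emeasure ?N (f -` X \<inter> A)"
    by (rule M[OF X])
  also have "\<dots> = (\<integral>\<^sup>+t. emeasure lborel (Pair t -` (f -` X \<inter> A)) \<partial>lborel)"
    by (intro lborel.emeasure_pair_measure_alt fA X)
  also have "\<dots> = (\<integral>\<^sup>+t. emeasure lborel (slice X b t) \<partial>lborel)"
    by (intro nn_integral_cong arg_cong[where f = "emeasure lborel"]) (auto simp: slice_def f_def A_def)
  finally show ?thesis .
qed

lemma compact_slice:
  fixes X :: "'a::euclidean_space set"
  assumes b: "b \<in> Basis" and X: "compact X"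
  shows "compact (slice X b t)"
proof -
  have "closed ((\<lambda>x. x + (t - x \<bullet> b) *\<^sub>R b) -` X)"
    using X by (intro closed_vimage compact_imp_closed continuous_intros)
  moreover have "closed {x. 0 \<le> x \<bullet> b}" "closed {x. x \<bullet> b \<le> 1}"
    by (intro closed_Collect_le continuous_intros)+
  moreover have "slice X b t = (\<lambda>x. x + (t - x \<bullet> b) *\<^sub>R b) -` X \<inter> ({x. 0 \<le> x \<bullet> b} \<inter> {x. x \<bullet> b \<le> 1})"
    by (auto simp: slice_def)
  ultimately have "closed (slice X b t)" by (simp add: closed_Int)
  moreover have "bounded (slice X b t)"
  proof -
    obtain D where D: "\<forall>x\<in>X. norm x \<le> D" using compact_imp_bounded[OF X] by (auto simp: bounded_iff)
    have "norm x \<le> D + (\<bar>t\<bar> + 1)" if "x \<in> slice X b t" for x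
    proof -
      have "norm x = norm ((x + (t - x \<bullet> b) *\<^sub>R b) - (t - x \<bullet> b) *\<^sub>R b)" by simp
      also have "\<dots> \<le> norm (x + (t - x \<bullet> b) *\<^sub>R b) + norm ((t - x \<bullet> b) *\<^sub>R b)" by (rule norm_triangle_ineq4)
      also have "\<dots> \<le> D + (\<bar>t\<bar> + 1)"
      proof (intro add_mono)
        show "norm (x + (t - x \<bullet> b) *\<^sub>R b) \<le> D" using D that by (auto simp: slice_def)
        show "norm ((t - x \<bullet> b) *\<^sub>R b) \<le> \<bar>t\<bar> + 1" using b that by (auto simp: slice_def)
      qed
      finally show ?thesis .
    qed
    then show ?thesis by (auto simp: bounded_iff)
  qed
  ultimately show ?thesis by (simp add: compact_eq_bounded_closed)
qed

lemma nn_integral_indicator_Ioo: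
  fixes g :: "real \<Rightarrow> real"
  assumes g: "continuous_on {a..c} g" and g0: "\<And>t. t \<in> {a..c} \<Longrightarrow> 0 \<le> g t"
  shows "(\<integral>\<^sup>+t. ennreal (g t) * indicator {a<..<c} t \<partial>lborel) = ennreal (integral {a..c} g)"
proof -
  have "(\<integral>\<^sup>+t. ennreal (g t) * indicator {a<..<c} t \<partial>lborel) = (\<integral>\<^sup>+t. ennreal (g t) * indicator {a..c} t \<partial>lborel)"
  proof (intro nn_integral_cong_AE)
    have "AE t in lborel. t \<noteq> a" "AE t in lborel. t \<noteq> c" by (rule AE_lborel_singleton)+
    then show "AE t in lborel. ennreal (g t) * indicator {a<..<c} t = ennreal (g t) * indicator {a..c} t"
      by eventually_elim (auto simp: indicator_def)
  qed
  also have "\<dots> = ennreal (integral {a..c} g)"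
    using integrable_continuous_real[OF g] g0
    by (intro nn_integral_has_integral_lebesgue') (auto simp: integrable_integral)
  finally show ?thesis .
qed

text \<open>The bound is asked inside the open interval only, because rescaling a slice of a cone to
  its base divides by the height, which vanishes at the apex. The two end slices do not affect the
  integral.\<close>

lemma measure_le_integral_slices:
  fixes X :: "'a::euclidean_space set"
  assumes b: "b \<in> Basis" and X: "compact X"
    and g: "continuous_on {a..c} g" and g0: "\<And>t. t \<in> {a..c} \<Longrightarrow> 0 \<le> g t"
    and sl: "\<And>t. t \<in> {a<..<c} \<Longrightarrow> measure lebesgue (slice X b t) \<le> g t"
    and sub: "\<And>x. x \<in> X \<Longrightarrow> x \<bullet> b \<in> {a..c}"
  shows "measure lebesgue X \<le> integral {a..c} g"
proof -
  have bb: "b \<bullet> b = 1" using b by simp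
  have "ennreal (measure lebesgue X) = (\<integral>\<^sup>+t. emeasure lborel (slice X b t) \<partial>lborel)"
    using emeasure_slices[OF b borel_compact[OF X]] emeasure_compact_eq_measure[OF X] by simp
  also have "\<dots> \<le> (\<integral>\<^sup>+t. ennreal (g t) * indicator {a<..<c} t \<partial>lborel)"
  proof (rule nn_integral_mono_AE)
    have "AE t in lborel. t \<noteq> a" "AE t in lborel. t \<noteq> c" by (rule AE_lborel_singleton)+
    then show "AE t in lborel. emeasure lborel (slice X b t) \<le> ennreal (g t) * indicator {a<..<c} t"
    proof eventually_elim
      case (elim t)
      show ?case
      proof (cases "t \<in> {a<..<c}")
        case True
        then show ?thesis using sl[OF True] g0[of t]
          by (simp add: emeasure_compact_eq_measure[OF compact_slice[OF b X]] ennreal_leI)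
      next
        case False
        have "slice X b t = {}"
        proof -
          have "(x + (t - x \<bullet> b) *\<^sub>R b) \<bullet> b = t" for x by (simp add: inner_add_left bb)
          then have "t \<in> {a..c}" if "x \<in> slice X b t" for x using sub that by (fastforce simp: slice_def)
          then show ?thesis using False elim by force
        qed
        then show ?thesis by simp
      qed
    qed
  qed
  also have "\<dots> = ennreal (integral {a..c} g)" by (rule nn_integral_indicator_Ioo[OF g g0])
  finally show ?thesis
    using integral_nonneg[OF integrable_continuous_real[OF g] g0] by (simp add: measure_nonneg)
qed

lemma measure_ge_integral_slices:
  fixes X :: "'a::euclidean_space set"
  assumes b: "b \<in> Basis" and X: "compact X"
    and g: "continuous_on {a..c} g" and g0: "\<And>t. t \<in> {a..c} \<Longrightarrow> 0 \<le> g t"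
    and sl: "\<And>t. t \<in> {a<..<c} \<Longrightarrow> g t \<le> measure lebesgue (slice X b t)"
  shows "integral {a..c} g \<le> measure lebesgue X"
proof -
  have "ennreal (integral {a..c} g) = (\<integral>\<^sup>+t. ennreal (g t) * indicator {a<..<c} t \<partial>lborel)"
    by (rule nn_integral_indicator_Ioo[OF g g0, symmetric])
  also have "\<dots> \<le> (\<integral>\<^sup>+t. emeasure lborel (slice X b t) \<partial>lborel)"
  proof (rule nn_integral_mono)
    fix t show "ennreal (g t) * indicator {a<..<c} t \<le> emeasure lborel (slice X b t)"
      using sl[of t] by (auto simp: indicator_def emeasure_compact_eq_measure[OF compact_slice[OF b X]] ennreal_leI)
  qed
  also have "\<dots> = ennreal (measure lebesgue X)"
    using emeasure_slices[OF b borel_compact[OF X]] emeasure_compact_eq_measure[OF X] by simp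
  finally show ?thesis by (simp add: measure_nonneg)
qed

lemma convex_bodyI:
  assumes "compact K" "convex K" "measure lebesgue K > 0"
  shows "convex_body (K :: 'a::euclidean_space set)"
  using assms negligible_convex_interior[OF assms(2)] negligible_imp_measure0[of K]
  by (auto simp: convex_body_def)

section \<open>Stretching a body along a coordinate axis\<close>

lemma stretch_axis:
  fixes x :: "real^'n"
  shows "stretch h (axis j 1) x = (\<chi> i. (if i = j then h else 1) * x $ i)"
proof (rule vec_eq_iff[THEN iffD2], intro allI)
  fix i
  have "x \<bullet> axis j 1 = x $ j" by (simp add: inner_axis)
  moreover have "(axis j 1 :: real^'n) $ i = (if i = j then 1 else 0)" by (simp add: axis_def)
  ultimately show "stretch h (axis j 1) x $ i = (\<chi> i. (if i = j then h else 1) * x $ i) $ i"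
    by (simp add: stretch_def algebra_simps)
qed

lemma compact_stretch: "compact X \<Longrightarrow> compact (stretch h b ` X)"
  by (intro compact_continuous_image linear_continuous_on) (simp_all add: linear_stretch linear_linear)

lemma measure_stretch_axis:
  fixes X :: "(real^'n) set"
  assumes "compact X" "h > 0"
  shows "measure lebesgue (stretch h (axis j 1) ` X) = h * measure lebesgue X"
proof -
  have "stretch h (axis j 1) = (\<lambda>x::real^'n. \<chi> i. (if i = j then h else 1) * x $ i)"
    by (rule ext) (rule stretch_axis)
  moreover have "(\<Prod>i\<in>UNIV. if i = j then h else 1) = h" by simp
  ultimately show ?thesis
    using measure_diagonal_image[OF assms(1), of "\<lambda>i. if i = j then h else 1"] assms(2) by simp
qed

lemma overlap_stretch:
  fixes C :: "(real^'n) set"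
  assumes h: "h > 0" and C: "compact C" and R: "continuous_on UNIV R" and b: "b = axis j 1"
  shows "overlap (stretch h b ` C) R = h * overlap C (\<lambda>y. stretch (1 / h) b (R (stretch h b y)))"
proof -
  have nb: "norm b = 1" by (simp add: b)
  have inv: "stretch (1 / h) b (stretch h b y) = y" "stretch h b (stretch (1 / h) b y) = y" for y
    using h by (simp_all add: stretch_stretch[OF nb])
  have st: "continuous_on UNIV (stretch k b)" for k
    by (intro linear_continuous_on) (simp add: linear_stretch linear_linear)
  have "{y \<in> stretch h b ` C. R y \<in> stretch h b ` C} =
      stretch h b ` {x \<in> C. stretch (1 / h) b (R (stretch h b x)) \<in> C}"
    by (auto simp: image_iff inv) (metis inv)+
  moreover have "compact {x \<in> C. stretch (1 / h) b (R (stretch h b x)) \<in> C}"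
    by (intro compact_overlap_set C continuous_on_compose2[OF st] continuous_on_compose2[OF R] st) auto
  ultimately show ?thesis unfolding overlap_def b using h by (simp add: measure_stretch_axis)
qed

lemma convex_body_stretch:
  fixes C :: "(real^'n) set"
  assumes "convex_body C" "h > 0"
  shows "convex_body (stretch h (axis j 1) ` C)"
proof (rule convex_bodyI)
  show "compact (stretch h (axis j 1) ` C)" using assms by (simp add: convex_body_def compact_stretch)
  show "convex (stretch h (axis j 1) ` C)"
    using assms by (simp add: convex_body_def convex_linear_image linear_stretch)
  show "measure lebesgue (stretch h (axis j 1) ` C) > 0"
    using assms convex_body_measure_pos[OF assms(1)] by (simp add: measure_stretch_axis convex_body_def)
qed

text \<open>Compactness by contradiction, without an explicit \<open>h\<close>: if the stretches by
  1, 2, 3, ... all fail, the violating reflections have a limit map whose overlap still exceeds the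
  bound \<open>lim\<close>.\<close>

lemma exists_flat_body:
  fixes C :: "(real^'n) set"
  assumes C: "convex_body C" and b: "b = axis j 1" and eps: "\<epsilon> > 0" and s: "0 \<le> s"
    and lim: "\<And>S p q. flat_involution d S \<Longrightarrow> \<forall>w\<in>F. S w = w \<Longrightarrow>
      S b = b \<and> S p = - p \<and> S q = - q \<or>
      S b = - b \<and> p \<bullet> b = 0 \<and> S p = p \<and> S q + q + (q \<bullet> b) *\<^sub>R p = 0 \<Longrightarrow>
      overlap C (\<lambda>y. S y + (y \<bullet> b) *\<^sub>R p + q) \<le> s * measure lebesgue C"
  shows "\<exists>h>0. convex_body (stretch h b ` C) \<and> sym_le d F (stretch h b ` C) (s + \<epsilon>)"
proof (rule ccontr)
  assume neg: "\<not> ?thesis"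
  have cC: "compact C" using C by (simp add: convex_body_def)
  have V: "measure lebesgue C > 0" by (rule convex_body_measure_pos[OF C])
  have nb: "norm b = 1" by (simp add: b)
  have "\<exists>S e. flat_involution d S \<and> (\<forall>w\<in>F. S w = w) \<and> S e = - e \<and>
      (s + \<epsilon>) * measure lebesgue C \<le>
      overlap C (\<lambda>y. stretch (1 / real (Suc k)) b (S (stretch (real (Suc k)) b y) + e))" for k
  proof -
    let ?h = "real (Suc k)"
    have "\<not> sym_le d F (stretch ?h b ` C) (s + \<epsilon>)"
      using neg convex_body_stretch[OF C, of ?h j] by (auto simp: b)
    then obtain S e where S: "flat_involution d S" "\<forall>w\<in>F. S w = w" "S e = - e"
      "(s + \<epsilon>) * measure lebesgue (stretch ?h b ` C) < overlap (stretch ?h b ` C) (\<lambda>x. S x + e)"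
      by (auto simp: sym_le_def not_le)
    have "?h * ((s + \<epsilon>) * measure lebesgue C)
        < ?h * overlap C (\<lambda>y. stretch (1 / ?h) b (S (stretch ?h b y) + e))"
      using S(4) overlap_stretch[OF _ cC continuous_reflection[OF S(1)] b, of ?h e]
      by (simp add: b measure_stretch_axis[OF cC] mult.left_commute)
    then have "(s + \<epsilon>) * measure lebesgue C \<le> overlap C (\<lambda>y. stretch (1 / ?h) b (S (stretch ?h b y) + e))"
      by (simp only: mult_less_cancel_left_pos of_nat_0_less_iff zero_less_Suc less_imp_le)
    then show ?thesis using S(1-3) by blast
  qed
  then have "\<forall>k. \<exists>g. flat_involution d (fst g) \<and> (\<forall>w\<in>F. fst g w = w) \<and> fst g (snd g) = - snd g \<and>
      (s + \<epsilon>) * measure lebesgue C \<le>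
      overlap C (\<lambda>y. stretch (1 / real (Suc k)) b (fst g (stretch (real (Suc k)) b y) + snd g))"
    by simp
  from choice[OF this] obtain g where g: "\<forall>k. flat_involution d (fst (g k)) \<and> (\<forall>w\<in>F. fst (g k) w = w) \<and>
      fst (g k) (snd (g k)) = - snd (g k) \<and> (s + \<epsilon>) * measure lebesgue C \<le>
      overlap C (\<lambda>y. stretch (1 / real (Suc k)) b (fst (g k) (stretch (real (Suc k)) b y) + snd (g k)))"
    by blast
  define S where "S k = fst (g k)" for k
  define e where "e k = snd (g k)" for k
  have S: "\<And>k. flat_involution d (S k)" "\<And>k. \<forall>w\<in>F. S k w = w" "\<And>k. S k (e k) = - e k"
    "\<And>k. (s + \<epsilon>) * measure lebesgue C \<le>
      overlap C (\<lambda>y. stretch (1 / real (Suc k)) b (S k (stretch (real (Suc k)) b y) + e k))"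
    using g by (simp_all add: S_def e_def)
  have pos: "(s + \<epsilon>) * measure lebesgue C > 0" using V s eps by simp
  obtain S' p q where "flat_involution d S'" "\<forall>w\<in>F. S' w = w"
    and ge: "(s + \<epsilon>) * measure lebesgue C \<le> overlap C (\<lambda>y. S' y + (y \<bullet> b) *\<^sub>R p + q)"
    and "S' b = b \<and> S' p = - p \<and> S' q = - q \<or>
     S' b = - b \<and> p \<bullet> b = 0 \<and> S' p = p \<and> S' q + q + (q \<bullet> b) *\<^sub>R p = 0"
    using stretched_reflections_limit[OF cC nb pos S(1) _ S(3,4), of F] S(2) by blast
  then have "overlap C (\<lambda>y. S' y + (y \<bullet> b) *\<^sub>R p + q) \<le> s * measure lebesgue C" by (intro lim)
  then have "\<epsilon> * measure lebesgue C \<le> 0" using ge by (simp add: algebra_simps)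
  then show False using mult_pos_pos[OF eps V] by simp
qed

subsection \<open>Cones over cylinders\<close>

text \<open>A body that is a unit cube in the coordinates of J represents its projection to the remaining coordinates.
  This keeps all dimensions inside one type.\<close>

definition cylindrical :: "'n set \<Rightarrow> (real^'n) set \<Rightarrow> bool" where
  "cylindrical J C \<longleftrightarrow> (\<forall>x\<in>C. (\<forall>j\<in>J. 0 \<le> x $ j \<and> x $ j \<le> 1) \<and>
     (\<forall>z. (\<forall>i. i \<notin> J \<longrightarrow> z $ i = x $ i) \<and> (\<forall>j\<in>J. 0 \<le> z $ j \<and> z $ j \<le> 1) \<longrightarrow> z \<in> C))"

lemma cylindricalD:
  assumes "cylindrical J C" "x \<in> C"
  shows "j \<in> J \<Longrightarrow> 0 \<le> x $ j" "j \<in> J \<Longrightarrow> x $ j \<le> 1"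
    "(\<And>i. i \<notin> J \<Longrightarrow> z $ i = x $ i) \<Longrightarrow> (\<And>j. j \<in> J \<Longrightarrow> 0 \<le> z $ j \<and> z $ j \<le> 1) \<Longrightarrow> z \<in> C"
proof -
  have A: "(\<forall>j\<in>J. 0 \<le> x $ j \<and> x $ j \<le> 1) \<and>
     (\<forall>z. (\<forall>i. i \<notin> J \<longrightarrow> z $ i = x $ i) \<and> (\<forall>j\<in>J. 0 \<le> z $ j \<and> z $ j \<le> 1) \<longrightarrow> z \<in> C)"
    using assms unfolding cylindrical_def by blast
  show "j \<in> J \<Longrightarrow> 0 \<le> x $ j" using A by blast
  show "j \<in> J \<Longrightarrow> x $ j \<le> 1" using A by blast
  show "z \<in> C" if "\<And>i. i \<notin> J \<Longrightarrow> z $ i = x $ i" "\<And>j. j \<in> J \<Longrightarrow> 0 \<le> z $ j \<and> z $ j \<le> 1"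
    using A that by simp
qed

text \<open>The cube coordinate \<open>j0\<close> becomes the height, with the apex at 0 and
  \<open>C\<close> as slice at 1. The coordinates in \<open>J - {j0}\<close> remain cube
  coordinates, so the result is again a cylinder, now over a base of one more dimension.\<close>

definition cone_over :: "'n set \<Rightarrow> 'n \<Rightarrow> (real^'n) set \<Rightarrow> (real^'n) set" where
  "cone_over J j0 C = {y. \<exists>z\<in>C. (\<forall>i. i \<notin> J \<longrightarrow> y $ i = y $ j0 * z $ i) \<and> (\<forall>j\<in>J. 0 \<le> y $ j \<and> y $ j \<le> 1)}"

definition scale_outside :: "'n set \<Rightarrow> real \<Rightarrow> real^'n \<Rightarrow> real^'n" where
  "scale_outside J t x = (\<chi> i. (if i \<in> J then 1 else t) * x $ i)"

lemma measure_scale_outside: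
  fixes X :: "(real^'n) set"
  assumes "compact X" "t > 0"
  shows "measure lebesgue (scale_outside J t ` X) = t ^ card (- J) * measure lebesgue X"
proof -
  have "(\<Prod>i\<in>UNIV. if i \<in> J then 1 else t) = t ^ card (- J)"
    by (simp add: prod.If_cases Collect_neg_eq[symmetric] Compl_eq)
  then show ?thesis
    using measure_diagonal_image[OF assms(1), of "\<lambda>i. if i \<in> J then 1 else t"] assms(2)
    by (simp add: scale_outside_def[abs_def])
qed

lemma integral_scaled_power:
  fixes a c V :: real
  assumes "a \<le> c"
  shows "integral {a..c} (\<lambda>t. t ^ m * V) = (c ^ Suc m - a ^ Suc m) / real (Suc m) * V"
proof -
  have "((\<lambda>t. t ^ m * V) has_integral (c ^ Suc m / real (Suc m) * V - a ^ Suc m / real (Suc m) * V)) {a..c}"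
  proof (rule fundamental_theorem_of_calculus[OF assms])
    fix t :: real
    have "((\<lambda>t. t ^ Suc m / real (Suc m) * V) has_real_derivative
        real (Suc m) * (1 * t ^ (Suc m - Suc 0)) / real (Suc m) * V) (at t within {a..c})"
      by (intro DERIV_cmult_right DERIV_cdivide DERIV_power DERIV_ident)
    then show "((\<lambda>t. t ^ Suc m / real (Suc m) * V) has_vector_derivative t ^ m * V) (at t within {a..c})"
      by (simp add: has_real_derivative_iff_has_vector_derivative[symmetric] del: of_nat_Suc power_Suc)
  qed
  then show ?thesis by (simp only: integral_unique diff_divide_distrib left_diff_distrib)
qed

text \<open>The left side is twice the share of a cone's volume between the levels
  \<open>max 0 (c - 1)\<close> and \<open>c / 2\<close>. Put
  \<open>\<rho> = 2 powr (- 1 / m)\<close>. The derivative vanishes where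
  \<open>c - 1 = \<rho> * c / 2\<close>, that is at \<open>c = 2 / (2 - \<rho>)\<close>, and the
  value there is the right side. The proof is Jensen's inequality for the power
  \<open>m + 1\<close>, with equality at this \<open>c\<close>.\<close>

lemma cone_profile_bound:
  fixes c :: real
  assumes m: "m \<ge> 1" and c: "0 \<le> c" "c \<le> 2"
  shows "2 * ((c / 2) ^ Suc m - (max 0 (c - 1)) ^ Suc m) \<le> (2 - 2 powr (- 1 / real m)) powr (- real m)"
proof -
  define \<rho> where "\<rho> = (2::real) powr (- 1 / real m)"
  define q where "q = (2 - \<rho>) powr (- real m)"
  have rpos: "\<rho> > 0" by (simp add: \<rho>_def)
  have "\<rho> < 2 powr 0" unfolding \<rho>_def using m by (intro powr_less_mono) auto
  then have r1: "\<rho> < 1" by simp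
  have rm: "\<rho> ^ m = 1 / 2"
  proof -
    have "\<rho> ^ m = \<rho> powr real m" using rpos by (simp add: powr_realpow)
    also have "\<dots> = 2 powr (-1)" unfolding \<rho>_def powr_powr using m by simp
    finally show ?thesis by (simp add: powr_minus_divide)
  qed
  have q: "q = 1 / (2 - \<rho>) ^ m"
    unfolding q_def using r1 by (simp add: powr_minus_divide powr_realpow)
  \<comment> \<open>Chosen so that \<open>(2 * \<theta>) ^ m = 1 / 2\<close>. This makes the
    weighted term at \<open>?u\<close> equal to \<open>(c - 1) ^ Suc m\<close>, while the one at
    \<open>?v\<close> does not depend on \<open>c\<close>.\<close>
  define \<theta> where "\<theta> = \<rho> / 2"
  have th: "0 < \<theta>" "\<theta> < 1" using rpos r1 by (auto simp: \<theta>_def)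
  have main: "2 * ((c / 2) ^ Suc m - (c - 1) ^ Suc m) \<le> q" if c: "1 \<le> c" "c \<le> 2" for c :: real
  proof -
    define x where "x = c - 1"
    have x: "0 \<le> x" using c by (simp add: x_def)
    let ?u = "x / (2 * \<theta>)" and ?v = "1 / (2 * (1 - \<theta>))"
    have "convex_on {0..} (\<lambda>x::real. x ^ Suc m)"
      by (cases "even (Suc m)")
         (rule convex_on_subset[OF convex_power_even], simp_all del: power_Suc even_Suc add: convex_power_odd)
    then have f1: "((1 - \<theta>) *\<^sub>R ?v + \<theta> *\<^sub>R ?u) ^ Suc m \<le> (1 - \<theta>) * ?v ^ Suc m + \<theta> * ?u ^ Suc m"
      using th x by (intro convex_onD[where A = "{0..}"]) auto
    have f2: "(1 - \<theta>) *\<^sub>R ?v + \<theta> *\<^sub>R ?u = c / 2" using th by (simp add: x_def field_simps)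
    have f3: "\<theta> * ?u ^ Suc m = x ^ Suc m"
    proof -
      have "\<theta> * ?u ^ Suc m = x ^ Suc m * (\<theta> / (2 * \<theta>)) / (2 * \<theta>) ^ m" by (simp add: power_divide)
      also have "\<dots> = x ^ Suc m * (1 / 2) / (1 / 2)"
      proof -
        have "\<theta> / (2 * \<theta>) = 1 / 2" "(2 * \<theta>) ^ m = 1 / 2" using th rm by (simp_all add: \<theta>_def)
        then show ?thesis by (simp only:)
      qed
      finally show ?thesis by simp
    qed
    have f4: "(1 - \<theta>) * ?v ^ Suc m = q / 2"
    proof -
      have "(1 - \<theta>) * ?v ^ Suc m = ((1 - \<theta>) / (2 * (1 - \<theta>))) / (2 * (1 - \<theta>)) ^ m"
        by (simp add: power_one_over field_simps)
      also have "\<dots> = (1 / 2) / (2 - \<rho>) ^ m"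
      proof -
        have "(1 - \<theta>) / (2 * (1 - \<theta>)) = 1 / 2" using th by simp
        moreover have "2 * (1 - \<theta>) = 2 - \<rho>" by (simp add: \<theta>_def)
        ultimately show ?thesis by (simp only:)
      qed
      finally show ?thesis by (simp add: q)
    qed
    have "(c / 2) ^ Suc m \<le> q / 2 + x ^ Suc m" using f1 unfolding f2 f3 f4 .
    then show ?thesis unfolding x_def by argo
  qed
  have "2 * ((c / 2) ^ Suc m - (max 0 (c - 1)) ^ Suc m) \<le> q"
  proof (cases "1 \<le> c")
    case True
    then show ?thesis using main[OF True c(2)] by simp
  next
    case False
    \<comment> \<open>Below \<open>c = 1\<close> the lower level is 0 and the expression increases
      with \<open>c\<close>, so the value at 1 decides.\<close>
    have "(c / 2) ^ Suc m \<le> (1 / 2) ^ Suc m" using False c by (intro power_mono) auto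
    then show ?thesis using main[of 1] False by simp
  qed
  then show ?thesis by (simp add: q_def \<rho>_def)
qed

lemma measure_vimage_involution:
  fixes X :: "'a::euclidean_space set"
  assumes f: "linear f" and ff: "\<And>x. f (f x) = x" and X: "compact X" and Y: "compact Y"
    and YX: "\<And>y. y \<in> Y \<Longrightarrow> f y + a \<in> X"
  shows "measure lebesgue Y \<le> measure lebesgue X"
proof -
  have fm: "f \<in> borel_measurable borel"
    using f by (intro borel_measurable_continuous_onI linear_continuous_on) (simp add: linear_linear)
  have X': "(\<lambda>x. x - a) ` X \<in> sets borel"
    using X by (intro borel_compact compact_continuous_image continuous_intros)
  have "Y \<subseteq> f -` ((\<lambda>x. x - a) ` X)" using YX by (force simp: image_iff)
  then have "emeasure lborel Y \<le> emeasure lborel (f -` ((\<lambda>x. x - a) ` X))"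
    using measurable_sets[OF fm X'] by (intro emeasure_mono) auto
  also have "\<dots> = emeasure lborel ((\<lambda>x. x - a) ` X)" by (rule emeasure_vimage_involution[OF f ff X'])
  also have "\<dots> = ennreal (measure lebesgue ((\<lambda>x. x - a) ` X))"
    using X by (intro emeasure_compact_eq_measure compact_continuous_image continuous_intros)
  also have "measure lebesgue ((\<lambda>x. x - a) ` X) = measure lebesgue X"
    using measure_translation_subtract[of a X] by simp
  finally show ?thesis by (simp add: emeasure_compact_eq_measure[OF Y])
qed

text \<open>A map that reverses the coordinate along b sends the half of the overlap above the level c/2
  into the half below it.\<close>

lemma overlap_reversing_le:
  fixes C :: "'a::euclidean_space set"
  assumes C: "compact C" and S: "flat_involution d S" and Sb: "S b = - b" and bn: "norm b = 1"
    and p: "p \<bullet> b = 0" "S p = p"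
    and C01: "\<And>y. y \<in> C \<Longrightarrow> 0 \<le> y \<bullet> b \<and> y \<bullet> b \<le> 1"
  shows "overlap C (\<lambda>y. S y + (y \<bullet> b) *\<^sub>R p + q)
     \<le> 2 * measure lebesgue {y \<in> C. max 0 (q \<bullet> b - 1) \<le> y \<bullet> b \<and> y \<bullet> b \<le> (q \<bullet> b) / 2}"
proof -
  define M where "M y = S y + (y \<bullet> b) *\<^sub>R p" for y
  define c where "c = q \<bullet> b"
  have lS: "linear S" and SS: "\<And>x. S (S x) = x" and sa: "\<And>x y. S x \<bullet> y = x \<bullet> S y"
    using flat_involutionD[OF S] by auto
  have lM: "linear M"
    unfolding M_def by (rule linearI) (simp_all add: linear_add[OF lS] linear_scale[OF lS] inner_add_left algebra_simps)
  have Mb: "M y \<bullet> b = - (y \<bullet> b)" for y by (simp add: M_def inner_add_left sa Sb p)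
  \<comment> \<open>\<open>M\<close> is an involution although it shears: the height changes sign
    and \<open>S p = p\<close>, so the two shear terms cancel.\<close>
  have MM: "M (M y) = y" for y
    using Mb[of y] by (simp add: M_def[of "M y"]) (simp add: M_def linear_add[OF lS] linear_scale[OF lS] SS p(2))
  \<comment> \<open>A point at height \<open>t\<close> goes to height \<open>c - t\<close>. Both
    heights lie in [0,1], which forces \<open>t\<close> to be at least \<open>c - 1\<close>.\<close>
  define L where "L = {y \<in> C. max 0 (c - 1) \<le> y \<bullet> b \<and> y \<bullet> b \<le> c / 2}"
  define O1 where "O1 = {y \<in> C. M y + q \<in> C}"
  define U where "U = {y \<in> O1. y \<bullet> b \<ge> c / 2}"
  define D where "D = {y \<in> O1. y \<bullet> b \<le> c / 2}"
  have cM: "continuous_on UNIV (\<lambda>y. M y + q)"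
    using lM by (intro continuous_on_add continuous_on_const linear_continuous_on) (simp add: linear_linear)
  have cO: "compact O1" unfolding O1_def by (rule compact_overlap_set[OF C cM])
  have half: "closed {y. y \<bullet> b \<ge> t}" "closed {y. y \<bullet> b \<le> t}" for t
    by (intro closed_Collect_le continuous_intros)+
  have "U = O1 \<inter> {y. y \<bullet> b \<ge> c / 2}" by (auto simp: U_def)
  then have cU: "compact U" by (metis compact_Int_closed[OF cO half(1)])
  have "D = O1 \<inter> {y. y \<bullet> b \<le> c / 2}" by (auto simp: D_def)
  then have cD: "compact D" by (metis compact_Int_closed[OF cO half(2)])
  have "L = C \<inter> ({y. y \<bullet> b \<ge> max 0 (c - 1)} \<inter> {y. y \<bullet> b \<le> c / 2})" by (auto simp: L_def)
  then have cL: "compact L" by (metis compact_Int_closed[OF C closed_Int[OF half(1) half(2)]])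
  have qb: "(M y + q) \<bullet> b = c - y \<bullet> b" for y by (simp add: inner_add_left Mb c_def)
  have "measure lebesgue O1 \<le> measure lebesgue U + measure lebesgue D"
  proof -
    have "O1 = U \<union> D" by (auto simp: U_def D_def)
    then show ?thesis using cU cD by (simp add: measure_Un_le fmeasurableD lmeasurable_compact)
  qed
  moreover have "measure lebesgue U \<le> measure lebesgue L"
  proof (rule measure_vimage_involution[OF lM MM cL cU])
    fix y assume y: "y \<in> U"
    then show "M y + q \<in> L" using C01[of y] C01[of "M y + q"] qb[of y] by (auto simp: U_def O1_def L_def)
  qed
  moreover have "measure lebesgue D \<le> measure lebesgue L"
  proof (rule measure_mono_fmeasurable)
    show "D \<subseteq> L"
    proof
      fix y assume y: "y \<in> D"
      then show "y \<in> L" using C01[of y] C01[of "M y + q"] qb[of y] by (auto simp: D_def O1_def L_def)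
    qed
  qed (use cD cL in \<open>auto simp: lmeasurable_compact fmeasurableD\<close>)
  moreover have "overlap C (\<lambda>y. S y + (y \<bullet> b) *\<^sub>R p + q) = measure lebesgue O1"
    by (simp only: overlap_def O1_def M_def)
  ultimately show ?thesis unfolding c_def[symmetric] L_def[symmetric] by linarith
qed

context
  fixes C :: "(real^'n) set" and J :: "'n set" and j0 :: 'n
  assumes C: "convex_body C" and cyl: "cylindrical J C" and j0: "j0 \<in> J"
begin

lemma cone_over_compact_convex: "compact (cone_over J j0 C)" "convex (cone_over J j0 C)"
proof -
  \<comment> \<open>The cube coordinate \<open>j0\<close> of a point of \<open>C\<close> doubles as
    its height, so the cone is a continuous image of \<open>C\<close> itself.\<close>
  let ?f = "\<lambda>z::real^'n. \<chi> i. (if i \<in> J then 1 else z $ j0) * z $ i"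
  have "cone_over J j0 C = ?f ` C"
  proof (intro equalityI subsetI)
    fix y assume "y \<in> cone_over J j0 C"
    then obtain z where z: "z \<in> C" "\<And>i. i \<notin> J \<Longrightarrow> y $ i = y $ j0 * z $ i" "\<And>j. j \<in> J \<Longrightarrow> 0 \<le> y $ j \<and> y $ j \<le> 1"
      by (auto simp: cone_over_def)
    let ?z = "\<chi> i. if i \<in> J then y $ i else z $ i"
    have "?z \<in> C" by (rule cylindricalD(3)[OF cyl z(1)]) (use z(3) in auto)
    moreover have "y = ?f ?z" using z(2) j0 by (auto simp: vec_eq_iff)
    ultimately show "y \<in> ?f ` C" by blast
  next
    fix y assume "y \<in> ?f ` C"
    then obtain z where z: "z \<in> C" "y = ?f z" by blast
    then show "y \<in> cone_over J j0 C"
      unfolding cone_over_def using j0 cylindricalD(1,2)[OF cyl z(1)] by (auto intro!: bexI[of _ z])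
  qed
  moreover have "continuous_on C ?f"
  proof (intro continuous_on_vec_lambda)
    fix i show "continuous_on C (\<lambda>z. (if i \<in> J then 1 else z $ j0) * z $ i)"
      by (cases "i \<in> J") (auto intro!: continuous_intros)
  qed
  ultimately show "compact (cone_over J j0 C)"
    using C by (simp add: convex_body_def compact_continuous_image)
  show "convex (cone_over J j0 C)"
  proof (rule convexI)
    fix y1 y2 and u v :: real
    assume y: "y1 \<in> cone_over J j0 C" "y2 \<in> cone_over J j0 C" and uv: "0 \<le> u" "0 \<le> v" "u + v = 1"
    obtain z1 where z1: "z1 \<in> C" "\<And>i. i \<notin> J \<Longrightarrow> y1 $ i = y1 $ j0 * z1 $ i" "\<And>j. j \<in> J \<Longrightarrow> 0 \<le> y1 $ j \<and> y1 $ j \<le> 1"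
      using y(1) by (auto simp: cone_over_def)
    obtain z2 where z2: "z2 \<in> C" "\<And>i. i \<notin> J \<Longrightarrow> y2 $ i = y2 $ j0 * z2 $ i" "\<And>j. j \<in> J \<Longrightarrow> 0 \<le> y2 $ j \<and> y2 $ j \<le> 1"
      using y(2) by (auto simp: cone_over_def)
    let ?y = "u *\<^sub>R y1 + v *\<^sub>R y2"
    \<comment> \<open>The height of the combination. Its base point combines \<open>z1\<close> and
      \<open>z2\<close> in proportion to the heights that they contribute; if \<open>T = 0\<close>
      it lies over the apex, where any base point serves.\<close>
    define T where "T = u * y1 $ j0 + v * y2 $ j0"
    have t: "0 \<le> u * y1 $ j0" "0 \<le> v * y2 $ j0" using z1(3)[OF j0] z2(3)[OF j0] uv by auto
    have J01: "0 \<le> ?y $ j \<and> ?y $ j \<le> 1" if "j \<in> J" for j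
    proof -
      have "u * y1 $ j + v * y2 $ j \<le> 1" using z1(3)[OF that] z2(3)[OF that] uv
        by (intro convex_bound_le) auto
      then show ?thesis using z1(3)[OF that] z2(3)[OF that] uv by simp
    qed
    have "\<exists>z\<in>C. \<forall>i. i \<notin> J \<longrightarrow> ?y $ i = T * z $ i"
    proof (cases "T = 0")
      case True
      then have 0: "u * y1 $ j0 = 0 \<and> v * y2 $ j0 = 0"
        using add_nonneg_eq_0_iff[OF t] unfolding T_def by blast
      have "?y $ i = 0" if "i \<notin> J" for i
        using 0 by (simp add: z1(2)[OF that] z2(2)[OF that]) auto
      then show ?thesis using z1(1) True by auto
    next
      case False
      then have Tp: "T > 0" using t by (simp add: T_def less_le)
      let ?z = "(u * y1 $ j0 / T) *\<^sub>R z1 + (v * y2 $ j0 / T) *\<^sub>R z2"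
      have "?z \<in> C"
        using C t Tp z1(1) z2(1) by (intro convexD) (auto simp: convex_body_def T_def add_divide_distrib[symmetric])
      moreover have "?y $ i = T * ?z $ i" if "i \<notin> J" for i
        using Tp by (simp add: z1(2)[OF that] z2(2)[OF that] field_simps)
      ultimately show ?thesis by blast
    qed
    then show "?y \<in> cone_over J j0 C" using J01 by (auto simp: cone_over_def T_def)
  qed
qed

lemma slice_cone_over:
  assumes t: "0 < t" "t \<le> 1"
  shows "slice (cone_over J j0 C) (axis j0 1) t = scale_outside J t ` C"
proof (intro equalityI subsetI)
  fix x assume "x \<in> slice (cone_over J j0 C) (axis j0 1) t"
  then have x: "0 \<le> x $ j0" "x $ j0 \<le> 1" "x + (t - x $ j0) *\<^sub>R axis j0 1 \<in> cone_over J j0 C" (is "?y \<in> _")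
    by (auto simp: slice_def inner_axis)
  have yi: "?y $ i = (if i = j0 then t else x $ i)" for i by (simp add: axis_def)
  obtain z where z: "z \<in> C" "\<And>i. i \<notin> J \<Longrightarrow> ?y $ i = ?y $ j0 * z $ i" "\<And>j. j \<in> J \<Longrightarrow> 0 \<le> ?y $ j \<and> ?y $ j \<le> 1"
    using x(3) unfolding cone_over_def by blast
  let ?z = "\<chi> i. if i \<in> J then x $ i else z $ i"
  have "0 \<le> x $ j \<and> x $ j \<le> 1" if "j \<in> J" for j using z(3)[OF that] x(1,2) unfolding yi by (auto split: if_splits)
  then have "?z \<in> C" by (intro cylindricalD(3)[OF cyl z(1)]) auto
  moreover have "x = scale_outside J t ?z"
  proof -
    have "x $ i = t * z $ i" if "i \<notin> J" for i
    proof -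
      have "i \<noteq> j0" using that j0 by auto
      then show ?thesis using z(2)[OF that] unfolding yi by simp
    qed
    then show ?thesis by (auto simp: vec_eq_iff scale_outside_def)
  qed
  ultimately show "x \<in> scale_outside J t ` C" by blast
next
  fix x assume "x \<in> scale_outside J t ` C"
  then obtain z where z: "z \<in> C" "x = scale_outside J t z" by blast
  have zJ: "0 \<le> z $ j \<and> z $ j \<le> 1" if "j \<in> J" for j using cylindricalD(1,2)[OF cyl z(1) that] by simp
  have "x + (t - x $ j0) *\<^sub>R axis j0 1 \<in> cone_over J j0 C"
    unfolding cone_over_def using z j0 zJ t
    by (auto simp: scale_outside_def axis_def intro!: bexI[of _ z])
  then show "x \<in> slice (cone_over J j0 C) (axis j0 1) t"
    using z zJ[OF j0] j0 by (simp add: slice_def inner_axis scale_outside_def)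
qed

lemma cone_over_coordinate: "y \<in> cone_over J j0 C \<Longrightarrow> 0 \<le> y $ j0 \<and> y $ j0 \<le> 1"
  using j0 by (auto simp: cone_over_def)

lemma measure_slice_cone_over:
  assumes "0 < t" "t \<le> 1"
  shows "measure lebesgue (slice (cone_over J j0 C) (axis j0 1) t) = t ^ card (- J) * measure lebesgue C"
  using C assms by (simp add: slice_cone_over measure_scale_outside convex_body_def)

lemma measure_cone_over: "measure lebesgue (cone_over J j0 C) = measure lebesgue C / real (Suc (card (- J)))"
proof -
  let ?g = "\<lambda>t. t ^ card (- J) * measure lebesgue C"
  have g: "continuous_on {0..1} ?g" by (intro continuous_intros)
  have g0: "0 \<le> ?g t" if "t \<in> {0..1}" for t using that by simp
  have B: "axis j0 1 \<in> (Basis :: (real^'n) set)" by simp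
  have "measure lebesgue (cone_over J j0 C) \<le> integral {0..1} ?g"
    by (rule measure_le_integral_slices[OF B cone_over_compact_convex(1) g g0])
       (auto simp: measure_slice_cone_over inner_axis dest: cone_over_coordinate)
  moreover have "integral {0..1} ?g \<le> measure lebesgue (cone_over J j0 C)"
    by (rule measure_ge_integral_slices[OF B cone_over_compact_convex(1) g g0])
       (auto simp: measure_slice_cone_over)
  moreover have "integral {0..1} ?g = measure lebesgue C / real (Suc (card (- J)))"
    by (subst integral_scaled_power) auto
  ultimately show ?thesis by simp
qed

lemma measure_cone_over_slab:
  assumes "0 \<le> a" "a \<le> c" "c \<le> 1"
  shows "measure lebesgue {y \<in> cone_over J j0 C. a \<le> y $ j0 \<and> y $ j0 \<le> c}
    \<le> (c ^ Suc (card (- J)) - a ^ Suc (card (- J))) / real (Suc (card (- J))) * measure lebesgue C"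
proof -
  let ?g = "\<lambda>t. t ^ card (- J) * measure lebesgue C" and ?b = "axis j0 1 :: real^'n"
  let ?W = "{y \<in> cone_over J j0 C. a \<le> y $ j0 \<and> y $ j0 \<le> c}"
  have B: "?b \<in> Basis" by simp
  have "closed {y::real^'n. a \<le> y $ j0}" "closed {y::real^'n. y $ j0 \<le> c}"
    by (intro closed_Collect_le continuous_intros)+
  moreover have "?W = cone_over J j0 C \<inter> ({y. a \<le> y $ j0} \<inter> {y. y $ j0 \<le> c})" by auto
  ultimately have W: "compact ?W" using cone_over_compact_convex(1) by (simp add: compact_Int_closed closed_Int)
  have "measure lebesgue ?W \<le> integral {a..c} ?g"
  proof (rule measure_le_integral_slices[OF B W])
    show "continuous_on {a..c} ?g" by (intro continuous_intros)
    show "0 \<le> ?g t" if "t \<in> {a..c}" for t using that assms by simp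
    show "x \<bullet> ?b \<in> {a..c}" if "x \<in> ?W" for x using that by (simp add: inner_axis)
    fix t assume t: "t \<in> {a<..<c}"
    have "measure lebesgue (slice ?W ?b t) \<le> measure lebesgue (slice (cone_over J j0 C) ?b t)"
      by (rule measure_mono_fmeasurable)
         (use compact_slice[OF B W] compact_slice[OF B cone_over_compact_convex(1)] in
          \<open>auto simp: slice_def lmeasurable_compact fmeasurableD\<close>)
    then show "measure lebesgue (slice ?W ?b t) \<le> ?g t"
      using t assms by (simp add: measure_slice_cone_over)
  qed
  then show ?thesis by (simp only: integral_scaled_power[OF assms(2)])
qed

lemma overlap_cone_over_reversing:
  assumes S: "flat_involution d S" and "S (axis j0 1) = - axis j0 1" "p \<bullet> axis j0 1 = 0" "S p = p"
    and m: "card (- J) \<ge> 1"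
  shows "overlap (cone_over J j0 C) (\<lambda>y. S y + (y \<bullet> axis j0 1) *\<^sub>R p + q)
    \<le> (2 - 2 powr (- 1 / real (card (- J)))) powr (- real (card (- J))) * measure lebesgue (cone_over J j0 C)"
proof -
  define m where "m = card (- J)"
  define c where "c = q $ j0"
  let ?Q = "(2 - 2 powr (- 1 / real m)) powr (- real m)"
  let ?L = "{y \<in> cone_over J j0 C. max 0 (c - 1) \<le> y $ j0 \<and> y $ j0 \<le> c / 2}"
  have "overlap (cone_over J j0 C) (\<lambda>y. S y + (y \<bullet> axis j0 1) *\<^sub>R p + q) \<le> 2 * measure lebesgue ?L"
  proof -
    have e: "y \<bullet> axis j0 1 = y $ j0" for y :: "real^'n" by (simp add: inner_axis)
    have nb: "norm (axis j0 1 :: real^'n) = 1" by simp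
    show ?thesis
      using overlap_reversing_le[OF cone_over_compact_convex(1) S assms(2) nb assms(3,4), of q] cone_over_coordinate
      unfolding e c_def by blast
  qed
  also have "2 * measure lebesgue ?L \<le> ?Q * measure lebesgue (cone_over J j0 C)"
  proof (cases "0 \<le> c \<and> c \<le> 2")
    case True
    have "measure lebesgue ?L
        \<le> ((c / 2) ^ Suc m - (max 0 (c - 1)) ^ Suc m) / real (Suc m) * measure lebesgue C"
      unfolding m_def by (rule measure_cone_over_slab) (use True in \<open>auto simp: max_def\<close>)
    then have "2 * measure lebesgue ?L
        \<le> 2 * (((c / 2) ^ Suc m - (max 0 (c - 1)) ^ Suc m) / real (Suc m) * measure lebesgue C)"
      by (rule mult_left_mono) simp
    also have "\<dots> = (2 * ((c / 2) ^ Suc m - (max 0 (c - 1)) ^ Suc m)) * (measure lebesgue C / real (Suc m))"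
      by simp
    also have "\<dots> \<le> ?Q * (measure lebesgue C / real (Suc m))"
      using m True by (intro mult_right_mono cone_profile_bound) (auto simp: m_def)
    finally show ?thesis unfolding measure_cone_over m_def .
  next
    case False
    have "?L = {}"
    proof -
      have "False" if "max 0 (c - 1) \<le> y $ j0 \<and> y $ j0 \<le> c / 2" for y :: "real^'n"
        using that False by linarith
      then show ?thesis by blast
    qed
    then show ?thesis by (simp only: measure_empty) simp
  qed
  finally show ?thesis by (simp add: m_def)
qed

text \<open>Dividing the slice at height \<open>t\<close> by \<open>t\<close> turns the map into
  \<open>S z + (p + (1 / t) *\<^sub>R q)\<close>. This translation is still reversed by
  \<open>S\<close>, so \<open>sym\<close> bounds every slice by the same \<open>s\<close>.\<close>

lemma overlap_cone_over_preserving: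
  assumes S: "flat_involution d S" and Sb: "S (axis j0 1) = axis j0 1" and Sp: "S p = - p" and Sq: "S q = - q"
    and F: "\<forall>w\<in>(\<lambda>j. axis j 1) ` (J - {j0}). S w = w"
    and sym: "sym_le d ((\<lambda>j. axis j 1) ` J) C s"
  shows "overlap (cone_over J j0 C) (\<lambda>y. S y + (y \<bullet> axis j0 1) *\<^sub>R p + q) \<le> s * measure lebesgue (cone_over J j0 C)"
proof -
  let ?b = "axis j0 1 :: real^'n"
  have lS: "linear S" and SS: "\<And>x. S (S x) = x" and sa: "\<And>x y. S x \<bullet> y = x \<bullet> S y"
    using flat_involutionD[OF S] by auto
  have SJ: "S (axis j 1) = axis j 1" if "j \<in> J" for j using F Sb that by (cases "j = j0") auto
  have Sxj: "S x $ j = x $ j" if "j \<in> J" for x j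
    using sa[of x "axis j 1"] SJ[OF that] by (simp add: inner_axis)
  have pJ: "p $ j = 0" "q $ j = 0" if "j \<in> J" for j
    using Sxj[OF that, of p] Sxj[OF that, of q] Sp Sq by simp_all
  \<comment> \<open>\<open>S\<close> fixes the axes in \<open>J\<close> and, being self-adjoint,
    also preserves the coordinates in \<open>J\<close>; so it commutes with scaling the
    others.\<close>
  have Sscale: "S (scale_outside J t x) = scale_outside J t (S x)" for t x
  proof -
    have dec: "scale_outside J t x = t *\<^sub>R x + (1 - t) *\<^sub>R (\<Sum>j\<in>J. x $ j *\<^sub>R axis j 1)" for x
    proof -
      have "(\<Sum>j\<in>J. x $ j *\<^sub>R axis j 1) $ i = (if i \<in> J then x $ i else 0)" for i
      proof -
        have "(\<Sum>j\<in>J. x $ j *\<^sub>R axis j 1) $ i = (\<Sum>j\<in>J. if j = i then x $ j else 0)"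
          unfolding sum_component by (rule sum.cong) (auto simp: axis_def)
        then show ?thesis by simp
      qed
      then show ?thesis by (simp add: vec_eq_iff scale_outside_def algebra_simps)
    qed
    have "S (\<Sum>j\<in>J. x $ j *\<^sub>R axis j 1) = (\<Sum>j\<in>J. S x $ j *\<^sub>R axis j 1)"
      unfolding linear_sum[OF lS] by (intro sum.cong) (auto simp: linear_scale[OF lS] SJ Sxj)
    then show ?thesis unfolding dec by (simp add: linear_add[OF lS] linear_scale[OF lS])
  qed
  let ?R = "\<lambda>y. S y + (y \<bullet> ?b) *\<^sub>R p + q"
  let ?O = "{y \<in> cone_over J j0 C. ?R y \<in> cone_over J j0 C}"
  let ?g = "\<lambda>t. t ^ card (- J) * (s * measure lebesgue C)"
  have cC: "compact C" using C by (simp add: convex_body_def)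
  have B: "?b \<in> Basis" by simp
  have "continuous_on UNIV ?R"
    using lS by (intro continuous_intros linear_continuous_on) (simp add: linear_linear)
  then have O: "compact ?O" by (rule compact_overlap_set[OF cone_over_compact_convex(1)])
  have symt: "overlap C (\<lambda>z. S z + (p + (1 / t) *\<^sub>R q)) \<le> s * measure lebesgue C" for t
  proof -
    have "S (p + (1 / t) *\<^sub>R q) = - (p + (1 / t) *\<^sub>R q)"
      by (simp add: linear_add[OF lS] linear_scale[OF lS] Sp Sq)
    moreover have "\<forall>w\<in>(\<lambda>j. axis j 1) ` J. S w = w" using SJ by blast
    ultimately show ?thesis using sym S unfolding sym_le_def by blast
  qed
  \<comment> \<open>The sign of \<open>s\<close> is not assumed; it follows because \<open>s\<close>
    bounds an overlap.\<close>
  have s0: "0 \<le> s * measure lebesgue C"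
    using symt[of 1] order_trans[of 0 "overlap C _"] by (simp add: overlap_def)
  have "measure lebesgue ?O \<le> integral {0..1} ?g"
  proof (rule measure_le_integral_slices[OF B O])
    show "continuous_on {0..1} ?g" by (intro continuous_intros)
    show "0 \<le> ?g t" if "t \<in> {0..1}" for t using that by (intro mult_nonneg_nonneg[OF zero_le_power s0]) simp
    show "x \<bullet> ?b \<in> {0..1}" if "x \<in> ?O" for x using that cone_over_coordinate[of x] by (simp add: inner_axis)
    fix t :: real assume "t \<in> {0<..<1}"
    then have t: "0 < t" "t \<le> 1" by auto
    let ?D = "{z \<in> C. S z + (p + (1 / t) *\<^sub>R q) \<in> C}"
    have D: "compact ?D" by (rule compact_overlap_set[OF cC continuous_reflection[OF S]])
    have "slice ?O ?b t \<subseteq> scale_outside J t ` ?D"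
    proof
      fix x assume x: "x \<in> slice ?O ?b t"
      then have "x \<in> slice (cone_over J j0 C) ?b t" by (auto simp: slice_def)
      then obtain z where z: "z \<in> C" "x = scale_outside J t z" using slice_cone_over[OF t] by auto
      let ?y = "x + (t - x $ j0) *\<^sub>R ?b"
      have "?R ?y \<in> cone_over J j0 C" using x by (simp add: slice_def inner_axis)
      moreover have "?R ?y = scale_outside J t (S z) + (t - x $ j0) *\<^sub>R ?b + t *\<^sub>R p + q"
        by (simp add: linear_add[OF lS] linear_scale[OF lS] Sb inner_axis z(2) Sscale)
      ultimately obtain z' where z': "z' \<in> C"
        "\<And>i. i \<notin> J \<Longrightarrow> (scale_outside J t (S z) + (t - x $ j0) *\<^sub>R ?b + t *\<^sub>R p + q) $ i
           = (scale_outside J t (S z) + (t - x $ j0) *\<^sub>R ?b + t *\<^sub>R p + q) $ j0 * z' $ i"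
        unfolding cone_over_def by auto
      have 1: "(scale_outside J t (S z) + (t - x $ j0) *\<^sub>R ?b + t *\<^sub>R p + q) $ j0 = t"
        using j0 by (simp add: scale_outside_def pJ Sxj z(2))
      have "S z + (p + (1 / t) *\<^sub>R q) \<in> C"
      proof (rule cylindricalD(3)[OF cyl z'(1)])
        fix i assume i: "i \<notin> J"
        then have "i \<noteq> j0" using j0 by auto
        then have "t * S z $ i + t * p $ i + q $ i = t * z' $ i"
          using z'(2)[OF i] i unfolding 1 by (simp add: scale_outside_def axis_def)
        then have "z' $ i = (t * S z $ i + t * p $ i + q $ i) / t" using t by simp
        then show "(S z + (p + (1 / t) *\<^sub>R q)) $ i = z' $ i" using t by (simp add: field_simps)
      next
        fix j assume "j \<in> J"
        then show "0 \<le> (S z + (p + (1 / t) *\<^sub>R q)) $ j \<and> (S z + (p + (1 / t) *\<^sub>R q)) $ j \<le> 1"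
          using cylindricalD(1,2)[OF cyl z(1)] by (simp add: Sxj pJ)
      qed
      then show "x \<in> scale_outside J t ` ?D" using z by blast
    qed
    moreover have "compact (scale_outside J t ` ?D)"
      unfolding scale_outside_def by (intro compact_continuous_image D continuous_intros)
    ultimately have "measure lebesgue (slice ?O ?b t) \<le> measure lebesgue (scale_outside J t ` ?D)"
      using compact_slice[OF B O, of t] by (intro measure_mono_fmeasurable) (auto simp: lmeasurable_compact fmeasurableD)
    also have "\<dots> = t ^ card (- J) * overlap C (\<lambda>z. S z + (p + (1 / t) *\<^sub>R q))"
      using measure_scale_outside[OF D t(1)] by (simp add: overlap_def)
    also have "\<dots> \<le> ?g t" using symt[of t] t by (intro mult_left_mono) auto
    finally show "measure lebesgue (slice ?O ?b t) \<le> ?g t" .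
  qed
  also have "\<dots> = s * measure lebesgue (cone_over J j0 C)"
    by (subst integral_scaled_power) (auto simp: measure_cone_over)
  finally show ?thesis by (simp add: overlap_def)
qed

lemma cylindrical_stretch_cone_over: "cylindrical (J - {j0}) (stretch h (axis j0 1) ` cone_over J j0 C)"
  unfolding cylindrical_def
proof (intro ballI conjI allI impI)
  fix x j assume x: "x \<in> stretch h (axis j0 1) ` cone_over J j0 C" and j: "j \<in> J - {j0}"
  then obtain z where "z \<in> cone_over J j0 C" "x = stretch h (axis j0 1) z" by blast
  then show "0 \<le> x $ j" "x $ j \<le> 1" using j by (auto simp: stretch_axis cone_over_def)
next
  fix x w assume x: "x \<in> stretch h (axis j0 1) ` cone_over J j0 C"
    and w: "(\<forall>i. i \<notin> J - {j0} \<longrightarrow> w $ i = x $ i) \<and> (\<forall>j\<in>J - {j0}. 0 \<le> w $ j \<and> w $ j \<le> 1)"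
  obtain z where z: "z \<in> cone_over J j0 C" "x = stretch h (axis j0 1) z" using x by blast
  obtain v where v: "v \<in> C" "\<And>i. i \<notin> J \<Longrightarrow> z $ i = z $ j0 * v $ i" "\<And>j. j \<in> J \<Longrightarrow> 0 \<le> z $ j \<and> z $ j \<le> 1"
    using z(1) by (auto simp: cone_over_def)
  let ?z = "\<chi> i. if i = j0 then z $ j0 else w $ i"
  have wi: "w $ i = z $ i" if "i \<notin> J" for i
    using w that j0 by (auto simp: z(2) stretch_axis)
  have "?z \<in> cone_over J j0 C"
    unfolding cone_over_def
  proof (intro CollectI bexI[OF _ v(1)] conjI allI impI ballI)
    fix i assume i: "i \<notin> J"
    then have "i \<noteq> j0" using j0 by auto
    then show "?z $ i = ?z $ j0 * v $ i" using v(2)[OF i] wi[OF i] by simp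
  next
    fix j assume "j \<in> J"
    then show "0 \<le> ?z $ j" "?z $ j \<le> 1" using w v(3)[of j] by auto
  qed
  moreover have "w = stretch h (axis j0 1) ?z"
    using w by (auto simp: z(2) stretch_axis vec_eq_iff)
  ultimately show "w \<in> stretch h (axis j0 1) ` cone_over J j0 C" by blast
qed

text \<open>One step of the iteration: \<open>J\<close> loses \<open>j0\<close>, and reflections no
  longer have to fix that axis. Preserving limit maps are charged to \<open>s\<close>, reversing
  ones to the power.\<close>

lemma exists_tall_cone:
  assumes sym: "sym_le d ((\<lambda>j. axis j 1) ` J) C s" and m: "card (- J) \<ge> 1" and eps: "\<epsilon> > 0"
  shows "\<exists>C'. convex_body C' \<and> cylindrical (J - {j0}) C' \<and>
    sym_le d ((\<lambda>j. axis j 1) ` (J - {j0})) C'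
      (max ((2 - 2 powr (- 1 / real (card (- J)))) powr (- real (card (- J)))) s + \<epsilon>)"
proof -
  let ?q = "(2 - 2 powr (- 1 / real (card (- J)))) powr (- real (card (- J)))"
  let ?K = "cone_over J j0 C" and ?b = "axis j0 1 :: real^'n"
  have V: "measure lebesgue ?K > 0"
    using convex_body_measure_pos[OF C] by (simp add: measure_cone_over)
  have K: "convex_body ?K" by (rule convex_bodyI[OF cone_over_compact_convex V])
  have mono: "r * measure lebesgue ?K \<le> max ?q s * measure lebesgue ?K" if "r \<le> max ?q s" for r
    using that V by (intro mult_right_mono) auto
  have "\<exists>h>0. convex_body (stretch h ?b ` ?K) \<and>
      sym_le d ((\<lambda>j. axis j 1) ` (J - {j0})) (stretch h ?b ` ?K) (max ?q s + \<epsilon>)"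
  proof (rule exists_flat_body[OF K refl eps])
    show "0 \<le> max ?q s" by (simp add: le_max_iff_disj)
    fix S p q
    assume S: "flat_involution d S" "\<forall>w\<in>(\<lambda>j. axis j 1) ` (J - {j0}). S w = w"
      and "S ?b = ?b \<and> S p = - p \<and> S q = - q \<or>
        S ?b = - ?b \<and> p \<bullet> ?b = 0 \<and> S p = p \<and> S q + q + (q \<bullet> ?b) *\<^sub>R p = 0"
    then show "overlap ?K (\<lambda>y. S y + (y \<bullet> ?b) *\<^sub>R p + q) \<le> max ?q s * measure lebesgue ?K"
      using overlap_cone_over_preserving[OF S(1) _ _ _ S(2) sym, of p q] mono[of s]
        overlap_cone_over_reversing[OF S(1) _ _ _ m, of p q] mono[of ?q]
      by (smt (verit, best) max.cobounded1 max.cobounded2)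
  qed
  then show ?thesis using cylindrical_stretch_cone_over by blast
qed

end

subsection \<open>Cylinders over bodies of lower dimension\<close>

lemma prod_Basis_vec: "(\<Prod>b\<in>(Basis :: (real^'n) set). f b) = (\<Prod>i\<in>UNIV. f (axis i 1))"
proof -
  have "(Basis :: (real^'n) set) = range (\<lambda>i. axis i 1)" by (auto simp: Basis_vec_def)
  moreover have "inj (\<lambda>i::'n. axis i (1::real))" by (auto simp: inj_def axis_eq_axis)
  ultimately show ?thesis using prod.reindex[of "\<lambda>i::'n. axis i (1::real)" UNIV f] by (simp only: o_def)
qed

lemma sum_Basis_vec: "(\<Sum>b\<in>(Basis :: (real^'n) set). f b) = (\<Sum>i\<in>UNIV. f (axis i 1))"
proof -
  have "(Basis :: (real^'n) set) = range (\<lambda>i. axis i 1)" by (auto simp: Basis_vec_def)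
  moreover have "inj (\<lambda>i::'n. axis i (1::real))" by (auto simp: inj_def axis_eq_axis)
  ultimately show ?thesis using sum.reindex[of "\<lambda>i::'n. axis i (1::real)" UNIV f] by (simp only: o_def)
qed

definition select :: "('a \<Rightarrow> 'b) \<Rightarrow> real^'b \<Rightarrow> real^'a" where
  "select g x = (\<chi> i. x $ g i)"

definition embed :: "('a \<Rightarrow> 'b) \<Rightarrow> real^'b \<Rightarrow> real^'a \<Rightarrow> real^'b" where
  "embed g z y = (\<chi> j. if j \<in> range g then y $ (inv g j) else z $ j)"

definition cylinder :: "('a \<Rightarrow> 'b) \<Rightarrow> (real^'a) set \<Rightarrow> (real^'b) set" where
  "cylinder g K = {x. select g x \<in> K \<and> (\<forall>j. j \<notin> range g \<longrightarrow> 0 \<le> x $ j \<and> x $ j \<le> 1)}"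

lemma linear_select: "linear (select g)"
  by (rule linearI) (simp_all add: select_def vec_eq_iff)

context
  fixes g :: "'a::finite \<Rightarrow> 'b::finite"
  assumes g: "inj g"
begin

lemma embed_nth: "embed g z y $ g i = y $ i" "j \<notin> range g \<Longrightarrow> embed g z y $ j = z $ j"
  using g by (auto simp: embed_def)

lemma select_embed: "select g (embed g z y) = y"
  by (simp add: select_def embed_nth vec_eq_iff)

lemma embed_select: "(\<And>j. j \<notin> range g \<Longrightarrow> z $ j = x $ j) \<Longrightarrow> embed g z (select g x) = x"
proof -
  assume a: "\<And>j. j \<notin> range g \<Longrightarrow> z $ j = x $ j"
  have "embed g z (select g x) $ j = x $ j" for j
  proof (cases "j \<in> range g")
    case True
    then show ?thesis by (auto simp: embed_nth select_def)
  next
    case False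
    then show ?thesis using a by (simp add: embed_nth)
  qed
  then show ?thesis by (simp add: vec_eq_iff)
qed

text \<open>The volume of the cylinder, as a function of its base, is the image under
  \<open>select g\<close> of Lebesgue measure restricted to \<open>A\<close>. On boxes the extra
  coordinates contribute sides of length 1, so uniqueness of Lebesgue measure applies.\<close>

lemma emeasure_cylinder:
  assumes X: "X \<in> sets borel"
  shows "emeasure lborel (cylinder g X) = emeasure lborel X"
proof -
  define A where "A = {x :: real^'b. \<forall>j\<in>-range g. 0 \<le> x $ j \<and> x $ j \<le> 1}"
  have "closed (\<Inter>j\<in>-range g. {x :: real^'b. 0 \<le> x $ j} \<inter> {x. x $ j \<le> 1})"
    by (intro closed_INT ballI closed_Int closed_Collect_le continuous_intros)
  moreover have "A = (\<Inter>j\<in>-range g. {x. 0 \<le> x $ j} \<inter> {x. x $ j \<le> 1})" by (auto simp: A_def)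
  ultimately have "closed A" by simp
  then have A: "A \<in> sets borel" by (rule borel_closed)
  have pm: "select g \<in> borel_measurable borel"
    using linear_select[of g] by (intro borel_measurable_continuous_onI linear_continuous_on) (simp add: linear_linear)
  then have pm': "select g \<in> borel_measurable lborel" by simp
  have M: "emeasure (distr (restrict_space lborel A) borel (select g)) Y = emeasure lborel (select g -` Y \<inter> A)"
    if "Y \<in> sets borel" for Y
  proof -
    have "emeasure (distr (restrict_space lborel A) borel (select g)) Y
        = emeasure (restrict_space lborel A) (select g -` Y \<inter> space (restrict_space lborel A))"
      by (rule emeasure_distr[OF measurable_restrict_space1[OF pm'] that])
    also have "\<dots> = emeasure lborel (select g -` Y \<inter> space (restrict_space lborel A))"
      by (rule emeasure_restrict_space) (use A in \<open>auto simp: space_restrict_space\<close>)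
    finally show ?thesis by (simp add: space_restrict_space)
  qed
  have "lborel = distr (restrict_space lborel A) borel (select g)"
  proof (rule lborel_eqI)
    fix l u :: "real^'a" assume le: "\<And>b. b \<in> Basis \<Longrightarrow> l \<bullet> b \<le> u \<bullet> b"
    have le': "l $ i \<le> u $ i" for i using le[of "axis i 1"] by (simp add: inner_axis)
    define l' where "l' = embed g 0 l"
    define u' where "u' = embed g 1 u"
    have lu: "l' \<bullet> b \<le> u' \<bullet> b" if "b \<in> Basis" for b
    proof -
      have "b \<in> range (\<lambda>j. axis j 1)" using that by (auto simp: Basis_vec_def)
      then obtain j where j: "b = axis j 1" by blast
      show ?thesis
      proof (cases "j \<in> range g")
        case True
        then show ?thesis using le' by (auto simp: j inner_axis l'_def u'_def embed_nth)
      next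
        case False
        then show ?thesis by (simp add: j inner_axis l'_def u'_def embed_nth)
      qed
    qed
    have prod: "(\<Prod>b\<in>Basis. (u' - l') \<bullet> b) = (\<Prod>b\<in>Basis. (u - l) \<bullet> b)"
    proof -
      have "(\<Prod>b\<in>Basis. (u' - l') \<bullet> b) = (\<Prod>j\<in>UNIV. u' $ j - l' $ j)"
        by (simp add: prod_Basis_vec inner_axis)
      also have "\<dots> = (\<Prod>j\<in>range g. u' $ j - l' $ j)"
        by (rule prod.mono_neutral_right) (auto simp: u'_def l'_def embed_nth)
      also have "\<dots> = (\<Prod>i\<in>UNIV. u $ i - l $ i)"
        using g by (simp add: prod.reindex o_def u'_def l'_def embed_nth)
      finally show ?thesis by (simp add: prod_Basis_vec inner_axis)
    qed
    have "emeasure lborel (select g -` box l u \<inter> A) = (\<Prod>b\<in>Basis. (u - l) \<bullet> b)"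
    proof (rule antisym)
      have "select g -` box l u \<inter> A \<subseteq> cbox l' u'"
      proof
        fix x assume x: "x \<in> select g -` box l u \<inter> A"
        have "l' $ j \<le> x $ j \<and> x $ j \<le> u' $ j" for j
        proof (cases "j \<in> range g")
          case True
          then show ?thesis using x by (auto simp: l'_def u'_def embed_nth select_def mem_box_cart less_imp_le)
        next
          case False
          then show ?thesis using x by (auto simp: l'_def u'_def embed_nth A_def)
        qed
        then show "x \<in> cbox l' u'" by (simp add: mem_box_cart)
      qed
      then have "emeasure lborel (select g -` box l u \<inter> A) \<le> emeasure lborel (cbox l' u')" by (intro emeasure_mono) auto
      also have "\<dots> = (\<Prod>b\<in>Basis. (u - l) \<bullet> b)" using lu prod by (simp add: emeasure_lborel_cbox)
      finally show "emeasure lborel (select g -` box l u \<inter> A) \<le> \<dots>" .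
      have "box l' u' \<subseteq> select g -` box l u \<inter> A"
      proof
        fix x assume x: "x \<in> box l' u'"
        then have lt: "l' $ j < x $ j \<and> x $ j < u' $ j" for j by (simp add: mem_box_cart)
        have "l $ i < x $ g i \<and> x $ g i < u $ i" for i
          using lt[of "g i"] by (simp add: l'_def u'_def embed_nth)
        moreover have "0 \<le> x $ j \<and> x $ j \<le> 1" if "j \<notin> range g" for j
          using lt[of j] that by (simp add: l'_def u'_def embed_nth)
        ultimately show "x \<in> select g -` box l u \<inter> A"
          by (simp add: A_def mem_box_cart select_def)
      qed
      then have "emeasure lborel (box l' u') \<le> emeasure lborel (select g -` box l u \<inter> A)"
        using A measurable_sets[OF pm, of "box l u"] by (intro emeasure_mono) auto
      moreover have "emeasure lborel (box l' u') = (\<Prod>b\<in>Basis. (u - l) \<bullet> b)"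
        using lu prod by (simp add: emeasure_lborel_box)
      ultimately show "(\<Prod>b\<in>Basis. (u - l) \<bullet> b) \<le> emeasure lborel (select g -` box l u \<inter> A)" by simp
    qed
    then show "emeasure (distr (restrict_space lborel A) borel (select g)) (box l u) = (\<Prod>b\<in>Basis. (u - l) \<bullet> b)"
      by (simp add: M)
  qed simp
  then have "emeasure lborel X = emeasure (distr (restrict_space lborel A) borel (select g)) X" by metis
  also have "\<dots> = emeasure lborel (select g -` X \<inter> A)" by (rule M[OF X])
  also have "select g -` X \<inter> A = cylinder g X" by (auto simp: cylinder_def A_def)
  finally show ?thesis by simp
qed

lemma compact_cylinder:
  assumes "compact X"
  shows "compact (cylinder g X)"
proof -
  let ?f = "\<lambda>p. embed g (snd p) (fst p)"
  have "cylinder g X = ?f ` (X \<times> cbox 0 1)"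
  proof (intro equalityI subsetI)
    fix x assume x: "x \<in> cylinder g X"
    let ?z = "\<chi> j. if j \<in> range g then 0 else x $ j"
    have "x = ?f (select g x, ?z)" using embed_select[of ?z x] by simp
    moreover have "?z \<in> cbox 0 1" using x by (auto simp: mem_box_cart cylinder_def)
    moreover have "select g x \<in> X" using x by (simp add: cylinder_def)
    ultimately show "x \<in> ?f ` (X \<times> cbox 0 1)" by blast
  next
    fix x assume "x \<in> ?f ` (X \<times> cbox 0 1)"
    then show "x \<in> cylinder g X"
      by (auto simp: cylinder_def select_embed embed_nth mem_box_cart)
  qed
  moreover have "continuous_on (X \<times> cbox 0 1) ?f"
    unfolding embed_def
  proof (intro continuous_on_vec_lambda)
    fix j show "continuous_on (X \<times> cbox 0 1) (\<lambda>p. if j \<in> range g then fst p $ inv g j else snd p $ j)"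
      by (cases "j \<in> range g") (auto intro!: continuous_intros)
  qed
  ultimately show ?thesis using assms by (simp add: compact_continuous_image compact_Times)
qed

lemma measure_cylinder:
  assumes "compact X"
  shows "measure lebesgue (cylinder g X) = measure lebesgue X"
  using emeasure_cylinder[OF borel_compact[OF assms]]
  by (simp add: emeasure_compact_eq_measure assms compact_cylinder)

lemma convex_body_cylinder:
  assumes K: "convex_body K"
  shows "convex_body (cylinder g K)"
proof (rule convex_bodyI)
  have cK: "compact K" "convex K" using K by (auto simp: convex_body_def)
  show "compact (cylinder g K)" by (rule compact_cylinder[OF cK(1)])
  show "measure lebesgue (cylinder g K) > 0"
    using convex_body_measure_pos[OF K] by (simp add: measure_cylinder cK)
  show "convex (cylinder g K)"
  proof (rule convexI)
    fix x y u v assume xy: "x \<in> cylinder g K" "y \<in> cylinder g K" and uv: "0 \<le> u" "0 \<le> (v::real)" "u + v = 1"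
    have "select g (u *\<^sub>R x + v *\<^sub>R y) = u *\<^sub>R select g x + v *\<^sub>R select g y"
      by (simp add: linear_add[OF linear_select] linear_scale[OF linear_select])
    moreover have "u *\<^sub>R select g x + v *\<^sub>R select g y \<in> K"
      using xy uv cK(2) by (intro convexD) (auto simp: cylinder_def)
    moreover have "0 \<le> u * x $ j + v * y $ j \<and> u * x $ j + v * y $ j \<le> 1" if "j \<notin> range g" for j
      using xy uv that by (auto simp: cylinder_def intro!: convex_bound_le)
    ultimately show "u *\<^sub>R x + v *\<^sub>R y \<in> cylinder g K" by (simp add: cylinder_def)
  qed
qed

lemma cylindrical_cylinder: "cylindrical (- range g) (cylinder g K)"
proof -
  have "select g z = select g x" if "\<forall>i. i \<notin> - range g \<longrightarrow> z $ i = x $ i" for x z :: "real^'b"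
    using that by (simp add: select_def vec_eq_iff)
  note sel = this
  show ?thesis unfolding cylindrical_def
  proof (intro ballI conjI allI impI)
    fix x j assume "x \<in> cylinder g K" "j \<in> - range g"
    then show "0 \<le> x $ j" "x $ j \<le> 1" by (simp_all add: cylinder_def)
  next
    fix x z assume x: "x \<in> cylinder g K"
      and z: "(\<forall>i. i \<notin> - range g \<longrightarrow> z $ i = x $ i) \<and> (\<forall>j\<in>- range g. 0 \<le> z $ j \<and> z $ j \<le> 1)"
    then show "z \<in> cylinder g K" using sel[of z x] by (simp add: cylinder_def)
  qed
qed

text \<open>A reflection that fixes the cube axes acts on the remaining coordinates alone. There it
  is a reflection in a k-flat of the base, whose dimension is smaller by the number of cube
  axes.\<close>

lemma sym_le_cylinder:
  assumes K: "convex_body K"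
  shows "sym_le (k + card (- range g)) ((\<lambda>j. axis j 1) ` (- range g)) (cylinder g K) (Sym k K)"
  unfolding sym_le_def
proof (intro allI impI)
  fix S :: "real^'b \<Rightarrow> real^'b" and e
  assume S: "flat_involution (k + card (- range g)) S"
    and F: "\<forall>w\<in>(\<lambda>j. axis j 1) ` (- range g). S w = w" and Se: "S e = - e"
  have cK: "compact K" using K by (simp add: convex_body_def)
  have lS: "linear S" and SS: "\<And>x. S (S x) = x" and sa: "\<And>x y. S x \<bullet> y = x \<bullet> S y"
    using flat_involutionD[OF S] by auto
  have SJ: "S (axis j 1) = axis j 1" if "j \<notin> range g" for j using F that by blast
  have Sxj: "S x $ j = x $ j" if "j \<notin> range g" for x j
    using sa[of x "axis j 1"] SJ[OF that] by (simp add: inner_axis)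
  have ej: "e $ j = 0" if "j \<notin> range g" for j
    using Sxj[OF that, of e] Se by simp
  let ?\<iota> = "embed g 0"
  define S' where "S' y = select g (S (?\<iota> y))" for y
  have li: "linear ?\<iota>"
  proof (rule linearI)
    show "?\<iota> (x + y) = ?\<iota> x + ?\<iota> y" for x y by (simp add: embed_def vec_eq_iff)
    show "?\<iota> (c *\<^sub>R x) = c *\<^sub>R ?\<iota> x" for c x by (simp add: embed_def vec_eq_iff)
  qed
  have adj: "select g x \<bullet> z = x \<bullet> ?\<iota> z" for x z
  proof -
    have "x \<bullet> ?\<iota> z = (\<Sum>j\<in>UNIV. x $ j * ?\<iota> z $ j)" by (simp add: inner_vec_def)
    also have "\<dots> = (\<Sum>j\<in>range g. x $ j * ?\<iota> z $ j)"
      by (rule sum.mono_neutral_right) (auto simp: embed_nth)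
    also have "\<dots> = (\<Sum>i\<in>UNIV. x $ g i * z $ i)" using g by (simp add: sum.reindex embed_nth)
    finally show ?thesis by (simp add: inner_vec_def select_def)
  qed
  have iota_axis: "?\<iota> (axis i 1) = axis (g i) 1" for i
  proof -
    have "?\<iota> (axis i 1) $ j = (axis (g i) 1 :: real^'b) $ j" for j
      using g by (cases "j \<in> range g") (auto simp: embed_nth axis_def inj_eq)
    then show ?thesis by (simp add: vec_eq_iff)
  qed
  have S': "flat_involution k S'"
    unfolding flat_involution_def
  proof (intro conjI allI)
    show "linear S'" unfolding S'_def
      using linear_compose[OF linear_compose[OF li lS] linear_select[of g]] by (simp add: o_def)
    show "S' (S' y) = y" for y
    proof -
      have "?\<iota> (select g (S (?\<iota> y))) = S (?\<iota> y)"
        by (rule embed_select) (simp add: Sxj embed_nth)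
      then show ?thesis by (simp add: S'_def SS select_embed)
    qed
    show "S' x \<bullet> y = x \<bullet> S' y" for x y
      unfolding S'_def adj using adj[of "S (?\<iota> y)" x] sa[of "?\<iota> x" "?\<iota> y"] by (simp add: inner_commute)
    \<comment> \<open>Each fixed axis contributes 1 to the trace. Removing them takes their number
      off the trace and off the dimension, which leaves the trace of a k-flat in the base.\<close>
    have "(\<Sum>j\<in>UNIV. S (axis j 1) $ j) = (\<Sum>j\<in>range g. S (axis j 1) $ j) + (\<Sum>j\<in>- range g. S (axis j 1) $ j)"
      using sum.union_disjoint[of "range g" "- range g" "\<lambda>j. S (axis j 1) $ j"] by (simp add: Compl_partition)
    also have "(\<Sum>j\<in>- range g. S (axis j 1) $ j) = real (card (- range g))"
    proof -
      have "S (axis j 1) $ j = 1" if "j \<in> - range g" for j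
        using Sxj[of j "axis j 1"] that by (simp add: axis_def)
      then show ?thesis by simp
    qed
    also have "(\<Sum>j\<in>range g. S (axis j 1) $ j) = (\<Sum>i\<in>UNIV. S' (axis i 1) $ i)"
      using g by (simp add: sum.reindex S'_def iota_axis select_def)
    finally have "(\<Sum>i\<in>UNIV. S' (axis i 1) $ i) = 2 * real (k + card (- range g)) - real CARD('b) - real (card (- range g))"
      using flat_involutionD(5)[OF S] by (simp add: sum_Basis_vec inner_axis)
    moreover have "CARD('b) = CARD('a) + card (- range g)"
    proof -
      have "card (range g) = CARD('a)" using g by (rule card_image)
      moreover have "card (range g \<union> - range g) = card (range g) + card (- range g)"
        by (rule card_Un_disjoint) auto
      ultimately show ?thesis by (simp add: Compl_partition)
    qed
    ultimately show "(\<Sum>b\<in>Basis. S' b \<bullet> b) = 2 * real k - real DIM(real^'a)"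
      by (simp add: sum_Basis_vec inner_axis)
  qed
  have S'e: "S' (select g e) = - select g e"
  proof -
    have "?\<iota> (select g e) = e" by (rule embed_select) (simp add: ej)
    then show ?thesis by (simp add: S'_def Se linear_neg[OF linear_select])
  qed
  \<comment> \<open>Split \<open>x\<close> into its part in the base coordinates and a combination
    \<open>r\<close> of cube axes, which \<open>S\<close> fixes and \<open>select g\<close>
    kills.\<close>
  have comm: "select g (S x) = S' (select g x)" for x
  proof -
    define r :: "real^'b" where "r = (\<Sum>j\<in>- range g. x $ j *\<^sub>R axis j 1)"
    have rj: "r $ i = (if i \<in> range g then 0 else x $ i)" for i
    proof -
      have "r $ i = (\<Sum>j\<in>- range g. if j = i then x $ j else 0)"
        unfolding r_def sum_component by (rule sum.cong) (auto simp: axis_def)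
      then show ?thesis by simp
    qed
    have "x = ?\<iota> (select g x) + r"
    proof -
      have "(?\<iota> (select g x) + r) $ j = x $ j" for j
        by (cases "j \<in> range g") (auto simp: rj embed_nth select_def)
      then show ?thesis by (simp add: vec_eq_iff)
    qed
    moreover have "S r = r" unfolding r_def linear_sum[OF lS]
      by (intro sum.cong) (auto simp: linear_scale[OF lS] SJ)
    moreover have "select g r = 0" by (simp add: select_def rj vec_eq_iff)
    ultimately show ?thesis unfolding S'_def by (metis linear_add[OF lS] linear_add[OF linear_select] add.right_neutral)
  qed
  have "{x \<in> cylinder g K. S x + e \<in> cylinder g K} = cylinder g {y \<in> K. S' y + select g e \<in> K}"
    by (auto simp: cylinder_def linear_add[OF linear_select] comm Sxj ej)
  then have "overlap (cylinder g K) (\<lambda>x. S x + e) = overlap K (\<lambda>y. S' y + select g e)"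
    unfolding overlap_def
    by (simp add: measure_cylinder compact_overlap_set[OF cK continuous_reflection[OF S']])
  also have "\<dots> \<le> Sym k K * measure lebesgue K" by (rule Sym_upper[OF K S' S'e])
  finally show "overlap (cylinder g K) (\<lambda>x. S x + e) \<le> Sym k K * measure lebesgue (cylinder g K)"
    by (simp add: measure_cylinder cK)
qed

end

subsection \<open>A flat planar body\<close>

lemma compact_strip: "compact {x :: real^2. 0 \<le> x $ 1 \<and> x $ 1 \<le> 1 \<and> l \<le> x $ 2 \<and> x $ 2 \<le> u}"
  and measure_strip: "l \<le> u \<Longrightarrow> measure lebesgue {x :: real^2. 0 \<le> x $ 1 \<and> x $ 1 \<le> 1 \<and> l \<le> x $ 2 \<and> x $ 2 \<le> u} = u - l"
proof -
  have eq: "{x :: real^2. 0 \<le> x $ 1 \<and> x $ 1 \<le> 1 \<and> l \<le> x $ 2 \<and> x $ 2 \<le> u} = cbox (vector [0, l]) (vector [1, u])"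
    by (auto simp: mem_box_cart forall_2)
  show "compact {x :: real^2. 0 \<le> x $ 1 \<and> x $ 1 \<le> 1 \<and> l \<le> x $ 2 \<and> x $ 2 \<le> u}" unfolding eq by simp
  assume le: "l \<le> u"
  then have "vector [0, l] \<in> cbox (vector [0, l]) (vector [1, u] :: real^2)"
    by (simp add: mem_box_cart forall_2)
  then have "cbox (vector [0, l]) (vector [1, u] :: real^2) \<noteq> {}" by blast
  then have "measure lborel (cbox (vector [0, l]) (vector [1, u] :: real^2)) = u - l"
    by (simp add: content_cbox_cart UNIV_2)
  then show "measure lebesgue {x :: real^2. 0 \<le> x $ 1 \<and> x $ 1 \<le> 1 \<and> l \<le> x $ 2 \<and> x $ 2 \<le> u} = u - l"
    unfolding eq by simp
qed

text \<open>The hypothesis compares pairs of points on a common vertical line, so the shape of a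
  section is irrelevant: it lies in an interval of length \<open>g\<close> above its lowest
  point.\<close>

lemma planar_measure_le:
  fixes X :: "(real^2) set"
  assumes X: "compact X" and g: "continuous_on {a..c} g" and g0: "\<And>t. t \<in> {a..c} \<Longrightarrow> 0 \<le> g t"
    and w: "\<And>x y. x \<in> X \<Longrightarrow> y \<in> X \<Longrightarrow> x $ 1 = y $ 1 \<Longrightarrow> y $ 2 - x $ 2 \<le> g (x $ 1)"
    and sub: "\<And>x. x \<in> X \<Longrightarrow> x $ 1 \<in> {a..c}"
  shows "measure lebesgue X \<le> integral {a..c} g"
proof -
  let ?b = "axis 1 1 :: real^2"
  have B: "?b \<in> Basis" by simp
  show ?thesis
  proof (rule measure_le_integral_slices[OF B X g g0])
    show "x \<bullet> ?b \<in> {a..c}" if "x \<in> X" for x using sub[OF that] by (simp add: inner_axis)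
    fix t assume t: "t \<in> {a<..<c}"
    let ?S = "slice X ?b t"
    have S: "compact ?S" by (rule compact_slice[OF B X])
    have mem: "x \<in> ?S \<longleftrightarrow> 0 \<le> x $ 1 \<and> x $ 1 \<le> 1 \<and> (\<chi> i. if i = 1 then t else x $ 2) \<in> X" for x
    proof -
      have "x + (t - x $ 1) *\<^sub>R ?b = (\<chi> i. if i = 1 then t else x $ 2)"
        by (simp add: vec_eq_iff forall_2 axis_def)
      then show ?thesis by (simp add: slice_def inner_axis)
    qed
    show "measure lebesgue ?S \<le> g t"
    proof (cases "?S = {}")
      case True
      then show ?thesis using g0[of t] t by simp
    next
      case False
      have "continuous_on ?S (\<lambda>x. x $ 2)" by (intro continuous_intros)
      from continuous_attains_inf[OF S False this]
      obtain x0 where "x0 \<in> ?S \<and> (\<forall>x\<in>?S. x0 $ 2 \<le> x $ 2)" by blast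
      then have x0: "x0 \<in> ?S" "\<And>x. x \<in> ?S \<Longrightarrow> x0 $ 2 \<le> x $ 2" by auto
      have "?S \<subseteq> {x. 0 \<le> x $ 1 \<and> x $ 1 \<le> 1 \<and> x0 $ 2 \<le> x $ 2 \<and> x $ 2 \<le> x0 $ 2 + g t}"
      proof
        fix x assume x: "x \<in> ?S"
        have "x $ 2 - x0 $ 2 \<le> g t"
          using w[of "\<chi> i. if i = 1 then t else x0 $ 2" "\<chi> i. if i = 1 then t else x $ 2"] x x0(1)
          by (simp add: mem)
        then show "x \<in> {x. 0 \<le> x $ 1 \<and> x $ 1 \<le> 1 \<and> x0 $ 2 \<le> x $ 2 \<and> x $ 2 \<le> x0 $ 2 + g t}"
          using x x0(2)[OF x] by (simp add: mem)
      qed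
      then have "measure lebesgue ?S \<le> measure lebesgue {x :: real^2. 0 \<le> x $ 1 \<and> x $ 1 \<le> 1 \<and> x0 $ 2 \<le> x $ 2 \<and> x $ 2 \<le> x0 $ 2 + g t}"
        using S compact_strip[of "x0 $ 2" "x0 $ 2 + g t"]
        by (intro measure_mono_fmeasurable) (auto simp: lmeasurable_compact fmeasurableD)
      moreover have "0 \<le> g t" using g0[of t] t by simp
      ultimately show ?thesis using measure_strip[of "x0 $ 2" "x0 $ 2 + g t"] by simp
    qed
  qed
qed

text \<open>Piecewise affine profiles are written below as sums of such ramps. Each is integrated
  over the whole interval, with no splitting at the breakpoints.\<close>

lemma has_integral_ramp:
  assumes "a \<le> s" "s \<le> c"
  shows "((\<lambda>t. k * max 0 (t - s)) has_integral k * (c - s)\<^sup>2 / 2) {a..c::real}"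
proof -
  have "((\<lambda>t. k * max 0 (t - s)) has_integral k * (max 0 (c - s))\<^sup>2 / 2 - k * (max 0 (a - s))\<^sup>2 / 2) {a..c}"
  proof (rule fundamental_theorem_of_calculus_strong[where S = "{s}"])
    show "continuous_on {a..c} (\<lambda>t. k * (max 0 (t - s))\<^sup>2 / 2)" by (intro continuous_intros) simp
    fix t assume t: "t \<in> {a..c} - {s}"
    show "((\<lambda>t. k * (max 0 (t - s))\<^sup>2 / 2) has_vector_derivative k * max 0 (t - s)) (at t)"
    proof (cases "t < s")
      case True
      have "((\<lambda>t. 0 :: real) has_vector_derivative 0) (at t)" by simp
      then have "((\<lambda>t. k * (max 0 (t - s))\<^sup>2 / 2) has_vector_derivative 0) (at t)"
        by (rule has_vector_derivative_transform_within_open[where S = "{..<s}"]) (use True in auto)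
      then show ?thesis using True by simp
    next
      case False
      then have "s < t" using t by auto
      have "((\<lambda>t. k * (t - s)\<^sup>2 / 2) has_real_derivative k * (t - s)) (at t)"
        by (auto intro!: derivative_eq_intros)
      then have "((\<lambda>t. k * (t - s)\<^sup>2 / 2) has_vector_derivative k * (t - s)) (at t)"
        by (simp add: has_real_derivative_iff_has_vector_derivative)
      then have "((\<lambda>t. k * (max 0 (t - s))\<^sup>2 / 2) has_vector_derivative k * (t - s)) (at t)"
        by (rule has_vector_derivative_transform_within_open[where S = "{s<..}"]) (use \<open>s < t\<close> in auto)
      then show ?thesis using \<open>s < t\<close> by simp
    qed
  qed (use assms in auto)
  then show ?thesis using assms by simp
qed

text \<open>Here max 0 u - max 0 (u - v) + max 0 (- v) is the positive part of the minimum of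
  an increasing u and a decreasing v.\<close>

lemma planar_measure_le_triangle:
  fixes X :: "(real^2) set"
  assumes X: "compact X" and k: "k1 > 0" "k2 > 0"
    and w: "\<And>x y. x \<in> X \<Longrightarrow> y \<in> X \<Longrightarrow> x $ 1 = y $ 1 \<Longrightarrow> y $ 2 - x $ 2 \<le> k1 * (x $ 1 - t1) \<and> y $ 2 - x $ 2 \<le> k2 * (t2 - x $ 1)"
  shows "measure lebesgue X \<le> k1 * k2 / (2 * (k1 + k2)) * (max 0 (t2 - t1))\<^sup>2"
proof (cases "t1 \<le> t2")
  case True
  \<comment> \<open>The abscissa where the two lines meet; the peak there has height
    \<open>k1 * k2 * (t2 - t1) / (k1 + k2)\<close>.\<close>
  define s where "s = (k1 * t1 + k2 * t2) / (k1 + k2)"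
  have kk: "k1 + k2 > 0" using k by simp
  have s: "(k1 + k2) * s = k1 * t1 + k2 * t2" using kk by (simp add: s_def)
  have s12: "t1 \<le> s" "s \<le> t2"
  proof -
    have "k2 * t1 \<le> k2 * t2" "k1 * t1 \<le> k1 * t2" using k True by (auto intro: mult_left_mono)
    then have "(k1 + k2) * t1 \<le> (k1 + k2) * s" "(k1 + k2) * s \<le> (k1 + k2) * t2"
      unfolding s by (auto simp: algebra_simps)
    then show "t1 \<le> s" "s \<le> t2" using kk by auto
  qed
  let ?g = "\<lambda>t. k1 * max 0 (t - t1) - (k1 + k2) * max 0 (t - s) + k2 * max 0 (t - t2)"
  have split: "k1 * (t - t1) - (k1 + k2) * (t - s) = k2 * (t2 - t)" for t
    using s by (simp add: algebra_simps)
  have g_eq: "?g t = max 0 (min (k1 * (t - t1)) (k2 * (t2 - t)))" for t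
  proof -
    consider "t \<le> t1" | "t1 \<le> t" "t \<le> s" | "s \<le> t" "t \<le> t2" | "t2 \<le> t" by linarith
    then show ?thesis
    proof cases
      case 1
      then have "k1 * (t - t1) \<le> 0" using k by (simp add: mult_le_0_iff)
      moreover have "max 0 (t - t1) = 0" "max 0 (t - s) = 0" "max 0 (t - t2) = 0" using 1 s12 by auto
      ultimately show ?thesis by (simp add: min_le_iff_disj max_absorb1)
    next
      case 2
      then have "(k1 + k2) * (t - s) \<le> 0" "0 \<le> k1 * (t - t1)" using kk k by (auto simp: mult_le_0_iff)
      then show ?thesis using 2 s12 split[of t] by (auto simp: max_def min_def)
    next
      case 3
      then have "(k1 + k2) * (t - s) \<ge> 0" "0 \<le> k2 * (t2 - t)" using kk k by auto
      then show ?thesis using 3 s12 split[of t] by (auto simp: max_def min_def)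
    next
      case 4
      then have "k2 * (t2 - t) \<le> 0" using k by (simp add: mult_le_0_iff)
      moreover have "max 0 (t - t1) = t - t1" "max 0 (t - s) = t - s" "max 0 (t - t2) = t - t2"
        using 4 s12 by auto
      moreover have "k1 * (t - t1) - (k1 + k2) * (t - s) + k2 * (t - t2) = 0"
        using split[of t] by (simp add: algebra_simps)
      ultimately show ?thesis by (simp add: min_le_iff_disj max_absorb1)
    qed
  qed
  have "(?g has_integral k1 * (t2 - t1)\<^sup>2 / 2 - (k1 + k2) * (t2 - s)\<^sup>2 / 2 + k2 * (t2 - t2)\<^sup>2 / 2) {t1..t2}"
    using s12 by (intro has_integral_add has_integral_diff has_integral_ramp) auto
  also have "k1 * (t2 - t1)\<^sup>2 / 2 - (k1 + k2) * (t2 - s)\<^sup>2 / 2 + k2 * (t2 - t2)\<^sup>2 / 2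
      = k1 * k2 / (2 * (k1 + k2)) * (t2 - t1)\<^sup>2"
  proof -
    have "t2 - s = k1 * (t2 - t1) / (k1 + k2)" using kk by (simp add: s_def field_simps)
    then have "(k1 + k2) * (t2 - s)\<^sup>2 = k1 * (t2 - t1) * (k1 * (t2 - t1)) / (k1 + k2)"
      using kk by (simp add: power2_eq_square)
    then show ?thesis using kk by (simp add: field_simps power2_eq_square)
  qed
  finally have I: "integral {t1..t2} ?g = k1 * k2 / (2 * (k1 + k2)) * (t2 - t1)\<^sup>2" by (rule integral_unique)
  have "measure lebesgue X \<le> integral {t1..t2} ?g"
  proof (rule planar_measure_le[OF X])
    show "continuous_on {t1..t2} ?g" by (intro continuous_intros)
    show "0 \<le> ?g t" for t unfolding g_eq by simp
    show "y $ 2 - x $ 2 \<le> ?g (x $ 1)" if "x \<in> X" "y \<in> X" "x $ 1 = y $ 1" for x y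
      unfolding g_eq using w[OF that] by (simp add: le_max_iff_disj)
    show "x $ 1 \<in> {t1..t2}" if "x \<in> X" for x
      using w[OF that that] k by (simp add: zero_le_mult_iff)
  qed
  then show ?thesis using I True by simp
next
  case False
  have "x \<notin> X" for x
  proof
    assume "x \<in> X"
    then have "t1 \<le> x $ 1" "x $ 1 \<le> t2" using w[of x x] k by (auto simp: zero_le_mult_iff)
    then show False using False by simp
  qed
  then have "X = {}" by blast
  then show ?thesis using k by simp
qed

text \<open>Half of \<open>?T\<close> is the area under a tent cut off by the line
  \<open>\<alpha> + \<beta> x\<close>. Clearing denominators and completing the square shows that
  \<open>?T\<close> is \<open>r\<^sup>2 / 3\<close> minus a nonnegative term that vanishes at
  \<open>6 * \<alpha> = r * (2 - \<beta>) * (1 - \<beta>)\<close>.\<close>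

lemma tent_quadrilateral_bound:
  fixes \<alpha> \<beta> r :: real
  assumes r: "r * r = 2" and be: "0 \<le> \<beta>" "\<beta> < 1"
  shows "(\<alpha>\<^sup>2 / (2 - \<beta>) - 2 * \<alpha>\<^sup>2 / (1 - \<beta>) - 2 * (r - \<alpha>)\<^sup>2 / (1 + \<beta>) + (2 * r - \<alpha>)\<^sup>2 / (2 + \<beta>)) / 2 \<le> 1 / 3"
    (is "?T / 2 \<le> _")
proof -
  define D where "D = (2 + \<beta>) * (1 + \<beta>) * (2 - \<beta>) * (1 - \<beta>)"
  have D: "D > 0" unfolding D_def using be by (intro mult_pos_pos) auto
  have "\<alpha>\<^sup>2 / (2 - \<beta>) * D = \<alpha>\<^sup>2 * ((2 + \<beta>) * (1 + \<beta>) * (1 - \<beta>))"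
    "2 * \<alpha>\<^sup>2 / (1 - \<beta>) * D = 2 * \<alpha>\<^sup>2 * ((2 + \<beta>) * (1 + \<beta>) * (2 - \<beta>))"
    "2 * (r - \<alpha>)\<^sup>2 / (1 + \<beta>) * D = 2 * (r - \<alpha>)\<^sup>2 * ((2 + \<beta>) * (2 - \<beta>) * (1 - \<beta>))"
    "(2 * r - \<alpha>)\<^sup>2 / (2 + \<beta>) * D = (2 * r - \<alpha>)\<^sup>2 * ((1 + \<beta>) * (2 - \<beta>) * (1 - \<beta>))"
    using be by (simp_all add: D_def)
  then have TD: "?T * D = \<alpha>\<^sup>2 * ((2 + \<beta>) * (1 + \<beta>) * (1 - \<beta>)) - 2 * \<alpha>\<^sup>2 * ((2 + \<beta>) * (1 + \<beta>) * (2 - \<beta>))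
    - 2 * (r - \<alpha>)\<^sup>2 * ((2 + \<beta>) * (2 - \<beta>) * (1 - \<beta>)) + (2 * r - \<alpha>)\<^sup>2 * ((1 + \<beta>) * (2 - \<beta>) * (1 - \<beta>))"
    by (simp only: left_diff_distrib distrib_right)
  have id: "2 * D - 3 * (?T * D) - (6 * \<alpha> - r * (2 - \<beta>) * (1 - \<beta>))\<^sup>2 = (2 - r * r) * D"
    unfolding TD unfolding D_def by (simp add: power2_eq_square algebra_simps)
  have "x = y" if "x - y = z" "z = 0" for x y z :: real using that by simp
  from this[OF id] have "2 * D - 3 * (?T * D) = (6 * \<alpha> - r * (2 - \<beta>) * (1 - \<beta>))\<^sup>2" by (simp add: r)
  also have "\<dots> \<ge> 0" by simp
  finally have nonneg: "0 \<le> 2 * D - 3 * (?T * D)" .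
  have "y \<le> 2 / 3 * z" if "0 \<le> 2 * z - 3 * y" for y z :: real using that by simp
  from this[OF nonneg] have "?T * D \<le> 2 / 3 * D" .
  then have "?T \<le> 2 / 3" using D by simp
  then show ?thesis by simp
qed

text \<open>Four ramps reproduce the positive part of the minimum of an increasing \<open>u\<close>,
  a middle line \<open>m\<close> and a decreasing \<open>v\<close>: \<open>a1\<close> starts
  \<open>u\<close>, \<open>a2\<close> turns \<open>u\<close> into \<open>m\<close>,
  \<open>a3\<close> turns \<open>m\<close> into \<open>v\<close>, and \<open>a4\<close> ends
  \<open>v\<close>. The five sign patterns are the five pieces between the breakpoints.\<close>

lemma tent_sum_eq_min:
  fixes u m v :: real
  assumes "u = a1" "u - m = a2" "m - v = a3" "v = - a4"
    and "a1 \<le> 0 \<and> a2 \<le> 0 \<and> a3 \<le> 0 \<and> a4 \<le> 0 \<or> 0 \<le> a1 \<and> a2 \<le> 0 \<and> a3 \<le> 0 \<and> a4 \<le> 0 \<or>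
      0 \<le> m \<and> 0 \<le> a1 \<and> 0 \<le> a2 \<and> a3 \<le> 0 \<and> a4 \<le> 0 \<or> 0 \<le> a1 \<and> 0 \<le> a2 \<and> 0 \<le> a3 \<and> a4 \<le> 0 \<or>
      0 \<le> a1 \<and> 0 \<le> a2 \<and> 0 \<le> a3 \<and> 0 \<le> a4"
  shows "max 0 a1 - max 0 a2 - max 0 a3 + max 0 a4 = max 0 (min (min u m) v)"
proof -
  note d = assms(1-4)
  consider "a1 \<le> 0" "a2 \<le> 0" "a3 \<le> 0" "a4 \<le> 0" | "0 \<le> a1" "a2 \<le> 0" "a3 \<le> 0" "a4 \<le> 0"
    | "0 \<le> m" "0 \<le> a1" "0 \<le> a2" "a3 \<le> 0" "a4 \<le> 0" | "0 \<le> a1" "0 \<le> a2" "0 \<le> a3" "a4 \<le> 0"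
    | "0 \<le> a1" "0 \<le> a2" "0 \<le> a3" "0 \<le> a4" using assms(5) by blast
  then show ?thesis
  proof cases
    case 1
    then have "min (min u m) v \<le> 0" unfolding d(1) by (simp add: min_le_iff_disj)
    then show ?thesis using 1 by (simp add: max_absorb1)
  next
    case 2
    then have "u \<le> m" "u \<le> v" using d by linarith+
    then show ?thesis using 2 d(1) by (simp add: min_absorb1 max_absorb1 max_absorb2)
  next
    case 3
    then have "m \<le> u" "m \<le> v" using d by linarith+
    then show ?thesis using 3 d(1,2) by (simp add: min_absorb1 min_absorb2 max_absorb1 max_absorb2)
  next
    case 4
    then have "m \<le> u" "v \<le> m" "0 \<le> v" using d by linarith+
    then show ?thesis using 4 d by (simp add: min_absorb1 min_absorb2 max_absorb1 max_absorb2)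
  next
    case 5
    then have "min (min u m) v \<le> 0" using d(4) by (simp add: min_le_iff_disj)
    moreover have "a1 - a2 - a3 + a4 = 0" using d by linarith
    ultimately show ?thesis using 5 by (simp add: max_absorb1 max_absorb2)
  qed
qed

text \<open>\<open>X\<close> models the part of the triangle \<open>0 \<le> y\<close>,
  \<open>y \<le> x\<close>, \<open>y \<le> r - x\<close> that stays in it when every vertical is
  reversed by \<open>y \<mapsto> \<alpha> + \<beta> x - y\<close>. Two such points on one vertical
  satisfy the four bounds.\<close>

lemma planar_measure_le_tent:
  fixes X :: "(real^2) set"
  assumes X: "compact X" and r: "r * r = 2" "r > 0" and be: "0 \<le> \<beta>"
    and w: "\<And>x y. x \<in> X \<Longrightarrow> y \<in> X \<Longrightarrow> x $ 1 = y $ 1 \<Longrightarrow>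
      y $ 2 - x $ 2 \<le> \<alpha> + \<beta> * x $ 1 \<and> y $ 2 - x $ 2 \<le> 2 * x $ 1 - (\<alpha> + \<beta> * x $ 1) \<and>
      y $ 2 - x $ 2 \<le> 2 * (r - x $ 1) - (\<alpha> + \<beta> * x $ 1) \<and> y $ 2 - x $ 2 \<le> x $ 1"
  shows "measure lebesgue X \<le> 1 / 3"
proof -
  define p where "p = r / 2"
  have p: "r = 2 * p" "p > 0" "p\<^sup>2 = 1 / 2" using r by (auto simp: p_def power2_eq_square)
  have sq: "(max 0 z)\<^sup>2 \<le> c\<^sup>2" if "z \<le> c" "0 \<le> c" for z c :: real
    using that by (intro power_mono) auto
  have v_eq: "2 * (r - t) - (\<alpha> + \<beta> * t) = (2 + \<beta>) * ((2 * r - \<alpha>) / (2 + \<beta>) - t)" for t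
    using be by (simp add: field_simps)
  \<comment> \<open>The triangle under the line \<open>\<alpha> + \<beta> x\<close> and the third
    bound; \<open>r * \<beta> + \<alpha>\<close> is the value of that line at
    \<open>x = r\<close>.\<close>
  have below: "measure lebesgue X \<le> c\<^sup>2 / (\<beta> * (2 + \<beta>) * (1 + \<beta>))" if b: "\<beta> > 0" and c: "r * \<beta> + \<alpha> \<le> c" "0 \<le> c" for c
  proof -
    have "\<alpha> + \<beta> * t = \<beta> * (t - (- \<alpha> / \<beta>))" for t using b by (simp add: field_simps)
    then have "measure lebesgue X \<le> \<beta> * (2 + \<beta>) / (2 * (\<beta> + (2 + \<beta>))) * (max 0 ((2 * r - \<alpha>) / (2 + \<beta>) - (- \<alpha> / \<beta>)))\<^sup>2"
      using w b by (intro planar_measure_le_triangle[OF X]) (auto simp: v_eq[symmetric])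
    also have "(2 * r - \<alpha>) / (2 + \<beta>) - (- \<alpha> / \<beta>) = 2 * (r * \<beta> + \<alpha>) / (\<beta> * (2 + \<beta>))"
      using b by (simp add: field_simps)
    also have "\<beta> * (2 + \<beta>) / (2 * (\<beta> + (2 + \<beta>))) * (max 0 (2 * (r * \<beta> + \<alpha>) / (\<beta> * (2 + \<beta>))))\<^sup>2
        \<le> \<beta> * (2 + \<beta>) / (2 * (\<beta> + (2 + \<beta>))) * (2 * c / (\<beta> * (2 + \<beta>)))\<^sup>2"
      using b c by (intro mult_left_mono sq divide_right_mono) auto
    also have "2 * (\<beta> + (2 + \<beta>)) = 4 * (1 + \<beta>)" by simp
    also have "\<beta> * (2 + \<beta>) / (4 * (1 + \<beta>)) * (2 * c / (\<beta> * (2 + \<beta>)))\<^sup>2 = c\<^sup>2 / (\<beta> * (2 + \<beta>) * (1 + \<beta>))"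
    proof -
      have "k / (4 * m) * (2 * c / k)\<^sup>2 = c\<^sup>2 / (k * m)" for k m :: real
        by (simp add: power2_eq_square)
      then show ?thesis .
    qed
    finally show ?thesis .
  qed
  \<comment> \<open>\<open>p * (1 - \<beta>) \<le> \<alpha>\<close> says that the line passes
    through or above the apex \<open>(p, p)\<close> of the triangle. In the first four cases two of
    the bounds suffice and leave at most a triangle; in the last one the line truncates the tent and
    three are used.\<close>
  consider (a) "1 \<le> \<beta>" "p * (1 - \<beta>) \<le> \<alpha>" | (b) "1 \<le> \<beta>" "\<alpha> \<le> p * (1 - \<beta>)"
    | (c) "\<beta> < 1" "p * (1 - \<beta>) \<le> \<alpha>" | (d) "\<beta> < 1" "\<alpha> < 0" | (e) "\<beta> < 1" "0 \<le> \<alpha>" "\<alpha> \<le> p * (1 - \<beta>)"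
    by linarith
  then show ?thesis
  proof cases
    case a
    have "measure lebesgue X \<le> 1 * (2 + \<beta>) / (2 * (1 + (2 + \<beta>))) * (max 0 ((2 * r - \<alpha>) / (2 + \<beta>) - 0))\<^sup>2"
      using w be by (intro planar_measure_le_triangle[OF X]) (auto simp: v_eq[symmetric])
    also have "\<dots> \<le> 1 * (2 + \<beta>) / (2 * (1 + (2 + \<beta>))) * (p * (3 + \<beta>) / (2 + \<beta>))\<^sup>2"
    proof (intro mult_left_mono sq)
      have "2 * r - \<alpha> \<le> p * (3 + \<beta>)" using a p by (simp add: algebra_simps)
      then show "(2 * r - \<alpha>) / (2 + \<beta>) - 0 \<le> p * (3 + \<beta>) / (2 + \<beta>)" using be by (simp add: divide_right_mono)
    qed (use be p in auto)
    also have "\<dots> = p\<^sup>2 * ((3 + \<beta>) / (2 * (2 + \<beta>)))"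
      using be by (simp add: divide_simps power2_eq_square) (simp add: algebra_simps)
    also have "\<dots> \<le> 1 / 3" using a by (simp add: p divide_simps)
    finally show ?thesis .
  next
    case b
    have "r * \<beta> + \<alpha> \<le> p * (1 + \<beta>)" using b p by (simp add: algebra_simps)
    then have "measure lebesgue X \<le> (p * (1 + \<beta>))\<^sup>2 / (\<beta> * (2 + \<beta>) * (1 + \<beta>))"
      using b p by (intro below) auto
    also have "\<dots> = p\<^sup>2 * ((1 + \<beta>) / (\<beta> * (2 + \<beta>)))"
    proof -
      have "(p * m)\<^sup>2 / (k * m) = p\<^sup>2 * (m / k)" for k m :: real by (simp add: power2_eq_square)
      then show ?thesis .
    qed
    also have "\<dots> \<le> 1 / 3"
    proof -
      have "0 \<le> (\<beta> - 1) * (2 * \<beta> + 3)" using b by (intro mult_nonneg_nonneg) auto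
      then have "3 * (1 + \<beta>) \<le> 2 * (\<beta> * (2 + \<beta>))" by (simp add: algebra_simps)
      then show ?thesis using b by (simp add: p divide_simps)
    qed
    finally show ?thesis .
  next
    case c
    have u_eq: "2 * t - (\<alpha> + \<beta> * t) = (2 - \<beta>) * (t - \<alpha> / (2 - \<beta>))" for t
      using c be by (simp add: field_simps)
    have "measure lebesgue X \<le> (2 - \<beta>) * (2 + \<beta>) / (2 * ((2 - \<beta>) + (2 + \<beta>))) * (max 0 ((2 * r - \<alpha>) / (2 + \<beta>) - \<alpha> / (2 - \<beta>)))\<^sup>2"
      using w be c by (intro planar_measure_le_triangle[OF X]) (auto simp: v_eq[symmetric] u_eq[symmetric])
    also have "\<dots> \<le> (2 - \<beta>) * (2 + \<beta>) / (2 * ((2 - \<beta>) + (2 + \<beta>))) * (4 * p / ((2 + \<beta>) * (2 - \<beta>)))\<^sup>2"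
    proof (intro mult_left_mono sq)
      have "(2 * r - \<alpha>) / (2 + \<beta>) - \<alpha> / (2 - \<beta>) = (4 * r - 2 * r * \<beta> - 4 * \<alpha>) / ((2 + \<beta>) * (2 - \<beta>))"
        using be c by (simp add: field_simps)
      moreover have "4 * r - 2 * r * \<beta> - 4 * \<alpha> \<le> 4 * p" using c p by (simp add: algebra_simps)
      ultimately show "(2 * r - \<alpha>) / (2 + \<beta>) - \<alpha> / (2 - \<beta>) \<le> 4 * p / ((2 + \<beta>) * (2 - \<beta>))"
        using be c by (simp add: divide_right_mono)
    qed (use be p c in auto)
    also have "\<dots> = p\<^sup>2 * (2 / ((2 + \<beta>) * (2 - \<beta>)))"
      using be c by (simp add: divide_simps power2_eq_square)
    also have "\<dots> \<le> 1 / 3"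
    proof -
      have "\<beta> * \<beta> \<le> 1 * 1" using be c by (intro mult_mono) auto
      then have "3 \<le> (2 + \<beta>) * (2 - \<beta>)" by (simp add: algebra_simps)
      then show ?thesis by (simp add: p divide_simps)
    qed
    finally show ?thesis .
  next
    case d
    show ?thesis
    proof (cases "\<beta> = 0")
      case True
      have "X = {}" using w d True by force
      then show ?thesis by simp
    next
      case False
      then have b: "\<beta> > 0" using be by simp
      have "measure lebesgue X \<le> (r * \<beta>)\<^sup>2 / (\<beta> * (2 + \<beta>) * (1 + \<beta>))"
        using b d r by (intro below) auto
      also have "\<dots> = 2 * \<beta> / ((2 + \<beta>) * (1 + \<beta>))"
        using b r by (simp add: divide_simps power2_eq_square)
      also have "\<dots> \<le> 1 / 3"
      proof -
        have "0 \<le> (1 - \<beta>) * (2 - \<beta>)" using d by (intro mult_nonneg_nonneg) auto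
        then have "6 * \<beta> \<le> (2 + \<beta>) * (1 + \<beta>)" by (simp add: algebra_simps)
        then show ?thesis using b by (simp add: divide_simps)
      qed
      finally show ?thesis .
    qed
  next
    case e
    \<comment> \<open>With \<open>u\<close> and \<open>v\<close> the second and third bound and
      \<open>m\<close> the line, \<open>t1\<close>, \<open>t2\<close>, \<open>t3\<close>,
      \<open>t4\<close> are the zeros of \<open>u\<close>, \<open>u - m\<close>,
      \<open>m - v\<close> and \<open>v\<close>.\<close>
    define t1 where "t1 = \<alpha> / (2 - \<beta>)"
    define t2 where "t2 = \<alpha> / (1 - \<beta>)"
    define t3 where "t3 = (r - \<alpha>) / (1 + \<beta>)"
    define t4 where "t4 = (2 * r - \<alpha>) / (2 + \<beta>)"
    have t: "(2 - \<beta>) * t1 = \<alpha>" "(1 - \<beta>) * t2 = \<alpha>" "(1 + \<beta>) * t3 = r - \<alpha>" "(2 + \<beta>) * t4 = 2 * r - \<alpha>"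
      using e be by (auto simp: t1_def t2_def t3_def t4_def)
    have t1: "0 \<le> t1" using e be by (simp add: t1_def)
    have t12: "t1 \<le> t2" unfolding t1_def t2_def using e be by (intro divide_left_mono) auto
    have t2p: "t2 \<le> p"
      unfolding t2_def using e be by (simp add: divide_le_eq)
    have t3p: "p \<le> t3"
    proof -
      have "p * (1 + \<beta>) \<le> r - \<alpha>" using e p by (simp add: algebra_simps)
      then show ?thesis unfolding t3_def using be by (simp add: le_divide_eq)
    qed
    have t34: "t3 \<le> t4"
    proof -
      have "r * \<beta> + \<alpha> \<ge> 0" using r be e by simp
      then have "(r - \<alpha>) * (2 + \<beta>) \<le> (2 * r - \<alpha>) * (1 + \<beta>)" by (simp add: algebra_simps)
      then show ?thesis unfolding t3_def t4_def using be by (simp add: frac_le_eq divide_simps)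
    qed
    have t4r: "t4 \<le> r"
    proof -
      have "2 * r - \<alpha> \<le> r * (2 + \<beta>)" using r be e by (simp add: algebra_simps)
      then show ?thesis unfolding t4_def using be by (simp add: divide_le_eq)
    qed
    let ?g = "\<lambda>t. (2 - \<beta>) * max 0 (t - t1) - 2 * (1 - \<beta>) * max 0 (t - t2)
        - 2 * (1 + \<beta>) * max 0 (t - t3) + (2 + \<beta>) * max 0 (t - t4)"
    have g: "?g t = max 0 (min (min (2 * t - (\<alpha> + \<beta> * t)) (\<alpha> + \<beta> * t)) (2 * (r - t) - (\<alpha> + \<beta> * t)))" for t
    proof -
      have u: "2 * t - (\<alpha> + \<beta> * t) = (2 - \<beta>) * (t - t1)" using t by (simp add: algebra_simps)
      have um: "2 * t - (\<alpha> + \<beta> * t) - (\<alpha> + \<beta> * t) = 2 * (1 - \<beta>) * (t - t2)" using t by (simp add: algebra_simps)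
      have mv: "\<alpha> + \<beta> * t - (2 * (r - t) - (\<alpha> + \<beta> * t)) = 2 * (1 + \<beta>) * (t - t3)" using t by (simp add: algebra_simps)
      have v: "2 * (r - t) - (\<alpha> + \<beta> * t) = - ((2 + \<beta>) * (t - t4))" using t by (simp add: algebra_simps)
      have sg: "0 \<le> k * (t - s) \<longleftrightarrow> s \<le> t" "k * (t - s) \<le> 0 \<longleftrightarrow> t \<le> s" if "k > 0" for k s :: real
        using that by (auto simp: zero_le_mult_iff mult_le_0_iff)
      have pos: "2 - \<beta> > 0" "2 * (1 - \<beta>) > 0" "2 * (1 + \<beta>) > 0" "2 + \<beta> > 0" using be e by auto
      have mk: "k * max 0 (t - s) = max 0 (k * (t - s))" if "k > 0" for k s :: real
        using sg[OF that, of s] by (auto simp: max_def)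
      have m0: "t < t2 \<or> 0 \<le> \<alpha> + \<beta> * t"
      proof (cases "t < t2")
        case False
        then have "0 \<le> t" using t1 t12 by linarith
        then show ?thesis using be e by simp
      qed simp
      have ord: "t1 \<le> t2" "t2 \<le> t3" "t3 \<le> t4" using t12 t2p t3p t34 by auto
      show ?thesis
        unfolding mk[OF pos(1)] mk[OF pos(2)] mk[OF pos(3)] mk[OF pos(4)]
        by (rule tent_sum_eq_min[OF u um mv v],
            unfold sg[OF pos(1)] sg[OF pos(2)] sg[OF pos(3)] sg[OF pos(4)])
           (use ord m0 in argo)
    qed
    have "(?g has_integral (2 - \<beta>) * (r - t1)\<^sup>2 / 2 - 2 * (1 - \<beta>) * (r - t2)\<^sup>2 / 2
        - 2 * (1 + \<beta>) * (r - t3)\<^sup>2 / 2 + (2 + \<beta>) * (r - t4)\<^sup>2 / 2) {0..r}"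
      using t1 t12 t2p t3p t34 t4r by (intro has_integral_add has_integral_diff has_integral_ramp) auto
    then have I: "integral {0..r} ?g = (2 - \<beta>) * (r - t1)\<^sup>2 / 2 - 2 * (1 - \<beta>) * (r - t2)\<^sup>2 / 2
        - 2 * (1 + \<beta>) * (r - t3)\<^sup>2 / 2 + (2 + \<beta>) * (r - t4)\<^sup>2 / 2" by (rule integral_unique)
    have "measure lebesgue X \<le> integral {0..r} ?g"
    proof (rule planar_measure_le[OF X])
      show "continuous_on {0..r} ?g" by (intro continuous_intros)
      show "0 \<le> ?g t" for t unfolding g by simp
      show "y $ 2 - x $ 2 \<le> ?g (x $ 1)" if "x \<in> X" "y \<in> X" "x $ 1 = y $ 1" for x y
        unfolding g using w[OF that] by (simp add: le_max_iff_disj)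
      show "x $ 1 \<in> {0..r}" if "x \<in> X" for x
      proof -
        have "0 \<le> \<alpha> + \<beta> * x $ 1" "0 \<le> 2 * (r - x $ 1) - (\<alpha> + \<beta> * x $ 1)" "0 \<le> x $ 1"
          using w[OF that that] by auto
        then show ?thesis by simp
      qed
    qed
    also have "\<dots> = (\<alpha>\<^sup>2 / (2 - \<beta>) - 2 * \<alpha>\<^sup>2 / (1 - \<beta>) - 2 * (r - \<alpha>)\<^sup>2 / (1 + \<beta>) + (2 * r - \<alpha>)\<^sup>2 / (2 + \<beta>)) / 2"
    proof -
      \<comment> \<open>Expand each square about \<open>r\<close>. The signed slopes of the four
        ramps add up to 0, and so do the products of slope and breakpoint; in the sum only the terms
        \<open>(k * s)\<^sup>2 / k\<close> survive.\<close>
      have ex: "k * (r - s)\<^sup>2 = k * r\<^sup>2 - 2 * r * (k * s) + (k * s)\<^sup>2 / k" if "k > 0" for k s :: real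
        using that by (simp add: power2_eq_square algebra_simps)
      have 1: "(2 - \<beta>) * (r - t1)\<^sup>2 = (2 - \<beta>) * r\<^sup>2 - 2 * r * \<alpha> + \<alpha>\<^sup>2 / (2 - \<beta>)"
        using ex[of "2 - \<beta>" t1] be e by (simp add: t)
      have 2: "(1 - \<beta>) * (r - t2)\<^sup>2 = (1 - \<beta>) * r\<^sup>2 - 2 * r * \<alpha> + \<alpha>\<^sup>2 / (1 - \<beta>)"
        using ex[of "1 - \<beta>" t2] be e by (simp add: t)
      have 3: "(1 + \<beta>) * (r - t3)\<^sup>2 = (1 + \<beta>) * r\<^sup>2 - 2 * r * (r - \<alpha>) + (r - \<alpha>)\<^sup>2 / (1 + \<beta>)"
        using ex[of "1 + \<beta>" t3] be e by (simp add: t)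
      have 4: "(2 + \<beta>) * (r - t4)\<^sup>2 = (2 + \<beta>) * r\<^sup>2 - 2 * r * (2 * r - \<alpha>) + (2 * r - \<alpha>)\<^sup>2 / (2 + \<beta>)"
        using ex[of "2 + \<beta>" t4] be e by (simp add: t)
      have "2 * integral {0..r} ?g = (2 - \<beta>) * (r - t1)\<^sup>2 - 2 * ((1 - \<beta>) * (r - t2)\<^sup>2)
        - 2 * ((1 + \<beta>) * (r - t3)\<^sup>2) + (2 + \<beta>) * (r - t4)\<^sup>2" 
      proof -
        have "2 * (A / 2 - 2 * B / 2 - 2 * C / 2 + E / 2) = A - 2 * B - 2 * C + E" for A B C E :: real by simp
        then show ?thesis unfolding I unfolding mult.assoc .
      qed
      also have "\<dots> = \<alpha>\<^sup>2 / (2 - \<beta>) - 2 * (\<alpha>\<^sup>2 / (1 - \<beta>)) - 2 * ((r - \<alpha>)\<^sup>2 / (1 + \<beta>)) + (2 * r - \<alpha>)\<^sup>2 / (2 + \<beta>)"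
        unfolding 1 2 3 4 by (simp add: algebra_simps power2_eq_square)
      finally show ?thesis by simp
    qed
    also have "\<dots> \<le> 1 / 3" by (rule tent_quadrilateral_bound[OF r(1) be e(1)])
    finally show ?thesis .
  qed
qed

section \<open>The planar region behind the bound (sqrt 2 + 1)/3\<close>

text \<open>An isosceles right triangle on the hypotenuse from 0 to \<open>sqrt 2\<close>, cut off
  at \<open>x = 1\<close>. With a hypotenuse of length r, the height-preserving limit maps would
  overlap in at most r^2/6, and the reversing ones in at most 1/3; \<open>sqrt 2\<close> makes these
  bounds equal.\<close>

definition trapezoid :: "(real^2) set" where
  "trapezoid = {x. 0 \<le> x $ 1 \<and> x $ 1 \<le> 1 \<and> 0 \<le> x $ 2 \<and> x $ 2 \<le> x $ 1 \<and> x $ 2 \<le> sqrt 2 - x $ 1}"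

lemma compact_trapezoid: "compact trapezoid"
proof -
  have "closed {x::real^2. 0 \<le> x $ 1 \<and> x $ 1 \<le> 1 \<and> 0 \<le> x $ 2 \<and> x $ 2 \<le> x $ 1 \<and> x $ 2 \<le> sqrt 2 - x $ 1}"
    by (intro closed_Collect_conj closed_Collect_le continuous_intros)
  moreover have "trapezoid \<subseteq> cbox 0 1"
    by (auto simp: trapezoid_def mem_box_cart forall_2)
  then have "bounded trapezoid" using bounded_cbox bounded_subset by blast
  ultimately show ?thesis by (simp add: compact_eq_bounded_closed trapezoid_def)
qed

lemma convex_trapezoid: "convex trapezoid"
proof -
  have "linear (\<lambda>x::real^2. x $ i)" for i by (rule linearI) auto
  then have h: "convex {x::real^2. a * x $ 1 + c * x $ 2 \<le> d}" for a c d :: real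
    using convex_halfspace_le[of "vector [a, c] :: real^2" d] by (simp add: inner_vec_def sum_2)
  have "trapezoid = {x. (-1) * x $ 1 + 0 * x $ 2 \<le> 0} \<inter> {x. 1 * x $ 1 + 0 * x $ 2 \<le> 1} \<inter> {x. 0 * x $ 1 + (-1) * x $ 2 \<le> 0}
     \<inter> {x. (-1) * x $ 1 + 1 * x $ 2 \<le> 0} \<inter> {x. 1 * x $ 1 + 1 * x $ 2 \<le> sqrt 2}"
    by (auto simp: trapezoid_def)
  also have "convex \<dots>" by (intro convex_Int h)
  finally show ?thesis .
qed

lemma measure_trapezoid_ge: "sqrt 2 - 1 \<le> measure lebesgue trapezoid"
proof -
  let ?b = "axis 1 1 :: real^2" and ?r = "sqrt 2 :: real"
  let ?g = "\<lambda>t. min t (?r - t)"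
  have r: "1 \<le> ?r" "?r \<le> 2" "?r * ?r = 2" using real_le_lsqrt[of 2 2] by auto
  have cont: "continuous_on S ?g" for S by (intro continuous_intros)
  have "((\<lambda>t. t) has_integral ((?r / 2)\<^sup>2 - 0\<^sup>2) / 2) {0..?r / 2}"
    by (rule ident_has_integral) simp
  then have "((\<lambda>t. t) has_integral (?r / 2)\<^sup>2 / 2) {0..?r / 2}" by simp
  then have 1: "integral {0..?r / 2} ?g = (?r / 2)\<^sup>2 / 2"
    by (intro integral_unique) (auto intro: has_integral_eq[rotated])
  have "((\<lambda>t. ?r - t) has_integral (?r * 1 - 1\<^sup>2 / 2) - (?r * (?r / 2) - (?r / 2)\<^sup>2 / 2)) {?r / 2..1}"
  proof (rule fundamental_theorem_of_calculus)
    show "?r / 2 \<le> 1" using r(2) by linarith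
    show "((\<lambda>t. ?r * t - t\<^sup>2 / 2) has_vector_derivative ?r - t) (at t within {?r / 2..1})" for t
      unfolding has_real_derivative_iff_has_vector_derivative[symmetric]
      by (auto intro!: derivative_eq_intros)
  qed
  then have 2: "integral {?r / 2..1} ?g = (?r * 1 - 1\<^sup>2 / 2) - (?r * (?r / 2) - (?r / 2)\<^sup>2 / 2)"
    by (intro integral_unique) (auto intro: has_integral_eq[rotated])
  have "integral {0..1} ?g = integral {0..?r / 2} ?g + integral {?r / 2..1} ?g"
    using r by (intro Henstock_Kurzweil_Integration.integral_combine[symmetric] integrable_continuous_real cont) auto
  also have "\<dots> = ?r - 1" unfolding 1 2 using r by (simp add: power2_eq_square algebra_simps)
  finally have "?r - 1 = integral {0..1} ?g" by simp
  also have "\<dots> \<le> measure lebesgue trapezoid"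
  proof (rule measure_ge_integral_slices[OF _ compact_trapezoid cont])
    show "?b \<in> Basis" by simp
    show pos: "0 \<le> ?g t" if "t \<in> {0..1}" for t
    proof -
      have "0 \<le> t" "t \<le> 1" using that by auto
      then have "0 \<le> ?r - t" using r(1) by linarith
      then show ?thesis using \<open>0 \<le> t\<close> by simp
    qed
    fix t :: real assume t: "t \<in> {0<..<1}"
    have c: "(x + (t - x $ 1) *\<^sub>R ?b) $ 1 = t" "(x + (t - x $ 1) *\<^sub>R ?b) $ 2 = x $ 2" for x
      by (simp_all add: axis_def)
    have b: "x \<bullet> ?b = x $ 1" for x by (simp add: inner_axis)
    have "slice trapezoid ?b t = {x. 0 \<le> x $ 1 \<and> x $ 1 \<le> 1 \<and> 0 \<le> x $ 2 \<and> x $ 2 \<le> ?g t}"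
      unfolding slice_def trapezoid_def b mem_Collect_eq c using t by auto
    then show "?g t \<le> measure lebesgue (slice trapezoid ?b t)"
      using measure_strip[OF pos[of t]] t by simp
  qed
  finally show ?thesis .
qed

lemma convex_body_trapezoid: "convex_body trapezoid"
proof -
  have "1 < sqrt (2::real)" by simp
  then have "measure lebesgue trapezoid > 0" using measure_trapezoid_ge by linarith
  then show ?thesis by (rule convex_bodyI[OF compact_trapezoid convex_trapezoid])
qed

lemma overlap_trapezoid_reversing:
  assumes S: "flat_involution d S" and "S (axis 1 1) = - axis 1 1" "p \<bullet> axis 1 1 = 0" "S p = p"
  shows "overlap trapezoid (\<lambda>y. S y + (y \<bullet> axis 1 1) *\<^sub>R p + q) \<le> 1 / 3"
proof -
  define c where "c = q $ 1"
  define a where "a = max 0 (c - 1)"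
  let ?L = "{y \<in> trapezoid. a \<le> y $ 1 \<and> y $ 1 \<le> c / 2}"
  have e: "y \<bullet> axis 1 1 = y $ 1" for y :: "real^2" by (simp add: inner_axis)
  have nb: "norm (axis 1 1 :: real^2) = 1" by simp
  have T01: "0 \<le> y $ 1 \<and> y $ 1 \<le> 1" if "y \<in> trapezoid" for y using that by (simp add: trapezoid_def)
  have "overlap trapezoid (\<lambda>y. S y + (y \<bullet> axis 1 1) *\<^sub>R p + q) \<le> 2 * measure lebesgue ?L"
    using overlap_reversing_le[OF compact_trapezoid S assms(2) nb assms(3,4), of q] T01
    unfolding e c_def a_def by blast
  also have "\<dots> \<le> 1 / 3"
  proof (cases "a \<le> c / 2")
    case True
    have a0: "a \<ge> 0" by (simp add: a_def)
    have eq: "?L = trapezoid \<inter> ({y. a \<le> y $ 1} \<inter> {y. y $ 1 \<le> c / 2})" by auto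
    have L: "compact ?L" unfolding eq
      by (intro compact_Int_closed compact_trapezoid closed_Int closed_Collect_le continuous_intros)
    have "measure lebesgue ?L \<le> integral {a..c / 2} (\<lambda>t. t)"
      by (rule planar_measure_le[OF L]) (use a0 in \<open>auto simp: trapezoid_def\<close>)
    also have "\<dots> = ((c / 2)\<^sup>2 - a\<^sup>2) / 2"
      using ident_has_integral[OF True] by (rule integral_unique)
    finally have "2 * measure lebesgue ?L \<le> (c / 2)\<^sup>2 - a\<^sup>2" by simp
    also have "\<dots> \<le> 1 / 3"
    proof (cases "1 \<le> c")
      case True
      \<comment> \<open>\<open>(c / 2)\<^sup>2 - (c - 1)\<^sup>2\<close> is 1/3 minus this square,
        so the worst reversing map has \<open>c = 4 / 3\<close>.\<close>
      have "0 \<le> 3 / 4 * (c - 4 / 3)\<^sup>2" by simp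
      then show ?thesis using True by (simp add: a_def power2_eq_square algebra_simps)
    next
      case False
      then have "c \<ge> 0" using \<open>a \<le> c / 2\<close> a0 by linarith
      then have "(c / 2)\<^sup>2 \<le> (1 / 2)\<^sup>2" using False by (intro power_mono) auto
      moreover have "(1 / 2)\<^sup>2 = (1 / 4 :: real)" by (simp add: power2_eq_square)
      ultimately show ?thesis using zero_le_power2[of a] by linarith
    qed
    finally show ?thesis .
  next
    case False
    then have "?L = {}" by auto
    then have "measure lebesgue ?L = 0" by (metis measure_empty)
    then show ?thesis by simp
  qed
  finally show ?thesis .
qed

text \<open>\<open>S\<close> fixes the first axis and has trace 0, so it negates the second. The map
  therefore sends each vertical to itself by \<open>y \<mapsto> \<mu> x - y\<close> with an affine
  \<open>\<mu>\<close>, which is the situation of \<open>planar_measure_le_tent\<close>.\<close>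

lemma overlap_trapezoid_preserving:
  assumes S: "flat_involution 1 S" and Sb: "S (axis 1 1) = axis 1 1" and Sp: "S p = - p" and Sq: "S q = - q"
  shows "overlap trapezoid (\<lambda>y. S y + (y \<bullet> axis 1 1) *\<^sub>R p + q) \<le> 1 / 3"
proof -
  let ?r = "sqrt 2 :: real"
  have sa: "S x \<bullet> y = x \<bullet> S y" for x y using flat_involutionD(3)[OF S] .
  have S1: "S x $ 1 = x $ 1" for x using sa[of x "axis 1 1"] by (simp add: Sb inner_axis)
  have tr: "S (axis 1 1) $ 1 + S (axis 2 1) $ 2 = 0"
    using flat_involutionD(5)[OF S] by (simp add: sum_Basis_vec sum_2 inner_axis)
  have Sa: "S (axis 2 1) = - axis 2 1"
  proof -
    have "S (axis 2 1) $ 1 = 0" by (simp add: S1 axis_def)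
    moreover have "S (axis 2 1) $ 2 = - 1" using tr S1[of "axis 1 1"] by (simp add: axis_def)
    ultimately show ?thesis by (simp add: vec_eq_iff forall_2 axis_def)
  qed
  have S2: "S x $ 2 = - x $ 2" for x using sa[of x "axis 2 1"] by (simp add: Sa inner_axis)
  have p1: "p $ 1 = 0" "q $ 1 = 0" using S1[of p] S1[of q] Sp Sq by auto
  define T where "T y = S y + (y \<bullet> axis 1 1) *\<^sub>R p + q" for y
  let ?X = "{y \<in> trapezoid. T y \<in> trapezoid}"
  define \<mu> where "\<mu> t = q $ 2 + p $ 2 * t" for t
  have R: "T y $ 1 = y $ 1" "T y $ 2 = \<mu> (y $ 1) - y $ 2" for y
    by (simp_all add: T_def S1 S2 p1 \<mu>_def inner_axis)
  have "continuous_on UNIV T"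
    unfolding T_def using flat_involutionD(1)[OF S] by (intro continuous_intros linear_continuous_on) (simp add: linear_linear)
  then have X: "compact ?X" by (rule compact_overlap_set[OF compact_trapezoid])
  have w: "y $ 2 - x $ 2 \<le> \<mu> (x $ 1)" "y $ 2 - x $ 2 \<le> 2 * x $ 1 - \<mu> (x $ 1)"
    "y $ 2 - x $ 2 \<le> 2 * (?r - x $ 1) - \<mu> (x $ 1)" "y $ 2 - x $ 2 \<le> x $ 1" "y $ 2 - x $ 2 \<le> ?r - x $ 1"
    if xy: "x \<in> ?X" "y \<in> ?X" "x $ 1 = y $ 1" for x y
  proof -
    have "0 \<le> x $ 2" "x $ 2 \<le> ?r - x $ 1" "0 \<le> \<mu> (x $ 1) - x $ 2" "\<mu> (x $ 1) - x $ 2 \<le> x $ 1" "\<mu> (x $ 1) - x $ 2 \<le> ?r - x $ 1"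
      "0 \<le> y $ 2" "y $ 2 \<le> x $ 1" "y $ 2 \<le> ?r - x $ 1" "0 \<le> \<mu> (x $ 1) - y $ 2"
      using xy by (simp_all add: trapezoid_def R)
    note b = this
    show "y $ 2 - x $ 2 \<le> \<mu> (x $ 1)" using b by linarith
    show "y $ 2 - x $ 2 \<le> 2 * x $ 1 - \<mu> (x $ 1)" using b by linarith
    show "y $ 2 - x $ 2 \<le> 2 * (?r - x $ 1) - \<mu> (x $ 1)" using b(5,8) by argo
    show "y $ 2 - x $ 2 \<le> x $ 1" using b by linarith
    show "y $ 2 - x $ 2 \<le> ?r - x $ 1" using b by linarith
  qed
  have r: "?r * ?r = 2" "?r > 0" by auto
  have "measure lebesgue ?X \<le> 1 / 3"
  proof (cases "0 \<le> p $ 2")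
    case True
    show ?thesis
      by (rule planar_measure_le_tent[OF X r True, of "q $ 2"]) (use w in \<open>auto simp: \<mu>_def\<close>)
  next
    case False
    \<comment> \<open>The mirror image in the axis of the uncut triangle,
      \<open>x \<mapsto> sqrt 2 - x\<close>, exchanges its two legs and changes the sign of the
      slope of \<open>\<mu>\<close>.\<close>
    let ?f = "\<lambda>x::real^2. \<chi> i. if i = 1 then - x $ 1 else x $ 2" and ?a = "?r *\<^sub>R axis 1 1 :: real^2"
    have lf: "linear ?f" by (rule linearI) (simp_all add: vec_eq_iff)
    have ff: "?f (?f x) = x" for x by (simp add: vec_eq_iff forall_2)
    let ?Y = "(\<lambda>x. ?f x + ?a) ` ?X"
    have Y: "compact ?Y"
      using lf X by (intro compact_continuous_image continuous_intros linear_continuous_on) (auto simp: linear_linear)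
    have co: "(?f x + ?a) $ 1 = ?r - x $ 1" "(?f x + ?a) $ 2 = x $ 2" for x by (simp_all add: axis_def)
    have "measure lebesgue ?X \<le> measure lebesgue ?Y"
      by (rule measure_vimage_involution[OF lf ff Y X]) blast
    also have "\<dots> \<le> 1 / 3"
    proof (rule planar_measure_le_tent[OF Y r, of "- p $ 2" "q $ 2 + p $ 2 * ?r"])
      show "0 \<le> - p $ 2" using False by simp
      fix x y assume "x \<in> ?Y" "y \<in> ?Y" "x $ 1 = y $ 1"
      then obtain x' y' where x': "x' \<in> ?X" "x = ?f x' + ?a" and y': "y' \<in> ?X" "y = ?f y' + ?a" by blast
      have eq: "x' $ 1 = y' $ 1" using \<open>x $ 1 = y $ 1\<close> unfolding x'(2) y'(2) co by simp
      show "y $ 2 - x $ 2 \<le> (q $ 2 + p $ 2 * ?r) + - p $ 2 * x $ 1 \<and>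
        y $ 2 - x $ 2 \<le> 2 * x $ 1 - (q $ 2 + p $ 2 * ?r + - p $ 2 * x $ 1) \<and>
        y $ 2 - x $ 2 \<le> 2 * (?r - x $ 1) - (q $ 2 + p $ 2 * ?r + - p $ 2 * x $ 1) \<and> y $ 2 - x $ 2 \<le> x $ 1"
        using w[OF x'(1) y'(1) eq] unfolding x'(2) y'(2) co \<mu>_def by (simp add: algebra_simps)
    qed
    finally show ?thesis .
  qed
  then show ?thesis by (simp add: overlap_def T_def)
qed

lemma sigma_plane_le: "sigma TYPE(real^2) 1 \<le> (sqrt 2 + 1) / 3"
proof (rule field_le_epsilon)
  fix \<epsilon> :: real assume eps: "\<epsilon> > 0"
  let ?s = "(sqrt 2 + 1) / 3 :: real"
  have "1 / 3 = ?s * (sqrt 2 - 1)" by (simp add: field_simps)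
  also have "\<dots> \<le> ?s * measure lebesgue trapezoid" by (intro mult_left_mono measure_trapezoid_ge) auto
  finally have le: "1 / 3 \<le> ?s * measure lebesgue trapezoid" .
  have "\<exists>h>0. convex_body (stretch h (axis 1 1) ` trapezoid) \<and> sym_le 1 {} (stretch h (axis 1 1) ` trapezoid) (?s + \<epsilon>)"
  proof (rule exists_flat_body[OF convex_body_trapezoid refl eps])
    show "0 \<le> ?s" by simp
    fix S :: "real^2 \<Rightarrow> real^2" and p q :: "real^2"
    assume S: "flat_involution 1 S" and
      "S (axis 1 1) = axis 1 1 \<and> S p = - p \<and> S q = - q \<or>
       S (axis 1 1) = - axis 1 1 \<and> p \<bullet> axis 1 1 = 0 \<and> S p = p \<and> S q + q + (q \<bullet> axis 1 1) *\<^sub>R p = 0"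
    then have "overlap trapezoid (\<lambda>y. S y + (y \<bullet> axis 1 1) *\<^sub>R p + q) \<le> 1 / 3"
      using overlap_trapezoid_preserving[OF S] overlap_trapezoid_reversing[OF S] by blast
    then show "overlap trapezoid (\<lambda>y. S y + (y \<bullet> axis 1 1) *\<^sub>R p + q) \<le> ?s * measure lebesgue trapezoid"
      using le by linarith
  qed
  then obtain C where C: "convex_body (C :: (real^2) set)" "sym_le 1 {} C (?s + \<epsilon>)" by blast
  have "sigma TYPE(real^2) 1 \<le> Sym 1 C" by (rule sigma_le_Sym[OF C(1)]) simp
  also have "\<dots> \<le> ?s + \<epsilon>" by (rule Sym_le[OF C]) simp
  finally show "sigma TYPE(real^2) 1 \<le> ?s + \<epsilon>" .
qed

subsection \<open>Planar bodies containing a rectangle\<close>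

lemma vector_2_eta: "vector [w $ 1, w $ 2] = (w :: real^2)"
  by (simp add: vec_eq_iff forall_2)

lemma convex_vector_2:
  fixes K :: "(real^2) set"
  assumes "convex K" "vector [x, y] \<in> K" "vector [x', y'] \<in> K" "0 \<le> s" "s \<le> 1"
  shows "vector [(1 - s) * x + s * x', (1 - s) * y + s * y'] \<in> K"
proof -
  have "(1 - s) *\<^sub>R vector [x, y] + s *\<^sub>R vector [x', y'] \<in> K"
    using assms by (intro convexD) auto
  moreover have "(1 - s) *\<^sub>R vector [x, y] + s *\<^sub>R vector [x', y'] = (vector [(1 - s) * x + s * x', (1 - s) * y + s * y'] :: real^2)"
    by (simp add: vec_eq_iff forall_2)
  ultimately show ?thesis by simp
qed

lemma convex_vertical:
  fixes K :: "(real^2) set"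
  assumes K: "convex K" and "vector [x, y1] \<in> K" "vector [x, y2] \<in> K" and y: "y1 \<le> y" "y \<le> y2"
  shows "vector [x, y] \<in> K"
proof (cases "y1 = y2")
  case True
  then show ?thesis using assms by simp
next
  case False
  then have lt: "y1 < y2" using y by simp
  define s where "s = (y - y1) / (y2 - y1)"
  have s: "0 \<le> s" "s \<le> 1" "s * (y2 - y1) = y - y1" using lt y by (auto simp: s_def)
  have "vector [(1 - s) * x + s * x, (1 - s) * y1 + s * y2] \<in> K"
    by (rule convex_vector_2[OF K assms(2,3) s(1,2)])
  moreover have "(1 - s) * x + s * x = x" "(1 - s) * y1 + s * y2 = y" using s(3) by (simp_all add: algebra_simps)
  ultimately show ?thesis by simp
qed

lemma chord_through_axis:
  fixes K :: "(real^2) set"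
  assumes K: "compact K" "convex K" and 0: "vector [0, y0] \<in> K"
  obtains Y where "vector [0, Y] \<in> K" "\<And>y. vector [0, y] \<in> K \<Longrightarrow> y \<le> Y"
proof -
  have eq: "{w \<in> K. w $ 1 = 0} = K \<inter> {w. w $ 1 = 0}" by auto
  have "compact {w \<in> K. w $ 1 = 0}" unfolding eq
    by (intro compact_Int_closed K closed_Collect_eq continuous_intros)
  moreover have "{w \<in> K. w $ 1 = 0} \<noteq> {}" using 0 by force
  moreover have "continuous_on {w \<in> K. w $ 1 = 0} (\<lambda>w. w $ 2)" by (intro continuous_intros)
  ultimately obtain w where w: "w \<in> {w \<in> K. w $ 1 = 0}" "\<forall>v\<in>{w \<in> K. w $ 1 = 0}. v $ 2 \<le> w $ 2"
    using continuous_attains_sup by blast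
  show ?thesis
  proof (rule that)
    show "vector [0, w $ 2] \<in> K" using w(1) vector_2_eta[of w] by simp
    show "y \<le> w $ 2" if "vector [0, y] \<in> K" for y using w(2) that by force
  qed
qed

text \<open>A supporting line at the point \<open>(0, Y)\<close>. By convexity, the difference
  quotients to its right are at most those to its left; the supremum of the former is a slope. The
  points at \<open>a\<close> and \<open>- a\<close> make it finite.\<close>

lemma support_slope:
  fixes K :: "(real^2) set"
  assumes K: "convex K" and a: "a > 0" and ab: "vector [a, c] \<in> K" "vector [- a, c'] \<in> K"
    and Y: "\<And>y. vector [0, y] \<in> K \<Longrightarrow> y \<le> Y"
  obtains m where "\<And>x y. vector [x, y] \<in> K \<Longrightarrow> y \<le> Y + m * x"
proof -
  let ?A = "{(y - Y) / x | x y. vector [x, y] \<in> K \<and> x > 0}"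
  have cross: "(y - Y) / x \<le> (y' - Y) / x'" if "vector [x, y] \<in> K" "x > 0" "vector [x', y'] \<in> K" "x' < 0" for x y x' y'
  proof -
    define s where "s = x / (x - x')"
    have d: "x - x' > 0" using that by simp
    have s: "0 \<le> s" "s \<le> 1" using that by (auto simp: s_def)
    have "vector [(1 - s) * x + s * x', (1 - s) * y + s * y'] \<in> K"
      by (rule convex_vector_2[OF K that(1,3) s])
    moreover have "(1 - s) * x + s * x' = 0" using d by (simp add: s_def field_simps)
    ultimately have "(1 - s) * y + s * y' \<le> Y" using Y by simp
    then have "((1 - s) * y + s * y') * (x - x') \<le> Y * (x - x')" using d by (simp add: mult_right_mono)
    moreover have "s * (x - x') = x" using d by (simp add: s_def)
    then have "((1 - s) * y + s * y') * (x - x') = y * (x - x') + (y' - y) * x" by (simp add: algebra_simps) algebra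
    ultimately have "(y' - Y) * x \<le> (y - Y) * x'" by (simp add: algebra_simps)
    then show ?thesis using that by (simp add: divide_simps mult.commute)
  qed
  have ne: "?A \<noteq> {}" using ab(1) a by blast
  have bdd: "bdd_above ?A"
    by (rule bdd_aboveI[where M = "(c' - Y) / (- a)"]) (use cross[OF _ _ ab(2)] a in auto)
  show ?thesis
  proof (rule that[of "Sup ?A"])
    fix x y assume xy: "vector [x, y] \<in> K"
    consider "x > 0" | "x = 0" | "x < 0" by linarith
    then show "y \<le> Y + Sup ?A * x"
    proof cases
      case 1
      then have "(y - Y) / x \<le> Sup ?A" using xy by (intro cSup_upper bdd) blast
      then show ?thesis using 1 by (simp add: field_simps)
    next
      case 2
      then show ?thesis using Y xy by simp
    next
      case 3
      have "Sup ?A \<le> (y - Y) / x"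
        by (rule cSup_least[OF ne]) (use cross[OF _ _ xy 3] in auto)
      then show ?thesis using 3 by (simp add: field_simps)
    qed
  qed
qed

abbreviation flip1 :: "real^2 \<Rightarrow> real^2" where "flip1 w \<equiv> vector [- w $ 1, w $ 2]"
abbreviation flip2 :: "real^2 \<Rightarrow> real^2" where "flip2 w \<equiv> vector [w $ 1, - w $ 2]"
abbreviation swap2 :: "real^2 \<Rightarrow> real^2" where "swap2 w \<equiv> vector [w $ 2, w $ 1]"

lemma linear_flips: "linear flip1" "linear flip2" "linear swap2"
  by (auto intro!: linearI simp: vec_eq_iff forall_2)

lemma continuous_flips: "continuous_on S flip1" "continuous_on S flip2" "continuous_on S swap2"
  using linear_flips by (auto intro!: linear_continuous_on simp: linear_linear)

text \<open>Let the vertical axis meet \<open>K\<close> from \<open>- Z\<close> to \<open>Y\<close>.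
  Supporting lines at these two points bound the strip by \<open>2 * a * (Y + Z)\<close>. The
  hexagon spanned by them and the four corners is symmetric and lies in \<open>K\<close>, so the
  overlap is at least its area \<open>a * (Y + Z) + 2 * a * b\<close>.\<close>

lemma overlap_flip1_ge:
  fixes K :: "(real^2) set"
  assumes K: "compact K" "convex K" and ab: "a > 0" "b > 0"
    and corners: "vector [a, b] \<in> K" "vector [- a, b] \<in> K" "vector [a, - b] \<in> K" "vector [- a, - b] \<in> K"
  shows "measure lebesgue {w \<in> K. - a \<le> w $ 1 \<and> w $ 1 \<le> a} / 2 + 2 * a * b \<le> overlap K flip1"
proof -
  have m: "vector [0, c] \<in> K" if "vector [a, c] \<in> K" "vector [- a, c] \<in> K" for c
    using convex_vector_2[OF K(2) that, of "1 / 2"] by simp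
  have 0: "vector [0, b] \<in> K" "vector [0, - b] \<in> K" using m corners by auto
  obtain Y where Y: "vector [0, Y] \<in> K" "\<And>y. vector [0, y] \<in> K \<Longrightarrow> y \<le> Y"
    using chord_through_axis[OF K 0(1)] by blast
  \<comment> \<open>Turned upside down, so that the lower boundary of \<open>K\<close> is treated as
    an upper one.\<close>
  let ?K' = "flip2 ` K"
  have K': "compact ?K'" "convex ?K'"
    using K linear_flips(2) by (auto intro!: compact_continuous_image continuous_flips convex_linear_image)
  have memK': "vector [x, y] \<in> ?K' \<longleftrightarrow> vector [x, - y] \<in> K" for x y :: real
  proof
    assume "vector [x, y] \<in> ?K'"
    then obtain w where w: "w \<in> K" "vector [x, y] = flip2 w" by blast
    then have "x = w $ 1" "y = - w $ 2" by (auto simp: vec_eq_iff forall_2)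
    then show "vector [x, - y] \<in> K" using w vector_2_eta[of w] by simp
  next
    assume a: "vector [x, - y] \<in> K"
    have "vector [x, y] = flip2 (vector [x, - y])" by simp
    then show "vector [x, y] \<in> ?K'" using a by blast
  qed
  obtain Z where Z: "vector [0, Z] \<in> ?K'" "\<And>y. vector [0, y] \<in> ?K' \<Longrightarrow> y \<le> Z"
    using chord_through_axis[OF K', of b] 0 by (auto simp: memK')
  obtain m where m: "\<And>x y. vector [x, y] \<in> K \<Longrightarrow> y \<le> Y + m * x"
    using support_slope[OF K(2) ab(1) corners(1,2) Y(2)] by blast
  obtain n where n: "\<And>x y. vector [x, y] \<in> ?K' \<Longrightarrow> y \<le> Z + n * x"
    using support_slope[OF K'(2) ab(1), of b b, OF _ _ Z(2)] corners by (auto simp: memK')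
  have Yb: "b \<le> Y" "b \<le> Z" using Y(2)[OF 0(1)] Z(2)[of b] 0(2) by (auto simp: memK')
  have upper: "measure lebesgue {w \<in> K. - a \<le> w $ 1 \<and> w $ 1 \<le> a} \<le> 2 * a * (Y + Z)"
  proof -
    let ?X = "{w \<in> K. - a \<le> w $ 1 \<and> w $ 1 \<le> a}"
    have eq: "?X = K \<inter> ({w. - a \<le> w $ 1} \<inter> {w. w $ 1 \<le> a})" by auto
    have X: "compact ?X" unfolding eq
      by (intro compact_Int_closed K closed_Int closed_Collect_le continuous_intros)
    let ?g = "\<lambda>x. (Y + Z) + (m + n) * x"
    have "?g (- a) \<ge> 0" "?g a \<ge> 0"
      using m[OF corners(1)] m[OF corners(2)] n[of a b] n[of "- a" b] corners ab by (auto simp: memK' algebra_simps)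
    then have g0: "0 \<le> ?g x" if "x \<in> {- a..a}" for x
    proof (cases "m + n \<ge> 0")
      case True
      then have "(m + n) * (- a) \<le> (m + n) * x" using that by (intro mult_left_mono) auto
      then show ?thesis using \<open>?g (- a) \<ge> 0\<close> by linarith
    next
      case False
      then have "(m + n) * a \<le> (m + n) * x" using that by (intro mult_left_mono_neg) auto
      then show ?thesis using \<open>?g a \<ge> 0\<close> by linarith
    qed
    have "measure lebesgue ?X \<le> integral {- a..a} ?g"
    proof (rule planar_measure_le[OF X _ g0])
      show "continuous_on {- a..a} ?g" by (intro continuous_intros)
      fix w v assume wv: "w \<in> ?X" "v \<in> ?X" "w $ 1 = v $ 1"
      have "v $ 2 \<le> Y + m * v $ 1" using m[of "v $ 1" "v $ 2"] wv(2) by (simp add: vector_2_eta)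
      moreover have "- w $ 2 \<le> Z + n * w $ 1"
        by (rule n) (use wv(1) in \<open>simp add: memK' vector_2_eta\<close>)
      ultimately show "v $ 2 - w $ 2 \<le> ?g (w $ 1)" using wv(3) by (simp add: algebra_simps)
    qed auto
    also have "integral {- a..a} ?g = ((Y + Z) * a + (m + n) * (a\<^sup>2 / 2)) - ((Y + Z) * (- a) + (m + n) * ((- a)\<^sup>2 / 2))"
    proof (rule integral_unique, rule fundamental_theorem_of_calculus)
      show "- a \<le> a" using ab by simp
      show "((\<lambda>x. (Y + Z) * x + (m + n) * (x\<^sup>2 / 2)) has_vector_derivative ?g x) (at x within {- a..a})" for x
        unfolding has_real_derivative_iff_has_vector_derivative[symmetric]
        by (auto intro!: derivative_eq_intros)
    qed
    finally show ?thesis by (simp add: algebra_simps)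
  qed
  have lower: "a * (Y + Z) + 2 * a * b \<le> overlap K flip1"
  proof -
    let ?O = "{w \<in> K. flip1 w \<in> K}" and ?b = "axis 1 1 :: real^2"
    have O: "compact ?O" by (rule compact_overlap_set[OF K(1) continuous_flips(1)])
    \<comment> \<open>The absolute value written with a ramp, so that
      \<open>has_integral_ramp\<close> integrates it.\<close>
    let ?abs = "\<lambda>x::real. 2 * max 0 (x - 0) - x"
    let ?g = "\<lambda>x. (Y + Z) - (Y + Z - 2 * b) / a * ?abs x"
    have abs: "?abs x = \<bar>x\<bar>" for x by (simp add: max_def abs_if)
    have pts: "vector [x, Y - (Y - b) * (\<bar>x\<bar> / a)] \<in> K" "vector [x, - (Z - (Z - b) * (\<bar>x\<bar> / a))] \<in> K"
      if x: "- a \<le> x" "x \<le> a" for x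
    proof -
      define s where "s = \<bar>x\<bar> / a"
      have s: "0 \<le> s" "s \<le> 1" using x ab by (auto simp: s_def)
      have sx: "s * (if x \<ge> 0 then a else - a) = x" using ab by (auto simp: s_def)
      have "vector [if x \<ge> 0 then a else - a, b] \<in> K" "vector [if x \<ge> 0 then a else - a, - b] \<in> K"
        using corners by auto
      from convex_vector_2[OF K(2) Y(1) this(1) s] convex_vector_2[OF K(2) _ this(2) s, of 0 "- Z"] Z(1)
      have "vector [x, (1 - s) * Y + s * b] \<in> K" "vector [x, (1 - s) * (- Z) + s * (- b)] \<in> K"
        by (simp_all add: memK' sx)
      moreover have "(1 - s) * Y + s * b = Y - (Y - b) * s" "(1 - s) * (- Z) + s * (- b) = - (Z - (Z - b) * s)"
        by (simp_all add: algebra_simps)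
      ultimately show "vector [x, Y - (Y - b) * (\<bar>x\<bar> / a)] \<in> K" "vector [x, - (Z - (Z - b) * (\<bar>x\<bar> / a))] \<in> K"
        by (simp_all add: s_def)
    qed
    have hb: "b \<le> c - (c - b) * (\<bar>x\<bar> / a)" if "- a \<le> x" "x \<le> a" "b \<le> c" for x c
    proof -
      have "(c - b) * (\<bar>x\<bar> / a) \<le> (c - b) * 1" using that ab by (intro mult_left_mono) auto
      then show ?thesis by simp
    qed
    have geq: "?g x = (Y - (Y - b) * (\<bar>x\<bar> / a)) - (- (Z - (Z - b) * (\<bar>x\<bar> / a)))" for x
      unfolding abs using ab by (simp add: field_simps)
    have "integral {- a..a} ?g \<le> measure lebesgue ?O"
    proof (rule measure_ge_integral_slices[OF _ O])
      show "?b \<in> Basis" by simp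
      show "continuous_on {- a..a} ?g" using ab by (intro continuous_intros) auto
      show g0: "0 \<le> ?g x" if "x \<in> {- a..a}" for x
        unfolding geq using hb[of x Y] hb[of x Z] that Yb ab by auto
      fix t assume t: "t \<in> {- a<..<a}"
      let ?hi = "Y - (Y - b) * (\<bar>t\<bar> / a)" and ?lo = "- (Z - (Z - b) * (\<bar>t\<bar> / a))"
      have t': "- a \<le> t" "t \<le> a" "- a \<le> - t" "- t \<le> a" using t by auto
      have "{x. 0 \<le> x $ 1 \<and> x $ 1 \<le> 1 \<and> ?lo \<le> x $ 2 \<and> x $ 2 \<le> ?hi} \<subseteq> slice ?O ?b t"
      proof
        fix x :: "real^2" assume x: "x \<in> {x. 0 \<le> x $ 1 \<and> x $ 1 \<le> 1 \<and> ?lo \<le> x $ 2 \<and> x $ 2 \<le> ?hi}"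
        have "vector [t, x $ 2] \<in> K"
          by (rule convex_vertical[OF K(2) pts(2)[OF t'(1,2)] pts(1)[OF t'(1,2)]]) (use x in auto)
        moreover have "vector [- t, x $ 2] \<in> K"
          by (rule convex_vertical[OF K(2) pts(2)[OF t'(3,4)] pts(1)[OF t'(3,4)]]) (use x in auto)
        moreover have eq: "x + (t - x $ 1) *\<^sub>R ?b = vector [t, x $ 2]" by (simp add: vec_eq_iff forall_2 axis_def)
        moreover have e: "x \<bullet> ?b = x $ 1" by (simp add: inner_axis)
        ultimately show "x \<in> slice ?O ?b t" unfolding slice_def mem_Collect_eq e eq using x by simp
      qed
      then have "measure lebesgue {x :: real^2. 0 \<le> x $ 1 \<and> x $ 1 \<le> 1 \<and> ?lo \<le> x $ 2 \<and> x $ 2 \<le> ?hi} \<le> measure lebesgue (slice ?O ?b t)"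
        using compact_strip[of ?lo ?hi] compact_slice[OF _ O, of ?b t]
        by (intro measure_mono_fmeasurable) (auto simp: lmeasurable_compact fmeasurableD)
      moreover have "measure lebesgue {x :: real^2. 0 \<le> x $ 1 \<and> x $ 1 \<le> 1 \<and> ?lo \<le> x $ 2 \<and> x $ 2 \<le> ?hi} = ?g t"
        unfolding geq using g0[of t] t geq[of t] by (intro measure_strip) auto
      ultimately show "?g t \<le> measure lebesgue (slice ?O ?b t)" by simp
    qed
    moreover have "integral {- a..a} ?g = 2 * a * (Y + Z) - (Y + Z - 2 * b) / a * a\<^sup>2"
    proof (rule integral_unique)
      have 1: "((\<lambda>x::real. x) has_integral (a\<^sup>2 - (- a)\<^sup>2) / 2) {- a..a}"
        using ab by (intro ident_has_integral) auto
      have 2: "((\<lambda>x. 2 * max 0 (x - 0)) has_integral 2 * (a - 0)\<^sup>2 / 2) {- a..a}"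
        using ab by (intro has_integral_ramp) auto
      have 3: "((\<lambda>x::real. Y + Z) has_integral (Y + Z) * (a - (- a))) {- a..a}"
        using has_integral_const_real[of "Y + Z" "- a" a] ab by (simp add: mult.commute)
      have "(?g has_integral (Y + Z) * (a - (- a)) - (Y + Z - 2 * b) / a * (2 * (a - 0)\<^sup>2 / 2 - (a\<^sup>2 - (- a)\<^sup>2) / 2)) {- a..a}"
        by (intro has_integral_diff has_integral_mult_right 1 2 3)
      then show "(?g has_integral 2 * a * (Y + Z) - (Y + Z - 2 * b) / a * a\<^sup>2) {- a..a}"
        by (simp add: algebra_simps)
    qed
    moreover have "2 * a * (Y + Z) - (Y + Z - 2 * b) / a * a\<^sup>2 = a * (Y + Z) + 2 * a * b"
    proof -
      have "(Y + Z - 2 * b) / a * a\<^sup>2 = (Y + Z - 2 * b) * a" using ab by (simp add: power2_eq_square)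
      then show ?thesis by (simp add: algebra_simps)
    qed
    ultimately show ?thesis by (simp add: overlap_def)
  qed
  show ?thesis using upper lower by (simp add: algebra_simps)
qed

locale maximal_rectangle =
  fixes K :: "(real^2) set" and a b :: real
  assumes convex: "convex K" and a: "a > 0" and b: "b > 0"
    and corners: "vector [a, b] \<in> K" "vector [- a, b] \<in> K" "vector [a, - b] \<in> K" "vector [- a, - b] \<in> K"
    and maximal: "\<And>x1 y1 x2 y2 l. vector [x1, y1] \<in> K \<Longrightarrow> vector [x1 + l, y1] \<in> K \<Longrightarrow>
      vector [x2, y2] \<in> K \<Longrightarrow> vector [x2 + l, y2] \<in> K \<Longrightarrow> 0 \<le> l \<Longrightarrow> l * (y2 - y1) \<le> 4 * a * b"
begin

text \<open>Together with \<open>(a, - b)\<close>, such a point would force a chord at height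
  \<open>b\<close> that is longer than \<open>2 * a\<close>. Towards the point the chords shrink,
  and one of length exactly \<open>2 * a\<close> remains strictly above height \<open>b\<close>;
  with the lower side of the rectangle it spans too large a parallelogram.\<close>

lemma no_point_beyond_corner:
  assumes xy: "vector [x, y] \<in> K" and x: "a < x"
  shows "y \<le> b"
proof (rule ccontr)
  assume "\<not> y \<le> b"
  then have y: "b < y" by simp
  define s where "s = 2 * b / (y + b)"
  have s: "0 < s" "s < 1" using b y by (auto simp: s_def)
  have "s * (y + b) = 2 * b" using b y by (simp add: s_def)
  then have sb: "(1 - s) * (- b) + s * y = b" by (simp add: algebra_simps)
  define x' where "x' = (1 - s) * a + s * x"
  have x'K: "vector [x', b] \<in> K"
    using convex_vector_2[OF convex corners(3) xy, of s] s unfolding x'_def sb by simp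
  have "s * (x - a) > 0" using s x by simp
  then have x': "a < x'" unfolding x'_def by (simp add: algebra_simps)
  \<comment> \<open>The fraction of the way to the apex \<open>(x, y)\<close> at which the chord
    from \<open>- a\<close> to \<open>x'\<close> has shrunk to length \<open>2 * a\<close>.\<close>
  define \<tau> where "\<tau> = 1 - 2 * a / (x' + a)"
  have \<tau>: "0 < \<tau>" "\<tau> \<le> 1" using a x' by (auto simp: \<tau>_def)
  have len: "(1 - \<tau>) * (x' + a) = 2 * a" using a x' by (simp add: \<tau>_def)
  have 1: "vector [(1 - \<tau>) * (- a) + \<tau> * x, (1 - \<tau>) * b + \<tau> * y] \<in> K"
    using \<tau> by (intro convex_vector_2[OF convex corners(2) xy]) auto
  have 2: "vector [(1 - \<tau>) * x' + \<tau> * x, (1 - \<tau>) * b + \<tau> * y] \<in> K"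
    using \<tau> by (intro convex_vector_2[OF convex x'K xy]) auto
  have eq: "(1 - \<tau>) * x' + \<tau> * x = ((1 - \<tau>) * (- a) + \<tau> * x) + 2 * a" using len by (simp add: algebra_simps)
  have right: "vector [((1 - \<tau>) * (- a) + \<tau> * x) + 2 * a, (1 - \<tau>) * b + \<tau> * y] \<in> K" using 2 unfolding eq .
  have "2 * a * (((1 - \<tau>) * b + \<tau> * y) - (- b)) \<le> 4 * a * b"
    by (rule maximal[OF corners(4) _ 1 right]) (use corners(3) a in auto)
  then have "a * (\<tau> * (y - b)) \<le> 0" by (simp add: algebra_simps)
  moreover have "a * (\<tau> * (y - b)) > 0" using a \<tau> y by simp
  ultimately show False by simp
qed

text \<open>First variation: mixing the rectangle with the parallelogram in the ratio
  \<open>1 - s\<close> to \<open>s\<close> gives inscribed parallelograms, so the area cannot grow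
  to first order at \<open>s = 0\<close>. Geometrically, the pair of length and height lies below
  the tangent at \<open>(2 * a, 2 * b)\<close> to the hyperbola of constant area.\<close>

lemma parallelogram_tangent:
  assumes P: "vector [x1, y1] \<in> K" "vector [x1 + l, y1] \<in> K" "vector [x2, y2] \<in> K" "vector [x2 + l, y2] \<in> K" and l: "0 \<le> l"
  shows "a * (y2 - y1) + b * l \<le> 4 * a * b"
proof -
  let ?h = "y2 - y1"
  have mix: "((1 - s) * (2 * a) + s * l) * ((1 - s) * (2 * b) + s * ?h) \<le> 4 * a * b" if s: "0 \<le> s" "s \<le> 1" for s
  proof -
    have e: "(1 - s) * a + s * (x + l) = ((1 - s) * (- a) + s * x) + ((1 - s) * (2 * a) + s * l)" for x
      by (simp add: algebra_simps)
    have 1: "vector [(1 - s) * (- a) + s * x1, (1 - s) * (- b) + s * y1] \<in> K"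
      by (rule convex_vector_2[OF convex corners(4) P(1) s])
    have 2: "vector [((1 - s) * (- a) + s * x1) + ((1 - s) * (2 * a) + s * l), (1 - s) * (- b) + s * y1] \<in> K"
      using convex_vector_2[OF convex corners(3) P(2) s] unfolding e .
    have 3: "vector [(1 - s) * (- a) + s * x2, (1 - s) * b + s * y2] \<in> K"
      by (rule convex_vector_2[OF convex corners(2) P(3) s])
    have 4: "vector [((1 - s) * (- a) + s * x2) + ((1 - s) * (2 * a) + s * l), (1 - s) * b + s * y2] \<in> K"
      using convex_vector_2[OF convex corners(1) P(4) s] unfolding e .
    have "((1 - s) * (2 * a) + s * l) * (((1 - s) * b + s * y2) - ((1 - s) * (- b) + s * y1)) \<le> 4 * a * b"
      by (rule maximal[OF 1 2 3 4]) (use a l s in auto)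
    then show ?thesis by (simp add: algebra_simps)
  qed
  define X where "X = 2 * a * (?h - 2 * b) + 2 * b * (l - 2 * a)"
  define Z where "Z = (l - 2 * a) * (?h - 2 * b)"
  have lin: "X + s * Z \<le> 0" if s: "0 < s" "s \<le> 1" for s
  proof -
    have "((1 - s) * (2 * a) + s * l) * ((1 - s) * (2 * b) + s * ?h) = 4 * a * b + s * (X + s * Z)"
      by (simp add: X_def Z_def algebra_simps)
    then have "s * (X + s * Z) \<le> 0" using mix[of s] s by simp
    then show ?thesis using s by (simp add: mult_le_0_iff)
  qed
  have "X \<le> 0"
  proof (rule ccontr)
    assume "\<not> X \<le> 0"
    then have X: "X > 0" by simp
    \<comment> \<open>Small enough that the quadratic term is at most half of the linear
      one.\<close>
    define s where "s = min 1 (X / (2 * (\<bar>Z\<bar> + 1)))"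
    have s: "0 < s" "s \<le> 1" using X by (auto simp: s_def)
    have "s * \<bar>Z\<bar> \<le> X / (2 * (\<bar>Z\<bar> + 1)) * (\<bar>Z\<bar> + 1)"
      using X by (intro mult_mono) (auto simp: s_def)
    also have "\<dots> = X / 2" using abs_ge_zero[of Z] by (simp add: field_simps)
    finally have "s * \<bar>Z\<bar> \<le> X / 2" .
    moreover have "- (s * \<bar>Z\<bar>) \<le> s * Z"
      using s abs_ge_minus_self[of Z] mult_left_mono[of "- Z" "\<bar>Z\<bar>" s] by simp
    ultimately show False using lin[OF s] X by linarith
  qed
  then show ?thesis by (simp add: X_def algebra_simps)
qed

text \<open>\<open>N\<close> is \<open>K\<close> with every horizontal section pushed to the left
  until it starts at 0; its points are pairs of a chord length and a height at which
  \<open>K\<close> has a chord of that length. Its verticals thus measure parallelograms with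
  horizontal sides.\<close>

lemma measure_le_twice_rectangle:
  assumes K: "compact K"
  shows "measure lebesgue K \<le> 8 * a * b"
proof -
  let ?b = "axis 2 1 :: real^2"
  define N where "N = {w :: real^2. 0 \<le> w $ 1 \<and> (\<exists>x. vector [x, w $ 2] \<in> K \<and> vector [x + w $ 1, w $ 2] \<in> K)}"
  have N: "compact N"
  proof -
    let ?D = "{p. fst p $ 2 = snd p $ 2} \<inter> {p. fst p $ 1 \<le> snd p $ 1} :: ((real^2) \<times> (real^2)) set"
    let ?f = "\<lambda>p :: (real^2) \<times> (real^2). (\<chi> i. if i = 1 then snd p $ 1 - fst p $ 1 else fst p $ 2) :: real^2"
    have comp: "compact ((K \<times> K) \<inter> ?D)"
      by (intro compact_Int_closed compact_Times K closed_Int closed_Collect_le closed_Collect_eq continuous_intros)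
    have cont: "continuous_on ((K \<times> K) \<inter> ?D) ?f"
    proof (intro continuous_on_vec_lambda)
      fix i :: 2 show "continuous_on ((K \<times> K) \<inter> ?D) (\<lambda>p. if i = 1 then snd p $ 1 - fst p $ 1 else fst p $ 2)"
        by (cases "i = 1") (auto intro!: continuous_intros)
    qed
    have eq: "N = ?f ` ((K \<times> K) \<inter> ?D)"
    proof (intro equalityI subsetI)
      fix w assume "w \<in> N"
      then obtain x where x: "0 \<le> w $ 1" "vector [x, w $ 2] \<in> K" "vector [x + w $ 1, w $ 2] \<in> K" by (auto simp: N_def)
      have "w = ?f (vector [x, w $ 2], vector [x + w $ 1, w $ 2])" by (simp add: vec_eq_iff forall_2)
      moreover have "(vector [x, w $ 2], vector [x + w $ 1, w $ 2]) \<in> (K \<times> K) \<inter> ?D" using x by simp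
      ultimately show "w \<in> ?f ` ((K \<times> K) \<inter> ?D)" by blast
    next
      fix w assume "w \<in> ?f ` ((K \<times> K) \<inter> ?D)"
      then obtain p q where pq: "p \<in> K" "q \<in> K" "p $ 2 = q $ 2" "p $ 1 \<le> q $ 1" "w = ?f (p, q)" by auto
      then have "w $ 1 = q $ 1 - p $ 1" "w $ 2 = p $ 2" by auto
      then show "w \<in> N" unfolding N_def using pq vector_2_eta[of p] vector_2_eta[of q] by (auto intro!: exI[of _ "p $ 1"])
    qed
    show ?thesis unfolding eq by (rule compact_continuous_image[OF cont comp])
  qed
  have B: "?b \<in> Basis" by simp
  have strip: "compact {x :: real^2. 0 \<le> x $ 2 \<and> x $ 2 \<le> 1 \<and> l \<le> x $ 1 \<and> x $ 1 \<le> u}" (is "compact ?S")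
    "l \<le> u \<Longrightarrow> measure lebesgue {x :: real^2. 0 \<le> x $ 2 \<and> x $ 2 \<le> 1 \<and> l \<le> x $ 1 \<and> x $ 1 \<le> u} = u - l" for l u
  proof -
    have eq: "?S = cbox (vector [l, 0]) (vector [u, 1])" by (auto simp: mem_box_cart forall_2)
    show "compact ?S" unfolding eq by simp
    assume le: "l \<le> u"
    then have "vector [l, 0] \<in> cbox (vector [l, 0]) (vector [u, 1] :: real^2)"
      by (simp add: mem_box_cart forall_2)
    then have "cbox (vector [l, 0]) (vector [u, 1] :: real^2) \<noteq> {}" by blast
    then have "measure lborel (cbox (vector [l, 0]) (vector [u, 1] :: real^2)) = u - l"
      by (simp add: content_cbox_cart UNIV_2)
    then show "measure lebesgue ?S = u - l" unfolding eq by simp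
  qed
  have co: "x + (t - x $ 2) *\<^sub>R ?b = vector [x $ 1, t]" for x t
    by (simp add: vec_eq_iff forall_2 axis_def)
  have mem: "x \<in> slice X ?b t \<longleftrightarrow> 0 \<le> x $ 2 \<and> x $ 2 \<le> 1 \<and> vector [x $ 1, t] \<in> X" for x X t
    using co[of x t] by (simp add: slice_def inner_axis)
  have sl: "measure lebesgue (slice K ?b t) \<le> measure lebesgue (slice N ?b t)" for t
  proof (cases "slice K ?b t = {}")
    case False
    have S: "compact (slice K ?b t)" by (rule compact_slice[OF B K])
    have c: "continuous_on (slice K ?b t) (\<lambda>x. x $ 1)" by (intro continuous_intros)
    obtain p where p: "p \<in> slice K ?b t" "\<forall>x\<in>slice K ?b t. p $ 1 \<le> x $ 1"
      using continuous_attains_inf[OF S False c] by blast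
    obtain q where q: "q \<in> slice K ?b t" "\<forall>x\<in>slice K ?b t. x $ 1 \<le> q $ 1"
      using continuous_attains_sup[OF S False c] by blast
    have pq: "p $ 1 \<le> q $ 1" using p(2) q(1) by blast
    have "slice K ?b t \<subseteq> {x. 0 \<le> x $ 2 \<and> x $ 2 \<le> 1 \<and> p $ 1 \<le> x $ 1 \<and> x $ 1 \<le> q $ 1}"
      using p(2) q(2) by (auto simp: mem)
    then have "measure lebesgue (slice K ?b t) \<le> measure lebesgue {x :: real^2. 0 \<le> x $ 2 \<and> x $ 2 \<le> 1 \<and> p $ 1 \<le> x $ 1 \<and> x $ 1 \<le> q $ 1}"
      using S strip(1)[of "p $ 1" "q $ 1"] by (intro measure_mono_fmeasurable) (auto simp: lmeasurable_compact fmeasurableD)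
    also have "\<dots> = measure lebesgue {x :: real^2. 0 \<le> x $ 2 \<and> x $ 2 \<le> 1 \<and> 0 \<le> x $ 1 \<and> x $ 1 \<le> q $ 1 - p $ 1}"
      using strip(2)[OF pq] strip(2)[of 0 "q $ 1 - p $ 1"] pq by simp
    also have "\<dots> \<le> measure lebesgue (slice N ?b t)"
    proof (rule measure_mono_fmeasurable)
      show "{x. 0 \<le> x $ 2 \<and> x $ 2 \<le> 1 \<and> 0 \<le> x $ 1 \<and> x $ 1 \<le> q $ 1 - p $ 1} \<subseteq> slice N ?b t"
      proof
        fix x :: "real^2" assume x: "x \<in> {x. 0 \<le> x $ 2 \<and> x $ 2 \<le> 1 \<and> 0 \<le> x $ 1 \<and> x $ 1 \<le> q $ 1 - p $ 1}"
        have pK: "vector [p $ 1, t] \<in> K" "vector [q $ 1, t] \<in> K" using p(1) q(1) by (auto simp: mem)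
        have "vector [p $ 1 + x $ 1, t] \<in> K"
        proof (cases "p $ 1 = q $ 1")
          case True
          then have "x $ 1 = 0" using x by simp
          then show ?thesis using pK by simp
        next
          case False
          then have lt: "p $ 1 < q $ 1" using pq by simp
          define s where "s = x $ 1 / (q $ 1 - p $ 1)"
          have s: "0 \<le> s" "s \<le> 1" "s * (q $ 1 - p $ 1) = x $ 1" using lt x by (auto simp: s_def)
          have "vector [(1 - s) * p $ 1 + s * q $ 1, (1 - s) * t + s * t] \<in> K"
            by (rule convex_vector_2[OF convex pK s(1,2)])
          moreover have "(1 - s) * p $ 1 + s * q $ 1 = p $ 1 + x $ 1" "(1 - s) * t + s * t = t"
            using s(3) by (simp_all add: algebra_simps)
          ultimately show ?thesis by simp
        qed
        then show "x \<in> slice N ?b t" using x pK(1) by (auto simp: mem N_def)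
      qed
    qed (use strip(1)[of 0 "q $ 1 - p $ 1"] compact_slice[OF B N] in \<open>auto simp: lmeasurable_compact fmeasurableD\<close>)
    finally show ?thesis .
  qed simp
  have "emeasure lborel K \<le> emeasure lborel N"
    unfolding emeasure_slices[OF B borel_compact[OF K]] emeasure_slices[OF B borel_compact[OF N]]
    by (intro nn_integral_mono) (simp add: emeasure_compact_eq_measure compact_slice[OF B] K N sl ennreal_leI)
  then have "measure lebesgue K \<le> measure lebesgue N"
    by (simp add: emeasure_compact_eq_measure K N)
  \<comment> \<open>By \<open>parallelogram_tangent\<close> the verticals of \<open>N\<close> are no
    longer than those of a right triangle with legs \<open>4 * a\<close> and \<open>4 * b\<close>,
    whose area is twice that of the rectangle.\<close>
  also have "\<dots> \<le> integral {0..4 * a} (\<lambda>t. 4 * b - b / a * t)"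
  proof (rule planar_measure_le[OF N])
    show "continuous_on {0..4 * a} (\<lambda>t. 4 * b - b / a * t)" using a by (intro continuous_intros) auto
    show "0 \<le> 4 * b - b / a * t" if "t \<in> {0..4 * a}" for t
    proof -
      have "b / a * t \<le> b / a * (4 * a)" using that a b by (intro mult_left_mono) auto
      then show ?thesis using a by simp
    qed
    have key: "a * (v $ 2 - w $ 2) + b * w $ 1 \<le> 4 * a * b" if wv: "w \<in> N" "v \<in> N" "w $ 1 = v $ 1" for v w
    proof -
      obtain x where x: "0 \<le> w $ 1" "vector [x, w $ 2] \<in> K" "vector [x + w $ 1, w $ 2] \<in> K" using wv by (auto simp: N_def)
      obtain y where y: "vector [y, v $ 2] \<in> K" "vector [y + w $ 1, v $ 2] \<in> K" using wv by (auto simp: N_def)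
      show ?thesis by (rule parallelogram_tangent[OF x(2,3) y x(1)])
    qed
    show "v $ 2 - w $ 2 \<le> 4 * b - b / a * w $ 1" if wv: "w \<in> N" "v \<in> N" "w $ 1 = v $ 1" for v w
      using key[OF wv] a by (simp add: field_simps)
    show "w $ 1 \<in> {0..4 * a}" if "w \<in> N" for w
      using key[OF that that refl] that b by (simp add: N_def)
  qed
  also have "\<dots> = (4 * b * (4 * a) - b / a * ((4 * a)\<^sup>2 / 2)) - (4 * b * 0 - b / a * (0\<^sup>2 / 2))"
  proof (rule integral_unique, rule fundamental_theorem_of_calculus)
    show "0 \<le> 4 * a" using a by simp
    show "((\<lambda>t. 4 * b * t - b / a * (t\<^sup>2 / 2)) has_vector_derivative 4 * b - b / a * t) (at t within {0..4 * a})" for t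
      unfolding has_real_derivative_iff_has_vector_derivative[symmetric]
      by (rule derivative_eq_intros refl | simp)+
  qed
  also have "\<dots> = 8 * a * b" using a by (simp add: power2_eq_square field_simps)
  finally show ?thesis .
qed

end

text \<open>Reduces all four corners to the one treated in
  \<open>no_point_beyond_corner\<close>.\<close>

lemma maximal_rectangle_flip:
  assumes "maximal_rectangle K a b"
  shows "maximal_rectangle (flip1 ` K) a b" "maximal_rectangle (flip2 ` K) a b"
proof -
  interpret maximal_rectangle K a b by fact
  have m1: "vector [x, y] \<in> flip1 ` K \<longleftrightarrow> vector [- x, y] \<in> K" for x y :: real
  proof
    assume "vector [x, y] \<in> flip1 ` K"
    then obtain w where w: "w \<in> K" "vector [x, y] = flip1 w" by blast
    then have "x = - w $ 1" "y = w $ 2" by (auto simp: vec_eq_iff forall_2)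
    then show "vector [- x, y] \<in> K" using w vector_2_eta[of w] by simp
  next
    assume a: "vector [- x, y] \<in> K"
    have "vector [x, y] = flip1 (vector [- x, y])" by simp
    then show "vector [x, y] \<in> flip1 ` K" using a by blast
  qed
  have m2: "vector [x, y] \<in> flip2 ` K \<longleftrightarrow> vector [x, - y] \<in> K" for x y :: real
  proof
    assume "vector [x, y] \<in> flip2 ` K"
    then obtain w where w: "w \<in> K" "vector [x, y] = flip2 w" by blast
    then have "x = w $ 1" "y = - w $ 2" by (auto simp: vec_eq_iff forall_2)
    then show "vector [x, - y] \<in> K" using w vector_2_eta[of w] by simp
  next
    assume a: "vector [x, - y] \<in> K"
    have "vector [x, y] = flip2 (vector [x, - y])" by simp
    then show "vector [x, y] \<in> flip2 ` K" using a by blast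
  qed
  show "maximal_rectangle (flip1 ` K) a b"
  proof (unfold_locales, unfold m1)
    show "convex (flip1 ` K)" by (rule convex_linear_image[OF linear_flips(1) convex])
    fix x1 y1 x2 y2 l :: real
    assume P: "vector [- x1, y1] \<in> K" "vector [- (x1 + l), y1] \<in> K" "vector [- x2, y2] \<in> K" "vector [- (x2 + l), y2] \<in> K" and l: "0 \<le> l"
    show "l * (y2 - y1) \<le> 4 * a * b"
      using maximal[OF P(2) _ P(4) _ l] P(1,3) by simp
  qed (use a b corners in auto)
  show "maximal_rectangle (flip2 ` K) a b"
  proof (unfold_locales, unfold m2)
    show "convex (flip2 ` K)" by (rule convex_linear_image[OF linear_flips(2) convex])
    fix x1 y1 x2 y2 l :: real
    assume P: "vector [x1, - y1] \<in> K" "vector [x1 + l, - y1] \<in> K" "vector [x2, - y2] \<in> K" "vector [x2 + l, - y2] \<in> K" and l: "0 \<le> l"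
    show "l * (y2 - y1) \<le> 4 * a * b"
      using maximal[OF P(3,4,1,2) l] by (simp add: algebra_simps)
  qed (use a b corners in auto)
qed

context maximal_rectangle
begin

lemma cross_shape:
  assumes "w \<in> K"
  shows "\<bar>w $ 1\<bar> \<le> a \<or> \<bar>w $ 2\<bar> \<le> b"
proof (rule ccontr)
  assume "\<not> ?thesis"
  then have w: "\<bar>w $ 1\<bar> > a" "\<bar>w $ 2\<bar> > b" by auto
  note mr = maximal_rectangle_axioms
  note no = maximal_rectangle.no_point_beyond_corner
  consider "a < w $ 1" "b < w $ 2" | "a < - w $ 1" "b < w $ 2" | "a < w $ 1" "b < - w $ 2" | "a < - w $ 1" "b < - w $ 2"
    using w by linarith
  then show False
  proof cases
    case 1
    then show False using no[OF mr, of "w $ 1" "w $ 2"] assms by (simp add: vector_2_eta)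
  next
    case 2
    then show False using no[OF maximal_rectangle_flip(1)[OF mr], of "- w $ 1" "w $ 2"] assms by auto
  next
    case 3
    then show False using no[OF maximal_rectangle_flip(2)[OF mr], of "w $ 1" "- w $ 2"] assms by auto
  next
    case 4
    have "vector [- w $ 1, - w $ 2] \<in> flip2 ` (flip1 ` K)"
    proof -
      have "vector [- w $ 1, - w $ 2] = flip2 (flip1 w)" by simp
      then show ?thesis using assms by blast
    qed
    then show False
      using 4 no[OF maximal_rectangle_flip(2)[OF maximal_rectangle_flip(1)[OF mr]], of "- w $ 1" "- w $ 2"] by simp
  qed
qed

text \<open>\<open>K\<close> is the union of its parts in the vertical and the horizontal strip,
  which meet in the rectangle; so these parts have total area
  \<open>measure lebesgue K + 4 * a * b\<close>. Half of this plus \<open>4 * a * b\<close> bounds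
  the two overlaps from below, and \<open>8 * a * b\<close> is at least the area of
  \<open>K\<close>: 1/2 + 6/8 = 5/4.\<close>

lemma overlaps_ge:
  assumes K: "compact K"
  shows "5 / 4 * measure lebesgue K \<le> overlap K flip1 + overlap K flip2"
proof -
  let ?A = "{w \<in> K. - a \<le> w $ 1 \<and> w $ 1 \<le> a}" and ?B = "{w \<in> K. - b \<le> w $ 2 \<and> w $ 2 \<le> b}"
  let ?R = "cbox (vector [- a, - b]) (vector [a, b]) :: (real^2) set"
  have eqA: "?A = K \<inter> ({w. - a \<le> w $ 1} \<inter> {w. w $ 1 \<le> a})" by auto
  have eqB: "?B = K \<inter> ({w. - b \<le> w $ 2} \<inter> {w. w $ 2 \<le> b})" by auto
  have A: "compact ?A" unfolding eqA
    by (intro compact_Int_closed K closed_Int closed_Collect_le continuous_intros)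
  have B: "compact ?B" unfolding eqB
    by (intro compact_Int_closed K closed_Int closed_Collect_le continuous_intros)
  have 1: "measure lebesgue ?A / 2 + 2 * a * b \<le> overlap K flip1"
    by (rule overlap_flip1_ge[OF K convex a b corners])
  have 2: "measure lebesgue ?B / 2 + 2 * a * b \<le> overlap K flip2"
  \<comment> \<open>The second axis becomes the first one after exchanging the coordinates.\<close>
  proof -
    let ?K' = "swap2 ` K"
    have ss: "swap2 (swap2 w) = w" for w by (simp add: vector_2_eta)
    have mem: "swap2 w \<in> ?K' \<longleftrightarrow> w \<in> K" for w by (auto simp: image_iff) (metis ss)+
    have mem': "w \<in> ?K' \<longleftrightarrow> swap2 w \<in> K" for w using mem[of "swap2 w"] by (simp add: vector_2_eta)
    have K': "compact ?K'" "convex ?K'"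
      using K convex by (auto intro!: compact_continuous_image continuous_flips convex_linear_image linear_flips)
    have "measure lebesgue {w \<in> ?K'. - b \<le> w $ 1 \<and> w $ 1 \<le> b} / 2 + 2 * b * a \<le> overlap ?K' flip1"
      by (rule overlap_flip1_ge[OF K' b a]) (use corners in \<open>simp_all add: mem'\<close>)
    moreover have "measure lebesgue ?B \<le> measure lebesgue {w \<in> ?K'. - b \<le> w $ 1 \<and> w $ 1 \<le> b}"
    proof (rule measure_vimage_involution[OF linear_flips(3) ss _ B, where a = 0])
      have eq: "{w \<in> ?K'. - b \<le> w $ 1 \<and> w $ 1 \<le> b} = ?K' \<inter> ({w. - b \<le> w $ 1} \<inter> {w. w $ 1 \<le> b})" by auto
      show "compact {w \<in> ?K'. - b \<le> w $ 1 \<and> w $ 1 \<le> b}" unfolding eq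
        by (intro compact_Int_closed K' closed_Int closed_Collect_le continuous_intros)
    qed (simp add: mem)
    moreover have "overlap ?K' flip1 \<le> overlap K flip2"
      unfolding overlap_def
    proof (rule measure_vimage_involution[OF linear_flips(3) ss _ _, where a = 0])
      show "compact {x \<in> K. flip2 x \<in> K}" by (rule compact_overlap_set[OF K continuous_flips(2)])
      show "compact {x \<in> ?K'. flip1 x \<in> ?K'}" by (rule compact_overlap_set[OF K'(1) continuous_flips(1)])
      show "swap2 y + 0 \<in> {x \<in> K. flip2 x \<in> K}" if "y \<in> {x \<in> ?K'. flip1 x \<in> ?K'}" for y
        using that by (simp add: mem')
    qed
    moreover have "2 * b * a = 2 * a * b" by simp
    ultimately show ?thesis by linarith
  qed
  have R: "?R = ?A \<inter> ?B"
  proof (intro equalityI subsetI)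
    fix w assume "w \<in> ?R"
    then have w: "- a \<le> w $ 1" "w $ 1 \<le> a" "- b \<le> w $ 2" "w $ 2 \<le> b" by (auto simp: mem_box_cart forall_2)
    have side: "vector [w $ 1, c] \<in> K" if "vector [a, c] \<in> K" "vector [- a, c] \<in> K" for c
    proof -
      define s where "s = (w $ 1 + a) / (2 * a)"
      have s: "0 \<le> s" "s \<le> 1" "s * (2 * a) = w $ 1 + a" using a w by (auto simp: s_def)
      have "vector [(1 - s) * (- a) + s * a, (1 - s) * c + s * c] \<in> K"
        by (rule convex_vector_2[OF convex that(2,1) s(1,2)])
      moreover have "(1 - s) * (- a) + s * a = w $ 1" "(1 - s) * c + s * c = c" using s(3) by (simp_all add: algebra_simps)
      ultimately show ?thesis by simp
    qed
    have "vector [w $ 1, w $ 2] \<in> K"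
      by (rule convex_vertical[OF convex side side w(3,4)]) (use corners in auto)
    then show "w \<in> ?A \<inter> ?B" using w by (simp add: vector_2_eta)
  next
    fix w assume "w \<in> ?A \<inter> ?B"
    then show "w \<in> ?R" by (auto simp: mem_box_cart forall_2)
  qed
  have "vector [- a, - b] \<in> ?R" using a b by (simp add: mem_box_cart forall_2)
  then have "?R \<noteq> {}" by blast
  then have mR: "measure lebesgue ?R = 4 * a * b" by (simp add: content_cbox_cart UNIV_2)
  have "K = ?A \<union> ?B" using cross_shape by (force simp: abs_le_iff)
  then have "measure lebesgue K = measure lebesgue ?A + measure lebesgue ?B - measure lebesgue (?A \<inter> ?B)"
    using measure_Un3[OF lmeasurable_compact[OF A] lmeasurable_compact[OF B]] by simp
  then have "measure lebesgue ?A + measure lebesgue ?B = measure lebesgue K + 4 * a * b"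
    unfolding R[symmetric] mR by simp
  then show ?thesis using 1 2 measure_le_twice_rectangle[OF K] by simp
qed

end

subsection \<open>Inscribed rectangles\<close>

definition perp :: "real^2 \<Rightarrow> real^2" where "perp u = vector [- u $ 2, u $ 1]"

lemma perp_nth [simp]: "perp u $ 1 = - u $ 2" "perp u $ 2 = u $ 1"
  by (simp_all add: perp_def)

lemma inner_2: "u \<bullet> v = u $ 1 * v $ 1 + u $ 2 * v $ 2" for u v :: "real^2"
  by (simp add: inner_vec_def sum_2)

lemma perp_props:
  "perp u \<bullet> u = 0" "u \<bullet> perp u = 0" "perp u \<bullet> perp u = u \<bullet> u" "perp u \<bullet> v = - (perp v \<bullet> u)" "perp (perp u) = - u"
  by (simp_all add: inner_2 vec_eq_iff forall_2)

lemma linear_perp: "linear perp"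
  by (rule linearI) (simp_all add: vec_eq_iff forall_2)

lemma continuous_on_perp [continuous_intros]:
  assumes "continuous_on S f"
  shows "continuous_on S (\<lambda>x. perp (f x))"
proof -
  have "continuous_on UNIV perp"
    using linear_perp by (intro linear_continuous_on) (simp add: linear_linear)
  then show ?thesis using assms by (rule continuous_on_compose2) simp
qed

lemma perp_decomposition:
  assumes "norm u = 1"
  shows "w = (w \<bullet> u) *\<^sub>R u + (w \<bullet> perp u) *\<^sub>R perp u"
proof -
  have "u $ 1 * u $ 1 + u $ 2 * u $ 2 = 1" using assms by (simp add: norm_eq_1 inner_2)
  then have "w $ 1 = (w $ 1 * u $ 1 + w $ 2 * u $ 2) * u $ 1 + (w $ 2 * u $ 1 - w $ 1 * u $ 2) * (- u $ 2)"
    "w $ 2 = (w $ 1 * u $ 1 + w $ 2 * u $ 2) * u $ 2 + (w $ 2 * u $ 1 - w $ 1 * u $ 2) * u $ 1"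
    by algebra+
  then show ?thesis by (simp add: vec_eq_iff forall_2 inner_2)
qed

type_synonym parallelogram = "(real^2) \<times> (real^2) \<times> real \<times> (real^2)"

definition parallelograms :: "(real^2) set \<Rightarrow> parallelogram set" where
  "parallelograms K = {(u, p, l, v). norm u = 1 \<and> 0 \<le> l \<and> 0 \<le> perp u \<bullet> v \<and>
     p \<in> K \<and> p + l *\<^sub>R u \<in> K \<and> p + v \<in> K \<and> p + v + l *\<^sub>R u \<in> K}"

definition area :: "parallelogram \<Rightarrow> real" where
  "area = (\<lambda>(u, p, l, v). l * (perp u \<bullet> v))"

definition area_maximal :: "(real^2) set \<Rightarrow> parallelogram \<Rightarrow> bool" where
  "area_maximal K x \<longleftrightarrow> x \<in> parallelograms K \<and> (\<forall>y\<in>parallelograms K. fst y = fst x \<longrightarrow> area y \<le> area x)"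

lemma continuous_on_area: "continuous_on S area"
  unfolding area_def case_prod_beta by (intro continuous_intros)

lemma compact_parallelograms:
  assumes K: "compact K"
  shows "compact (parallelograms K)"
proof -
  obtain D where D: "\<forall>x\<in>K. norm x \<le> D" using compact_imp_bounded[OF K] by (auto simp: bounded_iff)
  let ?B = "sphere 0 1 \<times> K \<times> {0..2 * D} \<times> cball 0 (2 * D) :: parallelogram set"
  let ?p = "\<lambda>x :: parallelogram. fst (snd x)" and ?l = "\<lambda>x :: parallelogram. fst (snd (snd x))"
    and ?v = "\<lambda>x :: parallelogram. snd (snd (snd x))"
  let ?C = "{x. 0 \<le> perp (fst x) \<bullet> ?v x} \<inter> (\<lambda>x. ?p x + ?l x *\<^sub>R fst x) -` K \<inter> (\<lambda>x. ?p x + ?v x) -` K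
    \<inter> (\<lambda>x. ?p x + ?v x + ?l x *\<^sub>R fst x) -` K"
  have nd: "norm (x - y) \<le> 2 * D" if "x \<in> K" "y \<in> K" for x y
  proof -
    have "norm x \<le> D" "norm y \<le> D" using D that by auto
    then show ?thesis using norm_triangle_ineq4[of x y] by linarith
  qed
  have "parallelograms K = ?B \<inter> ?C"
  proof (intro equalityI subsetI)
    fix x assume "x \<in> parallelograms K"
    then obtain u p l v where x: "x = (u, p, l, v)" "norm u = 1" "0 \<le> l" "0 \<le> perp u \<bullet> v"
      "p \<in> K" "p + l *\<^sub>R u \<in> K" "p + v \<in> K" "p + v + l *\<^sub>R u \<in> K" by (auto simp: parallelograms_def)
    have "l \<le> 2 * D" using nd[OF x(6,5)] x(2,3) by simp
    moreover have "norm v \<le> 2 * D" using nd[OF x(7,5)] by simp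
    ultimately show "x \<in> ?B \<inter> ?C" using x by simp
  qed (auto simp: parallelograms_def)
  moreover have "compact ?B" by (intro compact_Times compact_sphere K compact_Icc compact_cball)
  moreover have "closed ?C"
    using compact_imp_closed[OF K]
    by (intro closed_Int closed_vimage closed_Collect_le continuous_intros) auto
  ultimately show ?thesis by (simp add: compact_Int_closed)
qed

lemma area_maximal_exists:
  assumes K: "compact K" "z \<in> K" and u: "norm u = 1"
  obtains x where "area_maximal K x" "fst x = u"
proof -
  have eq: "{x \<in> parallelograms K. fst x = u} = parallelograms K \<inter> {x. fst x = u}" by auto
  have c: "compact {x \<in> parallelograms K. fst x = u}" unfolding eq
    by (intro compact_Int_closed compact_parallelograms K closed_Collect_eq continuous_intros)
  have "(u, z, 0, 0) \<in> {x \<in> parallelograms K. fst x = u}" using K u by (simp add: parallelograms_def)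
  then have "{x \<in> parallelograms K. fst x = u} \<noteq> {}" by blast
  from continuous_attains_sup[OF c this continuous_on_area]
  show ?thesis using that unfolding area_maximal_def by blast
qed

lemma parallelograms_convex:
  assumes K: "convex K" and P: "(u, p, l, v) \<in> parallelograms K" "(u, p', l', v') \<in> parallelograms K"
    and s: "0 \<le> s" "s \<le> 1"
  shows "(u, (1 - s) *\<^sub>R p + s *\<^sub>R p', (1 - s) * l + s * l', (1 - s) *\<^sub>R v + s *\<^sub>R v') \<in> parallelograms K"
proof -
  have mix: "(1 - s) *\<^sub>R x + s *\<^sub>R y \<in> K" if "x \<in> K" "y \<in> K" for x y
    using that s by (intro convexD[OF K]) auto
  have "(1 - s) *\<^sub>R p + s *\<^sub>R p' \<in> K" "(1 - s) *\<^sub>R (p + l *\<^sub>R u) + s *\<^sub>R (p' + l' *\<^sub>R u) \<in> K"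
    "(1 - s) *\<^sub>R (p + v) + s *\<^sub>R (p' + v') \<in> K" "(1 - s) *\<^sub>R (p + v + l *\<^sub>R u) + s *\<^sub>R (p' + v' + l' *\<^sub>R u) \<in> K"
    using P by (auto intro!: mix simp: parallelograms_def)
  moreover have "(1 - s) *\<^sub>R (p + l *\<^sub>R u) + s *\<^sub>R (p' + l' *\<^sub>R u)
      = ((1 - s) *\<^sub>R p + s *\<^sub>R p') + ((1 - s) * l + s * l') *\<^sub>R u"
    "(1 - s) *\<^sub>R (p + v) + s *\<^sub>R (p' + v') = ((1 - s) *\<^sub>R p + s *\<^sub>R p') + ((1 - s) *\<^sub>R v + s *\<^sub>R v')"
    "(1 - s) *\<^sub>R (p + v + l *\<^sub>R u) + s *\<^sub>R (p' + v' + l' *\<^sub>R u)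
      = ((1 - s) *\<^sub>R p + s *\<^sub>R p') + ((1 - s) *\<^sub>R v + s *\<^sub>R v') + ((1 - s) * l + s * l') *\<^sub>R u"
    by (simp_all add: algebra_simps)
  moreover have "0 \<le> (1 - s) * l + s * l'" using P s by (simp add: parallelograms_def)
  moreover have "0 \<le> perp u \<bullet> ((1 - s) *\<^sub>R v + s *\<^sub>R v')" using P s by (simp add: parallelograms_def inner_add_right)
  ultimately show ?thesis using P by (simp add: parallelograms_def)
qed

text \<open>The product of two nonnegative affine functions with equal values at both ends of a segment
  is at least this value in between.\<close>

lemma area_maximal_mix:
  assumes K: "convex K" and P: "area_maximal K (u, p, l, v)" "area_maximal K (u, p', l', v')" and s: "0 \<le> s" "s \<le> 1"
  shows "area_maximal K (u, (1 - s) *\<^sub>R p + s *\<^sub>R p', (1 - s) * l + s * l', (1 - s) *\<^sub>R v + s *\<^sub>R v')"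
    (is "area_maximal K ?x")
proof -
  have P': "(u, p, l, v) \<in> parallelograms K" "(u, p', l', v') \<in> parallelograms K"
    using P by (auto simp: area_maximal_def)
  have x: "?x \<in> parallelograms K" by (rule parallelograms_convex[OF K P' s])
  define h where "h = perp u \<bullet> v"
  define h' where "h' = perp u \<bullet> v'"
  have nn: "0 \<le> l" "0 \<le> h" "0 \<le> l'" "0 \<le> h'" using P' by (auto simp: parallelograms_def h_def h'_def)
  have eq: "l * h = l' * h'"
    using P P' unfolding area_maximal_def by (force simp: area_def h_def h'_def)
  \<comment> \<open>The inequality of arithmetic and geometric mean for \<open>l * h'\<close> and
    \<open>l' * h\<close>, whose product is the square of the common area.\<close>
  have "2 * (l * h) \<le> l * h' + l' * h"
  proof (rule power2_le_imp_le)
    have gen: "y \<le> x" if "x - y = p + q" "q = 0" "0 \<le> p" for x y p q :: real using that by simp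
    have id: "(l * h' + l' * h)\<^sup>2 - (2 * (l * h))\<^sup>2 = (l * h' - l' * h)\<^sup>2 + 4 * (l * h) * (l' * h' - l * h)"
      by (simp add: power2_eq_square algebra_simps)
    show "(2 * (l * h))\<^sup>2 \<le> (l * h' + l' * h)\<^sup>2"
      by (rule gen[OF id _ zero_le_power2]) (use eq in simp)
    show "0 \<le> l * h' + l' * h" using nn by simp
  qed
  then have "0 \<le> s * (1 - s) * (l * h' + l' * h - 2 * (l * h))" using s by simp
  moreover have "area ?x = l * h + s * (1 - s) * (l * h' + l' * h - 2 * (l * h)) + s * s * (l' * h' - l * h)"
    by (simp add: area_def h_def h'_def inner_add_right algebra_simps)
  ultimately have "l * h \<le> area ?x" using eq by simp
  then have "area y \<le> area ?x" if "y \<in> parallelograms K" "fst y = u" for y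
    using P(1) that unfolding area_maximal_def by (fastforce simp: area_def h_def)
  then show ?thesis using x by (simp add: area_maximal_def)
qed

text \<open>A better competitor in the limit direction must be turned into competitors in the nearby
  directions \<open>U n\<close>. Shrinking it towards an interior point of \<open>K\<close> costs
  little area and leaves room to rotate its sides.\<close>

lemma area_maximal_limit:
  assumes K: "compact K" "convex K" "interior K \<noteq> {}"
    and max: "\<And>n. area_maximal K (X n)" and lim: "X \<longlonglongrightarrow> x"
  shows "area_maximal K x"
proof -
  obtain u p l v where x: "x = (u, p, l, v)" by (cases x) auto
  have "X n \<in> parallelograms K" for n using max by (simp add: area_maximal_def)
  then have xP: "x \<in> parallelograms K"
    using closed_sequentially[OF compact_imp_closed[OF compact_parallelograms[OF K(1)]] _ lim] by blast
  define U where "U n = fst (X n)" for n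
  have limU: "U \<longlonglongrightarrow> u" using tendsto_fst[OF lim] by (simp add: U_def[abs_def] x)
  have limA: "(\<lambda>n. area (X n)) \<longlonglongrightarrow> area x"
    using continuous_on_tendsto_compose[OF continuous_on_area[of UNIV] lim] by simp
  have "area y \<le> area x" if y: "y \<in> parallelograms K" "fst y = u" for y
  proof (rule ccontr)
    assume "\<not> area y \<le> area x"
    then have gt: "area x < area y" by simp
    obtain p' l' v' where y': "y = (u, p', l', v')" using y(2) by (cases y) auto
    have Y: "0 \<le> l'" "0 \<le> perp u \<bullet> v'" "p' \<in> K" "p' + l' *\<^sub>R u \<in> K" "p' + v' \<in> K" "p' + v' + l' *\<^sub>R u \<in> K"
      using y(1) by (auto simp: y' parallelograms_def)
    have ax: "0 \<le> area x" using xP by (simp add: x area_def parallelograms_def)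
    have ay: "area y = l' * (perp u \<bullet> v')" by (simp add: y' area_def)
    have "perp u \<bullet> v' \<noteq> 0" using gt ax ay by auto
    then have pos: "perp u \<bullet> v' > 0" using Y by simp
    \<comment> \<open>Shrinking by the factor \<open>1 - \<delta>\<close> multiplies the area by its
      square; this \<open>\<delta>\<close> gives away at most half of the gap between the two
      areas.\<close>
    define \<delta> where "\<delta> = min (1 / 2) ((area y - area x) / (4 * area y))"
    have ayp: "area y > 0" using gt ax by simp
    have \<delta>: "0 < \<delta>" "\<delta> \<le> 1 / 2" using gt ayp by (auto simp: \<delta>_def)
    have "\<delta> * (4 * area y) \<le> (area y - area x) / (4 * area y) * (4 * area y)"
      using ayp by (intro mult_right_mono) (auto simp: \<delta>_def)
    then have d4: "\<delta> * (4 * area y) \<le> area y - area x" using ayp by simp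
    have big: "area x < (1 - \<delta>) * ((1 - \<delta>) * area y)"
    proof -
      have "(1 - \<delta>) * ((1 - \<delta>) * area y) = area y - 2 * (\<delta> * area y) + \<delta> * \<delta> * area y" by (simp add: algebra_simps)
      moreover have "\<delta> * \<delta> * area y > 0" using \<delta> ayp by simp
      ultimately show ?thesis using d4 gt by linarith
    qed
    obtain z where z: "z \<in> interior K" using K(3) by blast
    have shrink: "w - \<delta> *\<^sub>R (w - z) \<in> interior K" if "w \<in> K" for w
      using mem_interior_convex_shrink[OF K(2) z that] \<delta> by simp
    define P where "P = p' - \<delta> *\<^sub>R (p' - z)"
    define L where "L = (1 - \<delta>) * l'"
    define V where "V = (1 - \<delta>) *\<^sub>R v'"
    have c1: "P \<in> K" "P + V \<in> K"
      using shrink[OF Y(3)] shrink[OF Y(5)] interior_subset[of K]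
      by (auto simp: P_def V_def algebra_simps)
    \<comment> \<open>\<open>P\<close> and \<open>V\<close> stay fixed when \<open>u\<close> is
      replaced by \<open>U n\<close>; these two vertices move, so they are the ones needed in the
      interior.\<close>
    have c2: "P + L *\<^sub>R u \<in> interior K" "P + V + L *\<^sub>R u \<in> interior K"
      using shrink[OF Y(4)] shrink[OF Y(6)] by (simp_all add: P_def L_def V_def algebra_simps)
    have L0: "0 \<le> L" using Y \<delta> by (simp add: L_def)
    have V0: "0 < perp u \<bullet> V" using pos \<delta> by (simp add: V_def)
    have limp: "(\<lambda>n. perp (U n)) \<longlonglongrightarrow> perp u"
      using continuous_on_tendsto_compose[OF continuous_on_perp[OF continuous_on_id] limU, of UNIV] by simp
    have "(\<lambda>n. P + L *\<^sub>R U n) \<longlonglongrightarrow> P + L *\<^sub>R u" by (intro tendsto_intros limU)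
    then have e1: "\<forall>\<^sub>F n in sequentially. P + L *\<^sub>R U n \<in> interior K"
      by (rule topological_tendstoD) (use c2 in auto)
    have "(\<lambda>n. P + V + L *\<^sub>R U n) \<longlonglongrightarrow> P + V + L *\<^sub>R u" by (intro tendsto_intros limU)
    then have e2: "\<forall>\<^sub>F n in sequentially. P + V + L *\<^sub>R U n \<in> interior K"
      by (rule topological_tendstoD) (use c2 in auto)
    have limpv: "(\<lambda>n. perp (U n) \<bullet> V) \<longlonglongrightarrow> perp u \<bullet> V" by (intro tendsto_intros limp)
    have e3: "\<forall>\<^sub>F n in sequentially. 0 < perp (U n) \<bullet> V" by (rule order_tendstoD(1)[OF limpv V0])
    have "\<forall>\<^sub>F n in sequentially. L * (perp (U n) \<bullet> V) \<le> area (X n)"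
      using e1 e2 e3
    proof eventually_elim
      case (elim n)
      have "norm (U n) = 1" using max[of n] by (auto simp: area_maximal_def parallelograms_def U_def)
      then have "(U n, P, L, V) \<in> parallelograms K"
        using elim c1 L0 interior_subset[of K] by (auto simp: parallelograms_def)
      then have "area (U n, P, L, V) \<le> area (X n)" using max[of n] by (simp add: area_maximal_def U_def)
      then show ?case by (simp add: area_def)
    qed
    then have "L * (perp u \<bullet> V) \<le> area x"
      by (intro tendsto_le[OF _ limA tendsto_mult[OF tendsto_const limpv]]) auto
    then show False using big by (simp add: L_def V_def ay mult.assoc mult.left_commute)
  qed
  then show ?thesis using xP by (simp add: area_maximal_def x)
qed

text \<open>\<open>\<sigma>\<close> will be 1 or -1, to treat both signs of the offset at once. The
  witnesses lie in the compact set of parallelograms, so a subsequence converges, and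
  \<open>area_maximal_limit\<close> keeps its limit maximal.\<close>

lemma closed_maximal_directions:
  assumes K: "compact K" "convex K" "interior K \<noteq> {}"
  shows "closed {u. \<exists>p l v. area_maximal K (u, p, l, v) \<and> 0 \<le> \<sigma> * (v \<bullet> u)}"
  unfolding closed_sequential_limits
proof (intro allI impI, elim conjE)
  fix U u assume U: "\<forall>n. U n \<in> {u. \<exists>p l v. area_maximal K (u, p, l, v) \<and> 0 \<le> \<sigma> * (v \<bullet> u)}" and lim: "U \<longlonglongrightarrow> u"
  then have "\<forall>n. \<exists>x. area_maximal K x \<and> fst x = U n \<and> 0 \<le> \<sigma> * (snd (snd (snd x)) \<bullet> fst x)" by fastforce
  from choice[OF this] obtain X where X: "\<And>n. area_maximal K (X n)" "\<And>n. fst (X n) = U n"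
    "\<And>n. 0 \<le> \<sigma> * (snd (snd (snd (X n))) \<bullet> fst (X n))" by blast
  have "\<forall>n. X n \<in> parallelograms K" using X(1) by (simp add: area_maximal_def)
  then obtain x r where r: "strict_mono r" "(X \<circ> r) \<longlonglongrightarrow> x"
    using compact_parallelograms[OF K(1)] unfolding compact_def by blast
  have m: "area_maximal K x" using area_maximal_limit[OF K _ r(2)] X(1) by simp
  have "(\<lambda>n. fst ((X \<circ> r) n)) \<longlonglongrightarrow> fst x" by (rule tendsto_fst[OF r(2)])
  moreover have "(\<lambda>n. fst ((X \<circ> r) n)) = U \<circ> r" by (simp add: X(2) o_def)
  ultimately have fx: "fst x = u" using LIMSEQ_subseq_LIMSEQ[OF lim r(1)] LIMSEQ_unique by metis
  have "(\<lambda>n. \<sigma> * (snd (snd (snd ((X \<circ> r) n))) \<bullet> fst ((X \<circ> r) n))) \<longlonglongrightarrow> \<sigma> * (snd (snd (snd x)) \<bullet> fst x)"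
    by (intro tendsto_intros r(2))
  then have "0 \<le> \<sigma> * (snd (snd (snd x)) \<bullet> fst x)"
    by (rule LIMSEQ_le_const) (use X(3) in auto)
  then show "u \<in> {u. \<exists>p l v. area_maximal K (u, p, l, v) \<and> 0 \<le> \<sigma> * (v \<bullet> u)}"
    using m fx by (cases x) auto
qed

text \<open>A ball in the interior of \<open>K\<close> contains a small square with a side in
  direction \<open>u\<close>.\<close>

lemma area_maximal_pos:
  assumes K: "interior K \<noteq> {}" and x: "area_maximal K (u, p, l, v)"
  shows "0 < area (u, p, l, v)"
proof -
  have u: "norm u = 1" using x by (auto simp: area_maximal_def parallelograms_def)
  then have uu: "u \<bullet> u = 1" by (simp add: norm_eq_1)
  have nperp: "norm (perp u) = 1" using u by (simp add: norm_eq_sqrt_inner perp_props(1-3))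
  obtain z r where r: "r > 0" "cball z r \<subseteq> K" using K mem_interior_cball by (metis ex_in_conv)
  let ?e = "r / 2"
  have in_K: "z + w \<in> K" if "norm w \<le> r" for w using r that by (auto simp: dist_norm)
  have "norm (?e *\<^sub>R perp u + ?e *\<^sub>R u) \<le> ?e + ?e"
    using norm_triangle_ineq[of "?e *\<^sub>R perp u" "?e *\<^sub>R u"] r u nperp by simp
  then have "z + (?e *\<^sub>R perp u + ?e *\<^sub>R u) \<in> K" by (intro in_K) simp
  then have "z + ?e *\<^sub>R perp u + ?e *\<^sub>R u \<in> K" by (simp only: add.assoc)
  moreover have "z \<in> K" using in_K[of 0] r by simp
  moreover have "z + ?e *\<^sub>R u \<in> K" by (rule in_K) (use r u in simp)
  moreover have "z + ?e *\<^sub>R perp u \<in> K" by (rule in_K) (use r nperp in simp)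
  moreover have "0 \<le> perp u \<bullet> (?e *\<^sub>R perp u)" using r by (simp add: perp_props(1-3) uu)
  moreover have "0 \<le> ?e" using r by simp
  ultimately have "(u, z, ?e, ?e *\<^sub>R perp u) \<in> parallelograms K"
    unfolding parallelograms_def mem_Collect_eq case_prod_conv using u by blast
  then have "area (u, z, ?e, ?e *\<^sub>R perp u) \<le> area (u, p, l, v)" using x by (simp add: area_maximal_def)
  moreover have "0 < area (u, z, ?e, ?e *\<^sub>R perp u)" using r by (simp add: area_def perp_props(1-3) uu)
  ultimately show ?thesis by linarith
qed

text \<open>A parallelogram of largest area is maximal for the directions of both pairs of its sides, and the
  offset v \<bullet> u has opposite signs there. Since the circle is connected, it vanishes in between.\<close>

lemma maximal_rectangle_direction:
  assumes K: "compact K" "convex K" "interior K \<noteq> {}"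
  obtains u p l v where "area_maximal K (u, p, l, v)" "v \<bullet> u = 0"
proof -
  let ?A = "\<lambda>\<sigma>. {u. \<exists>p l v. area_maximal K (u, p, l, v) \<and> 0 \<le> \<sigma> * (v \<bullet> u)}"
  obtain z where z: "z \<in> K" using K(3) interior_subset by blast
  have cover: "sphere 0 1 \<subseteq> ?A 1 \<union> ?A (- 1)"
  proof
    fix u :: "real^2" assume "u \<in> sphere 0 1"
    then have "norm u = 1" by simp
    then obtain x where x: "area_maximal K x" "fst x = u" using area_maximal_exists[OF K(1) z] by blast
    obtain p l v where "x = (u, p, l, v)" using x(2) by (cases x) auto
    moreover have "0 \<le> v \<bullet> u \<or> 0 \<le> - (v \<bullet> u)" by linarith
    ultimately show "u \<in> ?A 1 \<union> ?A (- 1)" using x(1) by auto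
  qed
  have "(axis 1 1, z, 0, 0) \<in> parallelograms K" using z by (simp add: parallelograms_def)
  then have "parallelograms K \<noteq> {}" by blast
  from continuous_attains_sup[OF compact_parallelograms[OF K(1)] this continuous_on_area]
  obtain x0 where x0: "x0 \<in> parallelograms K" "\<forall>y\<in>parallelograms K. area y \<le> area x0" by blast
  obtain u p l v where x0': "x0 = (u, p, l, v)" by (cases x0) auto
  have m0: "area_maximal K (u, p, l, v)" using x0 by (simp add: area_maximal_def x0')
  have pos: "0 < l * (perp u \<bullet> v)" using area_maximal_pos[OF K(3) m0] by (simp add: area_def)
  have P: "norm u = 1" "0 \<le> l" "0 \<le> perp u \<bullet> v" "p \<in> K" "p + l *\<^sub>R u \<in> K" "p + v \<in> K" "p + v + l *\<^sub>R u \<in> K"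
    using x0(1) by (auto simp: x0' parallelograms_def)
  have v0: "v \<noteq> 0" using pos by auto
  \<comment> \<open>The same parallelogram with the roles of its sides exchanged: direction
    \<open>v\<close>, offset \<open>- l\<close> times \<open>u\<close>. The area is unchanged, and
    the new offset component is \<open>- (l * (v \<bullet> u) / norm v)\<close>, of the opposite
    sign.\<close>
  define u1 where "u1 = (1 / norm v) *\<^sub>R v"
  have nu1: "norm u1 = 1" and vu1: "norm v *\<^sub>R u1 = v" using v0 by (auto simp: u1_def)
  have perp1: "perp u1 \<bullet> ((- l) *\<^sub>R u) = l * (perp u \<bullet> v) / norm v"
    by (simp add: u1_def linear_scale[OF linear_perp] perp_props(4)[of v u])
  have "(u1, p + l *\<^sub>R u, norm v, (- l) *\<^sub>R u) \<in> parallelograms K"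
    using P nu1 perp1 vu1 by (simp add: parallelograms_def algebra_simps)
  moreover have "area (u1, p + l *\<^sub>R u, norm v, (- l) *\<^sub>R u) = area x0"
    using v0 by (simp only: area_def x0' case_prod_conv perp1) simp
  ultimately have m1: "area_maximal K (u1, p + l *\<^sub>R u, norm v, (- l) *\<^sub>R u)"
    using x0(2) by (simp add: area_maximal_def)
  have vu: "((- l) *\<^sub>R u) \<bullet> u1 = - (l * (v \<bullet> u) / norm v)" by (simp add: u1_def inner_commute)
  have ne: "?A 1 \<inter> sphere 0 1 \<noteq> {}" "?A (- 1) \<inter> sphere 0 1 \<noteq> {}"
  proof -
    have "\<exists>w w'. w \<in> ?A 1 \<inter> sphere 0 1 \<and> w' \<in> ?A (- 1) \<inter> sphere 0 1"
    proof (cases "0 \<le> v \<bullet> u")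
      case True
      have "u \<in> ?A 1 \<inter> sphere 0 1" using m0 True P(1) by auto
      moreover have "0 \<le> - 1 * (((- l) *\<^sub>R u) \<bullet> u1)" unfolding vu using True P(2) by simp
      then have "u1 \<in> ?A (- 1) \<inter> sphere 0 1" using m1 nu1 by (simp only: Int_iff mem_Collect_eq mem_sphere_0) blast
      ultimately show ?thesis by blast
    next
      case False
      then have "0 \<le> - 1 * (v \<bullet> u)" by simp
      then have "u \<in> ?A (- 1) \<inter> sphere 0 1" using m0 P(1) by (simp only: Int_iff mem_Collect_eq mem_sphere_0) blast
      moreover have "0 \<le> 1 * (((- l) *\<^sub>R u) \<bullet> u1)" unfolding vu using False P(2)
        by (simp add: divide_nonpos_nonneg mult_nonneg_nonpos)
      then have "u1 \<in> ?A 1 \<inter> sphere 0 1" using m1 nu1 by (simp only: Int_iff mem_Collect_eq mem_sphere_0) blast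
      ultimately show ?thesis by blast
    qed
    then show "?A 1 \<inter> sphere 0 1 \<noteq> {}" "?A (- 1) \<inter> sphere 0 1 \<noteq> {}" by blast+
  qed
  have conn: "connected (sphere (0 :: real^2) 1)" by (rule connected_sphere) simp
  have "?A 1 \<inter> ?A (- 1) \<inter> sphere 0 1 \<noteq> {}"
  proof
    assume "?A 1 \<inter> ?A (- 1) \<inter> sphere 0 1 = {}"
    then have "\<exists>A B. closed A \<and> closed B \<and> sphere 0 1 \<subseteq> A \<union> B \<and> A \<inter> B \<inter> sphere 0 1 = {} \<and>
        A \<inter> sphere (0 :: real^2) 1 \<noteq> {} \<and> B \<inter> sphere 0 1 \<noteq> {}"
      by (intro exI[of _ "?A 1"] exI[of _ "?A (- 1)"] conjI closed_maximal_directions[OF K] cover ne)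
    then show False using conn unfolding connected_closed by simp
  qed
  then obtain w where w: "w \<in> ?A 1" "w \<in> ?A (- 1)" by blast
  obtain p1 l1 v1 where 1: "area_maximal K (w, p1, l1, v1)" "0 \<le> v1 \<bullet> w" using w(1) by auto
  obtain p2 l2 v2 where 2: "area_maximal K (w, p2, l2, v2)" "v2 \<bullet> w \<le> 0" using w(2) by auto
  \<comment> \<open>The component of the offset along \<open>w\<close> is nonnegative for one
    maximal parallelogram and nonpositive for the other. It is affine along their mixtures, which
    stay maximal by \<open>area_maximal_mix\<close>.\<close>
  have "\<exists>s. 0 \<le> s \<and> s \<le> 1 \<and> ((1 - s) *\<^sub>R v1 + s *\<^sub>R v2) \<bullet> w = 0"
  proof (cases "v1 \<bullet> w = v2 \<bullet> w")
    case True
    then show ?thesis using 1 2 by (intro exI[of _ 0]) auto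
  next
    case False
    then have d: "v1 \<bullet> w - v2 \<bullet> w > 0" using 1 2 by simp
    define s where "s = v1 \<bullet> w / (v1 \<bullet> w - v2 \<bullet> w)"
    have "s * (v1 \<bullet> w - v2 \<bullet> w) = v1 \<bullet> w" using d by (simp add: s_def)
    then have "((1 - s) *\<^sub>R v1 + s *\<^sub>R v2) \<bullet> w = 0" by (simp add: inner_add_left algebra_simps)
    moreover have "0 \<le> s" "s \<le> 1" using d 1 2 by (auto simp: s_def)
    ultimately show ?thesis by blast
  qed
  then show ?thesis using area_maximal_mix[OF K(2) 1(1) 2(1)] that by blast
qed

lemma measure_vimage_isometry:
  fixes T T' :: "'a::euclidean_space \<Rightarrow> 'a"
  assumes T: "linear T" and TT': "\<And>x. T (T' x) = x" and n: "\<And>x. norm (T x) = norm x" and X: "compact X"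
  shows "compact {w. T w + z \<in> X}" "measure lebesgue {w. T w + z \<in> X} = measure lebesgue X"
proof -
  have inj: "T x = T y \<Longrightarrow> x = y" for x y
  proof -
    assume "T x = T y"
    then have "norm (T (x - y)) = 0" by (simp add: linear_diff[OF T])
    then show "x = y" by (simp add: n)
  qed
  have T'T: "T' (T x) = x" for x by (rule inj) (rule TT')
  have T': "linear T'"
  proof (rule linearI)
    show "T' (x + y) = T' x + T' y" for x y by (rule inj) (simp add: TT' linear_add[OF T])
    show "T' (c *\<^sub>R x) = c *\<^sub>R T' x" for c x by (rule inj) (simp add: TT' linear_scale[OF T])
  qed
  let ?X = "(\<lambda>x. x - z) ` X"
  have X': "compact ?X" using X by (intro compact_continuous_image continuous_intros)
  have eq: "{w. T w + z \<in> X} = T -` ?X" by (force simp: image_iff)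
  also have "\<dots> = T' ` ?X"
  proof (intro equalityI subsetI)
    fix w assume "w \<in> T -` ?X"
    then show "w \<in> T' ` ?X" using T'T[of w] by (metis imageI vimageD)
  next
    fix w assume "w \<in> T' ` ?X"
    then show "w \<in> T -` ?X" using TT' by auto
  qed
  finally show c: "compact {w. T w + z \<in> X}"
    using X' T' by (auto intro!: compact_continuous_image linear_continuous_on simp: linear_linear)
  have "emeasure lborel {w. T w + z \<in> X} = emeasure lborel ?X"
    unfolding eq by (rule emeasure_vimage_isometry[OF T TT' n borel_compact[OF X']])
  then have "measure lebesgue {w. T w + z \<in> X} = measure lebesgue ?X"
    by (simp add: emeasure_compact_eq_measure c X')
  then show "measure lebesgue {w. T w + z \<in> X} = measure lebesgue X"
    using measure_translation_subtract[of z X] by simp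
qed

text \<open>One formula for both axes of a rectangle: \<open>s = 1\<close> reflects in the line
  along \<open>u\<close>, and \<open>s = - 1\<close> in the line along
  \<open>perp u\<close>.\<close>

lemma flat_involution_plane:
  assumes u: "norm u = 1" and s: "s = 1 \<or> s = - 1"
  shows "flat_involution 1 (\<lambda>x. s *\<^sub>R ((x \<bullet> u) *\<^sub>R u - (x \<bullet> perp u) *\<^sub>R perp u))"
    (is "flat_involution 1 ?S")
  unfolding flat_involution_def
proof (intro conjI allI)
  have uu: "u \<bullet> u = 1" using u by (simp add: norm_eq_1)
  have ss: "s * s = 1" using s by auto
  show "linear ?S" by (rule linearI) (simp_all add: inner_add_left algebra_simps)
  show "?S (?S x) = x" for x
  proof -
    have "?S x \<bullet> u = s * (x \<bullet> u)" "?S x \<bullet> perp u = - s * (x \<bullet> perp u)"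
      by (simp_all add: inner_diff_left perp_props(1-3) uu)
    then have "?S (?S x) = (s * s) *\<^sub>R ((x \<bullet> u) *\<^sub>R u + (x \<bullet> perp u) *\<^sub>R perp u)"
      by (simp only: algebra_simps scaleR_scaleR) (simp add: algebra_simps)
    then show ?thesis using perp_decomposition[OF u, of x] by (simp only: ss) simp
  qed
  show "?S x \<bullet> y = x \<bullet> ?S y" for x y
    by (simp add: inner_diff_left inner_diff_right inner_commute mult.commute)
  show "(\<Sum>b\<in>Basis. ?S b \<bullet> b) = 2 * real 1 - real DIM(real^2)"
    by (simp add: sum_Basis_vec sum_2 inner_axis inner_axis' algebra_simps)
qed

text \<open>The congruence \<open>w \<mapsto> T w + z\<close> makes the maximal rectangle centred
  and axis-parallel in \<open>K'\<close>. There \<open>flip1\<close> and \<open>flip2\<close>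
  correspond to reflections of \<open>K\<close> in lines, so each overlap is at most
  \<open>Sym 1 K\<close> times the area, while their sum is at least 5/4 of it.\<close>

lemma Sym_plane_ge:
  fixes K :: "(real^2) set"
  assumes K: "convex_body K"
  shows "5 / 8 \<le> Sym 1 K"
proof -
  have cK: "compact K" "convex K" "interior K \<noteq> {}" using K by (auto simp: convex_body_def)
  obtain u p l v where x: "area_maximal K (u, p, l, v)" and vu: "v \<bullet> u = 0"
    using maximal_rectangle_direction[OF cK] by blast
  have pos: "0 < l * (perp u \<bullet> v)" using area_maximal_pos[OF cK(3) x] by (simp add: area_def)
  have P: "norm u = 1" "0 \<le> l" "0 \<le> perp u \<bullet> v" "p \<in> K" "p + l *\<^sub>R u \<in> K" "p + v \<in> K" "p + v + l *\<^sub>R u \<in> K"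
    using x by (auto simp: area_maximal_def parallelograms_def)
  have uu: "u \<bullet> u = 1" using P(1) by (simp add: norm_eq_1)
  define a where "a = l / 2"
  define b where "b = (perp u \<bullet> v) / 2"
  have l: "l = 2 * a" and h: "perp u \<bullet> v = 2 * b" by (simp_all add: a_def b_def)
  have ab: "a > 0" "b > 0" using pos P(2,3) by (auto simp: l h zero_less_mult_iff)
  have v: "v = (2 * b) *\<^sub>R perp u"
    using perp_decomposition[OF P(1), of v] vu h by (simp add: inner_commute)
  \<comment> \<open>The centre of the rectangle with corner \<open>p\<close>.\<close>
  define z where "z = p + a *\<^sub>R u + b *\<^sub>R perp u"
  define T where "T w = (w $ 1) *\<^sub>R u + (w $ 2) *\<^sub>R perp u" for w :: "real^2"
  define T' where "T' w = (vector [w \<bullet> u, w \<bullet> perp u] :: real^2)" for w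
  have linT: "linear T" unfolding T_def by (rule linearI) (simp_all add: algebra_simps)
  have TT': "T (T' x) = x" for x using perp_decomposition[OF P(1), of x] by (simp add: T_def T'_def)
  have nT: "norm (T x) = norm x" for x
    by (simp add: norm_eq_sqrt_inner T_def inner_add_left inner_add_right perp_props(1-3) uu inner_2[of x])
  define K' where "K' = {w. T w + z \<in> K}"
  have mem: "vector [x, y] \<in> K' \<longleftrightarrow> x *\<^sub>R u + y *\<^sub>R perp u + z \<in> K" for x y by (simp add: K'_def T_def)
  note iso = measure_vimage_isometry[OF linT TT' nT]
  have cK': "compact K'" and mK': "measure lebesgue K' = measure lebesgue K"
    unfolding K'_def by (rule iso[OF cK(1)])+
  have "maximal_rectangle K' a b"
  proof
    show "convex K'"
    proof (rule convexI)
      fix x y s t assume xy: "x \<in> K'" "y \<in> K'" and st: "0 \<le> s" "0 \<le> t" "s + t = (1::real)"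
      have "s *\<^sub>R (T x + z) + t *\<^sub>R (T y + z) \<in> K"
        using xy st by (intro convexD[OF cK(2)]) (auto simp: K'_def)
      moreover have "s *\<^sub>R (T x + z) + t *\<^sub>R (T y + z) = T (s *\<^sub>R x + t *\<^sub>R y) + (s + t) *\<^sub>R z"
        by (simp add: linear_add[OF linT] linear_scale[OF linT] algebra_simps)
      ultimately show "s *\<^sub>R x + t *\<^sub>R y \<in> K'" using st(3) by (simp add: K'_def)
    qed
    show "a > 0" "b > 0" by (rule ab)+
    have "a *\<^sub>R u + b *\<^sub>R perp u + z = p + v + l *\<^sub>R u" "(- a) *\<^sub>R u + b *\<^sub>R perp u + z = p + v"
      "a *\<^sub>R u + (- b) *\<^sub>R perp u + z = p + l *\<^sub>R u" "(- a) *\<^sub>R u + (- b) *\<^sub>R perp u + z = p"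
      unfolding v l z_def mult_2 scaleR_left_distrib by simp_all
    then show "vector [a, b] \<in> K'" "vector [- a, b] \<in> K'" "vector [a, - b] \<in> K'" "vector [- a, - b] \<in> K'"
      unfolding mem using P(4-7) by simp_all
    fix x1 y1 x2 y2 m
    assume Q: "vector [x1, y1] \<in> K'" "vector [x1 + m, y1] \<in> K'" "vector [x2, y2] \<in> K'" "vector [x2 + m, y2] \<in> K'"
      and m: "0 \<le> m"
    show "m * (y2 - y1) \<le> 4 * a * b"
    proof (cases "0 \<le> y2 - y1")
      case True
      let ?p = "x1 *\<^sub>R u + y1 *\<^sub>R perp u + z" and ?v = "(x2 - x1) *\<^sub>R u + (y2 - y1) *\<^sub>R perp u"
      have hv: "perp u \<bullet> ?v = y2 - y1" by (simp add: inner_add_right perp_props(1-3) uu)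
      have e1: "?p + m *\<^sub>R u = (x1 + m) *\<^sub>R u + y1 *\<^sub>R perp u + z"
        and e2: "?p + ?v = x2 *\<^sub>R u + y2 *\<^sub>R perp u + z"
        and e3: "?p + ?v + m *\<^sub>R u = (x2 + m) *\<^sub>R u + y2 *\<^sub>R perp u + z"
        by (simp_all add: algebra_simps)
      have "?p \<in> K" using Q(1) unfolding mem .
      moreover have "?p + m *\<^sub>R u \<in> K" unfolding e1 using Q(2) unfolding mem .
      moreover have "?p + ?v \<in> K" unfolding e2 using Q(3) unfolding mem .
      moreover have "?p + ?v + m *\<^sub>R u \<in> K" unfolding e3 using Q(4) unfolding mem .
      ultimately have "(u, ?p, m, ?v) \<in> parallelograms K"
        unfolding parallelograms_def mem_Collect_eq case_prod_conv hv using P(1) m True by blast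
      then have "area (u, ?p, m, ?v) \<le> area (u, p, l, v)" using x by (simp add: area_maximal_def)
      then have "m * (y2 - y1) \<le> l * (perp u \<bullet> v)" unfolding area_def case_prod_conv hv .
      then show ?thesis unfolding l h by simp
    next
      case False
      then have "m * (y2 - y1) \<le> 0" using m by (simp add: mult_nonneg_nonpos)
      moreover have "0 < 4 * a * b" using ab by simp
      ultimately show ?thesis by linarith
    qed
  qed
  then interpret maximal_rectangle K' a b .
  have ov: "overlap K' R \<le> Sym 1 K * measure lebesgue K"
    if s: "s = 1 \<or> s = - 1" and R: "\<And>w. R w = vector [s * w $ 1, - s * w $ 2]" for s R
  proof -
    let ?S = "\<lambda>x. s *\<^sub>R ((x \<bullet> u) *\<^sub>R u - (x \<bullet> perp u) *\<^sub>R perp u)"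
    have S: "flat_involution 1 ?S" by (rule flat_involution_plane[OF P(1) s])
    define e where "e = z - ?S z"
    have lS: "linear ?S" using flat_involutionD(1)[OF S] .
    have "?S e = ?S z - ?S (?S z)" unfolding e_def by (rule linear_diff[OF lS])
    then have Se: "?S e = - e" unfolding flat_involutionD(2)[OF S] by (simp add: e_def)
    have key: "?S (T w + z) + e = T (R w) + z" for w
    proof -
      have "?S (T w + z) = ?S (T w) + ?S z" by (rule linear_add[OF lS])
      moreover have "T w \<bullet> u = w $ 1" "T w \<bullet> perp u = w $ 2"
        by (simp_all add: T_def inner_add_left perp_props(1-3) uu)
      then have "?S (T w) = T (R w)" by (simp add: T_def R algebra_simps)
      ultimately show ?thesis by (simp add: e_def)
    qed
    have "{w \<in> K'. R w \<in> K'} = {w. T w + z \<in> {x \<in> K. ?S x + e \<in> K}}"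
      by (simp add: K'_def key)
    then have "overlap K' R = overlap K (\<lambda>x. ?S x + e)"
      unfolding overlap_def using iso(2)[OF compact_overlap_set[OF cK(1) continuous_reflection[OF S]]] by simp
    also have "\<dots> \<le> Sym 1 K * measure lebesgue K" by (rule Sym_upper[OF K S Se])
    finally show ?thesis .
  qed
  have "overlap K' flip1 \<le> Sym 1 K * measure lebesgue K" by (rule ov[of "- 1"]) auto
  moreover have "overlap K' flip2 \<le> Sym 1 K * measure lebesgue K" by (rule ov[of 1]) auto
  ultimately have "5 / 4 * measure lebesgue K \<le> 2 * Sym 1 K * measure lebesgue K"
    using overlaps_ge[OF cK'] unfolding mK' by linarith
  then have "5 / 4 \<le> 2 * Sym 1 K"
    using convex_body_measure_pos[OF K] by (simp only: mult_le_cancel_right_pos)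
  then show ?thesis by simp
qed

subsection \<open>Iterated cones\<close>

text \<open>With \<open>x = 1 - \<rho>\<close> one has
  \<open>(2 - \<rho>) * \<rho> = 1 - x\<^sup>2\<close>. Since \<open>\<rho> ^ m = 1 / 2\<close>,
  Bernoulli's inequality gives \<open>(2 - \<rho>) ^ m / 2 \<ge> 1 - m * x\<^sup>2\<close>, and 4/5
  on the right yields 5/8.\<close>

lemma cone_bound_le:
  assumes m: "m \<ge> 2"
  shows "(2 - 2 powr (- 1 / real m)) powr (- real m) \<le> 5 / 8"
proof -
  define \<rho> where "\<rho> = (2::real) powr (- 1 / real m)"
  define x where "x = 1 - \<rho>"
  have rpos: "\<rho> > 0" by (simp add: \<rho>_def)
  have "\<rho> < 2 powr 0" unfolding \<rho>_def using m by (intro powr_less_mono) auto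
  then have r1: "\<rho> < 1" by simp
  have x01: "0 < x" "x < 1" using rpos r1 by (auto simp: x_def)
  have rm: "\<rho> ^ m = 1 / 2"
  proof -
    have "\<rho> ^ m = \<rho> powr real m" using rpos by (simp add: powr_realpow)
    also have "\<dots> = 2 powr (-1)" unfolding \<rho>_def powr_powr using m by simp
    finally show ?thesis by (simp add: powr_minus_divide)
  qed
  \<comment> \<open>From \<open>m = 3\<close> on, \<open>x \<le> ln 2 / m\<close> is enough. For
    \<open>m = 2\<close> that estimate would give about 0.24, so \<open>\<rho> \<ge> 7 / 10\<close>
    is used instead.\<close>
  have mx: "real m * (x * x) \<le> 1 / 5"
  proof (cases "m = 2")
    case True
    have "\<rho> * \<rho> = 1 / 2" using rm True by (simp add: power2_eq_square)
    moreover have "\<rho> * \<rho> < 7 / 10 * (7 / 10)" if "\<rho> < 7 / 10" using that rpos by (intro mult_strict_mono) auto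
    ultimately have "7 / 10 \<le> \<rho>" by force
    then have "x \<le> 3 / 10" by (simp add: x_def)
    then have "x * x \<le> 3 / 10 * (3 / 10)" using x01 by (intro mult_mono) auto
    then show ?thesis using True by simp
  next
    case False
    then have m3: "real m \<ge> 3" using m by simp
    have "\<rho> = exp (- (ln 2 / real m))" by (simp add: \<rho>_def powr_def)
    then have "1 + - (ln 2 / real m) \<le> \<rho>" using exp_ge_add_one_self[of "- (ln 2 / real m)"] by simp
    then have "x \<le> ln 2 / real m" by (simp add: x_def)
    then have "real m * x \<le> ln 2" using m3 by (simp add: field_simps)
    then have mx1: "real m * x \<le> 25 / 36" using ln2_le_25_over_36 by linarith
    then have "(real m * x) * (real m * x) \<le> 25 / 36 * (25 / 36)" using x01 by (intro mult_mono) auto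
    then have "real m * (real m * (x * x)) \<le> 3 / 5" by (simp add: algebra_simps)
    moreover have "3 * (real m * (x * x)) \<le> real m * (real m * (x * x))" using m3 by (intro mult_right_mono) auto
    ultimately show ?thesis by linarith
  qed
  have "1 + real m * (- (x * x)) \<le> (1 + - (x * x)) ^ m"
    using x01 mult_le_one[of x x] by (intro Bernoulli_inequality) auto
  also have "1 + - (x * x) = (2 - \<rho>) * \<rho>" by (simp add: x_def algebra_simps)
  finally have "4 / 5 \<le> (2 - \<rho>) ^ m * (1 / 2)" using mx by (simp add: power_mult_distrib rm)
  then have ge: "8 / 5 \<le> (2 - \<rho>) ^ m" by simp
  have "(2 - \<rho>) powr (- real m) = 1 / (2 - \<rho>) ^ m"
    using r1 by (simp add: powr_minus_divide powr_realpow)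
  also have "\<dots> \<le> 1 / (8 / 5)" using ge by (intro divide_left_mono) auto
  finally show ?thesis by (simp add: \<rho>_def)
qed

lemma sym_le_mono:
  assumes "sym_le d F C s" "s \<le> t"
  shows "sym_le d F C t"
  unfolding sym_le_def
proof (intro allI impI)
  fix S e assume "flat_involution d S" "\<forall>w\<in>F. S w = w" "S e = - e"
  then have "overlap C (\<lambda>x. S x + e) \<le> s * measure lebesgue C" using assms(1) by (simp add: sym_le_def)
  also have "\<dots> \<le> t * measure lebesgue C" using assms(2) by (intro mult_right_mono) auto
  finally show "overlap C (\<lambda>x. S x + e) \<le> t * measure lebesgue C" .
qed

text \<open>Induction on the number of cube coordinates, one cone for each, with half of the
  remaining \<open>\<delta>\<close> spent every time. \<open>5 / 8 \<le> s\<close> absorbs the cone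
  term by \<open>cone_bound_le\<close>. \<open>d\<close> stays fixed, since it already counts the
  cube axes.\<close>

lemma exists_iterated_cone:
  fixes C :: "(real^'n) set"
  assumes "convex_body C" "cylindrical J C" "sym_le d ((\<lambda>j. axis j 1) ` J) C s"
    and "2 \<le> card (- J)" "5 / 8 \<le> s" "\<delta> > 0"
  shows "\<exists>C' :: (real^'n) set. convex_body C' \<and> sym_le d {} C' (s + \<delta>)"
  using assms
proof (induction "card J" arbitrary: J C s \<delta>)
  case 0
  then have "J = {}" by simp
  then show ?case using 0 sym_le_mono[of d "{}" C s "s + \<delta>"] by auto
next
  case (Suc n)
  then obtain j0 where j0: "j0 \<in> J" by (metis card.empty ex_in_conv nat.distinct(1))
  let ?q = "(2 - 2 powr (- 1 / real (card (- J)))) powr (- real (card (- J)))"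
  obtain C1 where C1: "convex_body C1" "cylindrical (J - {j0}) C1"
    "sym_le d ((\<lambda>j. axis j 1) ` (J - {j0})) C1 (max ?q s + \<delta> / 2)"
    using exists_tall_cone[OF Suc.prems(1,2) j0 Suc.prems(3), of "\<delta> / 2"] Suc.prems(4,6) by auto
  have "?q \<le> s" using cone_bound_le[OF Suc.prems(4)] Suc.prems(5) by linarith
  then have mx: "max ?q s + \<delta> / 2 = s + \<delta> / 2" by simp
  have "n = card (J - {j0})" using Suc.hyps(2) j0 by simp
  moreover have "2 \<le> card (- (J - {j0}))"
  proof -
    have "card (- J) \<le> card (- (J - {j0}))" by (rule card_mono) auto
    then show ?thesis using Suc.prems(4) by linarith
  qed
  ultimately have "\<exists>C' :: (real^'n) set. convex_body C' \<and> sym_le d {} C' ((s + \<delta> / 2) + \<delta> / 2)"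
    using Suc.hyps(1)[OF _ C1(1,2) C1(3)[unfolded mx], of "\<delta> / 2"] Suc.prems(5,6) by simp
  moreover have "s + \<delta> / 2 + \<delta> / 2 = s + \<delta>" by simp
  ultimately show ?case by (simp only:)
qed

lemma card_Compl_range:
  fixes g :: "'a::finite \<Rightarrow> 'b::finite"
  assumes "inj g"
  shows "card (- range g) = CARD('b) - CARD('a)"
  using assms by (simp add: Compl_eq_Diff_UNIV card_Diff_subset card_image)

lemma inj_exists:
  assumes "CARD('a::finite) \<le> CARD('b::finite)"
  obtains g :: "'a::finite \<Rightarrow> 'b::finite" where "inj g"
  using card_le_inj[of "UNIV :: 'a set" "UNIV :: 'b set"] assms by auto

text \<open>A cylinder with a single cube coordinate and one cone over it. The epsilon is shared
  between the choice of \<open>K\<close> and that of the cone's height.\<close>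

lemma sigma_Suc_le:
  assumes n: "CARD('n::finite) \<ge> 1" and k: "k < CARD('n)" and m: "CARD('m::finite) = CARD('n) + 1"
  shows "sigma TYPE(real^'m) (k + 1) \<le> max ((2 - 2 powr (- 1 / real CARD('n))) powr (- real CARD('n))) (sigma TYPE(real^'n) k)"
    (is "_ \<le> max ?q ?\<sigma>")
proof (rule field_le_epsilon)
  fix \<epsilon> :: real assume "\<epsilon> > 0"
  then have e: "\<epsilon> / 2 > 0" by simp
  obtain K :: "(real^'n) set" where K: "convex_body K" "Sym k K \<le> ?\<sigma> + \<epsilon> / 2"
    using sigma_approx[OF e] by blast
  obtain g :: "'n \<Rightarrow> 'm" where g: "inj g" using inj_exists[where 'a = 'n and 'b = 'm] m by auto
  have c1: "card (- range g) = 1" using card_Compl_range[OF g] m by simp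
  then obtain j0 where j0: "- range g = {j0}" by (metis card_1_singletonE)
  have cr: "card (- (- range g)) = CARD('n)" using g by (simp add: card_image)
  have "\<exists>C'. convex_body C' \<and> cylindrical (- range g - {j0}) C' \<and>
     sym_le (k + 1) ((\<lambda>j. axis j 1) ` (- range g - {j0})) C' (max ?q (Sym k K) + \<epsilon> / 2)"
    using exists_tall_cone[OF convex_body_cylinder[OF g K(1)] cylindrical_cylinder[OF g] _
      sym_le_cylinder[OF g K(1), of k] _ e, of j0] n cr unfolding j0 by simp
  then obtain C' :: "(real^'m) set" where C': "convex_body C'" "sym_le (k + 1) {} C' (max ?q (Sym k K) + \<epsilon> / 2)"
    unfolding j0 by auto
  have d: "k + 1 \<le> DIM(real^'m)" using k m by simp
  have "sigma TYPE(real^'m) (k + 1) \<le> max ?q (Sym k K) + \<epsilon> / 2"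
    using sigma_le_Sym[OF C'(1) d] Sym_le[OF C' d] by linarith
  also have "\<dots> \<le> max ?q ?\<sigma> + \<epsilon>" using K(2) e by (auto simp: max_def)
  finally show "sigma TYPE(real^'m) (k + 1) \<le> max ?q ?\<sigma> + \<epsilon>" .
qed

text \<open>Start from lines in the plane: the \<open>n - 2\<close> cube axes that a reflection has
  to fix raise the dimension of its flat from 1 to \<open>n - 1\<close>.\<close>

lemma sigma_hyperplane_le:
  assumes n: "CARD('n::finite) \<ge> 2"
  shows "sigma TYPE(real^'n) (CARD('n) - 1) \<le> sigma TYPE(real^2) 1"
proof (rule field_le_epsilon)
  fix \<epsilon> :: real assume "\<epsilon> > 0"
  then have e: "\<epsilon> / 2 > 0" by simp
  obtain K :: "(real^2) set" where K: "convex_body K" "Sym 1 K \<le> sigma TYPE(real^2) 1 + \<epsilon> / 2"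
    using sigma_approx[OF e] by blast
  obtain g :: "2 \<Rightarrow> 'n" where g: "inj g" using inj_exists[where 'a = 2 and 'b = 'n] n by auto
  have d: "1 + card (- range g) = CARD('n) - 1" using card_Compl_range[OF g] n by simp
  have cr: "card (- (- range g)) = 2" using g by (simp add: card_image)
  obtain C' :: "(real^'n) set" where C': "convex_body C'" "sym_le (CARD('n) - 1) {} C' (Sym 1 K + \<epsilon> / 2)"
    using exists_iterated_cone[OF convex_body_cylinder[OF g K(1)] cylindrical_cylinder[OF g]
      sym_le_cylinder[OF g K(1), of 1], of "\<epsilon> / 2"] Sym_plane_ge[OF K(1)] e unfolding cr d by auto
  have dim: "CARD('n) - 1 \<le> DIM(real^'n)" by simp
  have "sigma TYPE(real^'n) (CARD('n) - 1) \<le> Sym 1 K + \<epsilon> / 2"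
    using sigma_le_Sym[OF C'(1) dim] Sym_le[OF C' dim] by linarith
  then show "sigma TYPE(real^'n) (CARD('n) - 1) \<le> sigma TYPE(real^2) 1 + \<epsilon>" using K(2) by linarith
qed

theorem theorem1p2:
  fixes k :: nat
  assumes "CARD('n::finite) \<ge> 2"
    and "k < CARD('n)"
    and "CARD('m::finite) = CARD('n) + 1"
  shows "sigma TYPE(real^'m) (k + 1)
           \<le> max ((2 - 2 powr (- 1 / real CARD('n))) powr (- real CARD('n)))
                  (sigma TYPE(real^'n) k)
       \<and> sigma TYPE(real^'n) (CARD('n) - 1) \<le> sigma TYPE(real^2) 1
       \<and> sigma TYPE(real^2) 1 \<le> (sqrt 2 + 1) / 3"
  using sigma_Suc_le[OF _ assms(2,3)] sigma_hyperplane_le[OF assms(1)] sigma_plane_le assms(1) by simp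

end
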